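(* For the stable retrial queue described in the context, and for each fixed $n\ge1$, the joint probabilities $\pi_{m,n}(1)$ have the following tail asymptotics as $m\to\infty$. Type 1 (exact geometric decay): if $x_{dom}=x^*=x_+<x_3$, then $$\pi_{m,n}(1)\sim A_1(x_+)\left(\frac1{Y_1(x_+)}\right)^{n-1}\left(\frac1{x_+}\right)^{m-1}.$$ Type 2 (geometric decay with prefactor $m^{-1/2}$): if $x_{dom}=x_3=x^*=x_+$, then $$\pi_{m,n}(1)\sim\frac{A_2(x_{dom})}{\sqrt\pi}\left(\frac1{Y_1(x_{dom})}\right)^{n-1}m^{-1/2}\left(\frac1{x_{dom}}\right)^{m-1}.$$ Type 3 (geometric decay with prefactor $m^{-3/2}$): if $x_{dom}=x_3<x^*=+\infty$, then $$\pi_{m,n}(1)\sim\frac{A_3(x_3)+(n-1)B_3(x_3)}{\sqrt\pi}\left(\frac1{Y_1(x_3)}\right)^{n-1}m^{-3/2}\left(\frac1{x_3}\right)^{m-2}.$$ Here $A_i(x_{dom})=-\frac{b_1(x_{dom})}{c(x_{dom})}C_{i,0}$ for $i=1,2,3$ and $B_3(x_3)=-\frac{p_1(x_3)}{c(x_3)}C_{3,0}$, with all quantities as defined in the context.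
   Context: Model. $\lambda_1,\lambda_2,\mu,\mu_1,\mu_2>0$, $\lambda=\lambda_1+\lambda_2$, normalized so that $\lambda+\mu+\mu_1+\mu_2=1$. Consider the continuous-time Markov chain on $\{0,1,\dots\}^2\times\{0,1\}$ with states $(m,n,k)$ ($m,n$ = numbers of customers in orbits 1 and 2, $k=0$ idle server, $k=1$ busy server) and transition rates: from $(m,n,0)$ to $(m,n,1)$ at rate $\lambda$, to $(m-1,n,1)$ at rate $\mu_1$ if $m\ge1$, to $(m,n-1,1)$ at rate $\mu_2$ if $n\ge 1$; from $(m,n,1)$ to $(m+1,n,1)$ at rate $\lambda_1$, to $(m,n+1,1)$ at rate $\lambda_2$, to $(m,n,0)$ at rate $\mu$. Write $\alpha=\lambda+\mu_1+\mu_2=1-\mu$, $\hat\lambda_i=\alpha\lambda_i$, $\hat\mu_i=\mu\mu_i$. Standing assumptions: stability, i.e. $\lambda(\lambda_i+\mu_i)<\mu\mu_i$ for $i=1,2$; and $\hat\lambda_1<\hat\mu_1$. $\pi_{m,n}(k)$ denotes the unique stationary distribution. Generating functions: $\pi_1^{(1)}(x)=\sum_{m\ge1}\pi_{m,0}(1)x^{m-1}$, $\pi_2^{(1)}(y)=\sum_{n\ge1}\pi_{0,n}(1)y^{n-1}$; the same symbols denote their analytic continuations. The dominant singularity $x_{dom}$ of $\pi_1^{(1)}$ is its singularity of smallest modulus. Functions: $\hat b(x)=\hat\lambda_1x^2-(\hat\lambda_1+\hat\lambda_2+\hat\mu_1+\hat\mu_2)x+\hat\mu_1$; $b_\pm(x)=\hat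 b(x)\pm 2x\sqrt{\hat\lambda_2\hat\mu_2}$; $\Delta=b_+b_-$. The zeros of $b_+$ are $x_2<x_3$ and those of $b_-$ are $x_1<x_4$ (so $x_1<x_2<x_3<x_4$). $Y_\pm(x)=\frac{-\hat b(x)\pm\sqrt{\Delta(x)}}{2\hat\lambda_2x}$ are the two roots $y$ of the kernel equation $\hat\lambda_2xy^2+\hat b(x)y+\hat\mu_2x=0$; $Y_0(x)$ is the one of smaller modulus and $Y_1(x)$ the other ($Y_0=Y_-,Y_1=Y_+$ if $|Y_-|\le|Y_+|$, and otherwise interchanged). $h_1(x,y)=a_1(x)y+b_1(x)$ with $a_1(x)=\lambda_2x$, $b_1(x)=\lambda_1x^2-\big(\lambda+\frac{\hat\mu_1}{\lambda+\mu_1}\big)x+\frac{\hat\mu_1}{\lambda+\mu_1}$; $h_2(x,y)=\lambda_2y^2+\big(\lambda_1x-\lambda-\frac{\hat\mu_2}{\lambda+\mu_2}\big)y+\frac{\hat\mu_2}{\lambda+\mu_2}$; $h_0(x,y)=\lambda_1x+\lambda_2y-\lambda$; $c(x)=\frac{\hat\mu_2}{\alpha}x$; $p_1(x)=-\frac{\hat b(x)a_1(x)}{2\hat\lambda_2x}+b_1(x)$. $x_+>0>x_-$ are the two zeros of $g(x)=\lambda\lambda_1(\lambda+\mu_1)x^2+\lambda\mu_1(\lambda+\mu_1-\mu)x-\mu\mu_1^2$. $x^*$ is the unique zero of $h_1(x,Y_0(x))$ in $(1,x_3]$ if such a zero exists, and $x^*=+\infty$ otherwise. Constants: with $N(x,y)=h_2(x,y)\pi_2^{(1)}(y)+h_0(x,y)\pi_{0,0}(1)$,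 $$C_{1,0}=\frac{(\lambda+\mu_1)\sqrt{\Delta(x_+)}\,N(x_+,Y_0(x_+))}{\hat\mu_2\lambda\lambda_1x_+(x_+-1)(x_+-x_-)},$$ $$C_{2,0}=\frac2{\lambda_1}\cdot\frac{N(x_{dom},Y_0(x_{dom}))}{\sqrt{x_{dom}(x_{dom}-x_1)(x_{dom}-x_2)(x_4-x_{dom})}},$$ $$C_{3,0}=-\frac{q(x_3)}{2x_3}\,\frac{\partial}{\partial y}\left[-\frac{N(x_3,y)}{h_1(x_3,y)}\right]_{y=Y_0(x_3)},\qquad q(x)=-\frac1{2\hat\lambda_2x}\sqrt{\frac{\Delta(x)}{1-x/x_3}}$$ (with $q(x_3)$ the limiting value at $x_3$). $a_m\sim b_m$ means $a_m/b_m\to1$. *)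

theory Defs
  imports "HOL-Complex_Analysis.Complex_Analysis"
begin

section \<open>The retrial queue\<close>

record retrial_params =
  lam1 :: real
  lam2 :: real
  mu :: real
  mu1 :: real
  mu2 :: real

definition lam :: "retrial_params \<Rightarrow> real" where
  "lam q = lam1 q + lam2 q"

definition alpha :: "retrial_params \<Rightarrow> real" where
  "alpha q = lam q + mu1 q + mu2 q"

definition lamh1 :: "retrial_params \<Rightarrow> real" where "lamh1 q = alpha q * lam1 q"
definition lamh2 :: "retrial_params \<Rightarrow> real" where "lamh2 q = alpha q * lam2 q"
definition muh1 :: "retrial_params \<Rightarrow> real" where "muh1 q = mu q * mu1 q"
definition muh2 :: "retrial_params \<Rightarrow> real" where "muh2 q = mu q * mu2 q"

definition retrial_model :: "retrial_params \<Rightarrow> bool" where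
  "retrial_model q \<longleftrightarrow>
     lam1 q > 0 \<and> lam2 q > 0 \<and> mu q > 0 \<and> mu1 q > 0 \<and> mu2 q > 0 \<and>
     lam q + mu q + mu1 q + mu2 q = 1"

definition stable_queue :: "retrial_params \<Rightarrow> bool" where
  "stable_queue q \<longleftrightarrow>
     lam q * (lam1 q + mu1 q) < mu q * mu1 q \<and>
     lam q * (lam2 q + mu2 q) < mu q * mu2 q"

datatype server = Idle | Busy

type_synonym state = "nat \<times> nat \<times> server"

fun rate :: "retrial_params \<Rightarrow> state \<Rightarrow> state \<Rightarrow> real" where
  "rate q (m, n, Idle) t =
     (if t = (m, n, Busy) then lam q
      else if m \<ge> 1 \<and> t = (m - 1, n, Busy) then mu1 q
      else if n \<ge> 1 \<and> t = (m, n - 1, Busy) then mu2 q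
      else 0)"
| "rate q (m, n, Busy) t =
     (if t = (m + 1, n, Busy) then lam1 q
      else if t = (m, n + 1, Busy) then lam2 q
      else if t = (m, n, Idle) then mu q
      else 0)"

text \<open>Both infinite sums in the balance equations have finitely many nonzero terms.\<close>

definition stationary_distribution :: "retrial_params \<Rightarrow> (state \<Rightarrow> real) \<Rightarrow> bool" where
  "stationary_distribution q P \<longleftrightarrow>
     (\<forall>s. P s \<ge> 0) \<and> (P has_sum 1) UNIV \<and>
     (\<forall>s. P s * (\<Sum>\<^sub>\<infinity>t. rate q s t) = (\<Sum>\<^sub>\<infinity>t. P t * rate q t s))"


section \<open>Generating functions, analytic continuation and singularities\<close>

text \<open>
  Index shift: the coefficient of the power \<open>j\<close> is the probability with orbit size \<open>j + 1\<close>.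
\<close>

definition gf1 :: "(state \<Rightarrow> real) \<Rightarrow> nat \<Rightarrow> complex" where
  "gf1 P j = complex_of_real (P (j + 1, 0, Busy))"

definition gf2 :: "(state \<Rightarrow> real) \<Rightarrow> nat \<Rightarrow> complex" where
  "gf2 P j = complex_of_real (P (0, j + 1, Busy))"

text \<open>
  A power series \<open>\<Sum>k. a k * z ^ k\<close> is continued along straight rays from the origin, i.e.\ inside
  its Mittag-Leffler star.  Domains that are star-shaped about the origin are connected, and so is
  the intersection of two of them, so the continuation is single-valued by the identity theorem.
\<close>

definition continues_series :: "(nat \<Rightarrow> complex) \<Rightarrow> complex set \<Rightarrow> (complex \<Rightarrow> complex) \<Rightarrow> bool" where
  "continues_series a U F \<longleftrightarrow>
     open U \<and> (\<forall>z\<in>U. closed_segment 0 z \<subseteq> U) \<and> F holomorphic_on U \<and>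
     (\<forall>\<^sub>F z in nhds 0. (\<lambda>k. a k * z ^ k) sums F z)"

definition regular_point :: "(nat \<Rightarrow> complex) \<Rightarrow> complex \<Rightarrow> bool" where
  "regular_point a z \<longleftrightarrow> (\<exists>U F. continues_series a U F \<and> z \<in> U)"

definition continuation :: "(nat \<Rightarrow> complex) \<Rightarrow> complex \<Rightarrow> complex" where
  "continuation a z = (THE v. \<exists>U F. continues_series a U F \<and> z \<in> U \<and> F z = v)"

text \<open>A singularity is the first obstruction met on its ray; points behind it are not counted.\<close>

definition singularity :: "(nat \<Rightarrow> complex) \<Rightarrow> complex \<Rightarrow> bool" where
  "singularity a z \<longleftrightarrow>
     \<not> regular_point a z \<and> (\<forall>t. 0 \<le> t \<and> t < 1 \<longrightarrow> regular_point a (complex_of_real t * z))"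

definition dominant_singularity :: "(nat \<Rightarrow> complex) \<Rightarrow> complex \<Rightarrow> bool" where
  "dominant_singularity a z \<longleftrightarrow>
     singularity a z \<and> (\<forall>w. singularity a w \<longrightarrow> cmod z \<le> cmod w)"

text \<open>The coefficients are real, so the continuation is real at regular points of the real axis.\<close>

definition pi2 :: "(state \<Rightarrow> real) \<Rightarrow> real \<Rightarrow> real" where
  "pi2 P y = Re (continuation (gf2 P) (complex_of_real y))"


section \<open>The kernel and its branches\<close>

definition bhat :: "retrial_params \<Rightarrow> real \<Rightarrow> real" where
  "bhat q x = lamh1 q * x\<^sup>2 - (lamh1 q + lamh2 q + muh1 q + muh2 q) * x + muh1 q"

definition b_plus :: "retrial_params \<Rightarrow> real \<Rightarrow> real" where
  "b_plus q x = bhat q x + 2 * x * sqrt (lamh2 q * muh2 q)"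

definition b_minus :: "retrial_params \<Rightarrow> real \<Rightarrow> real" where
  "b_minus q x = bhat q x - 2 * x * sqrt (lamh2 q * muh2 q)"

definition Delta :: "retrial_params \<Rightarrow> real \<Rightarrow> real" where
  "Delta q x = b_plus q x * b_minus q x"

definition x_1 :: "retrial_params \<Rightarrow> real" where "x_1 q = Min {x. b_minus q x = 0}"
definition x_2 :: "retrial_params \<Rightarrow> real" where "x_2 q = Min {x. b_plus q x = 0}"
definition x_3 :: "retrial_params \<Rightarrow> real" where "x_3 q = Max {x. b_plus q x = 0}"
definition x_4 :: "retrial_params \<Rightarrow> real" where "x_4 q = Max {x. b_minus q x = 0}"

text \<open>
  The branches are only needed at real \<open>x\<close> with \<open>1 < x \<le> x_3 q\<close>, where \<open>Delta q x \<ge> 0\<close>; outside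
  such ranges the real \<open>sqrt\<close> below has no meaning for the model.
\<close>

definition Y_minus :: "retrial_params \<Rightarrow> real \<Rightarrow> real" where
  "Y_minus q x = (- bhat q x - sqrt (Delta q x)) / (2 * lamh2 q * x)"

definition Y_plus :: "retrial_params \<Rightarrow> real \<Rightarrow> real" where
  "Y_plus q x = (- bhat q x + sqrt (Delta q x)) / (2 * lamh2 q * x)"

definition Y0 :: "retrial_params \<Rightarrow> real \<Rightarrow> real" where
  "Y0 q x = (if \<bar>Y_minus q x\<bar> \<le> \<bar>Y_plus q x\<bar> then Y_minus q x else Y_plus q x)"

definition Y1 :: "retrial_params \<Rightarrow> real \<Rightarrow> real" where
  "Y1 q x = (if \<bar>Y_minus q x\<bar> \<le> \<bar>Y_plus q x\<bar> then Y_plus q x else Y_minus q x)"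

definition a1 :: "retrial_params \<Rightarrow> real \<Rightarrow> real" where
  "a1 q x = lam2 q * x"

definition b1 :: "retrial_params \<Rightarrow> real \<Rightarrow> real" where
  "b1 q x = lam1 q * x\<^sup>2 - (lam q + muh1 q / (lam q + mu1 q)) * x + muh1 q / (lam q + mu1 q)"

definition h1 :: "retrial_params \<Rightarrow> real \<Rightarrow> real \<Rightarrow> real" where
  "h1 q x y = a1 q x * y + b1 q x"

definition h2 :: "retrial_params \<Rightarrow> real \<Rightarrow> real \<Rightarrow> real" where
  "h2 q x y = lam2 q * y\<^sup>2 + (lam1 q * x - lam q - muh2 q / (lam q + mu2 q)) * y
              + muh2 q / (lam q + mu2 q)"

definition h0 :: "retrial_params \<Rightarrow> real \<Rightarrow> real \<Rightarrow> real" where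
  "h0 q x y = lam1 q * x + lam2 q * y - lam q"

definition c :: "retrial_params \<Rightarrow> real \<Rightarrow> real" where
  "c q x = muh2 q / alpha q * x"

definition p1 :: "retrial_params \<Rightarrow> real \<Rightarrow> real" where
  "p1 q x = - (bhat q x * a1 q x / (2 * lamh2 q * x)) + b1 q x"

definition g :: "retrial_params \<Rightarrow> real \<Rightarrow> real" where
  "g q x = lam q * lam1 q * (lam q + mu1 q) * x\<^sup>2
           + lam q * mu1 q * (lam q + mu1 q - mu q) * x - mu q * (mu1 q)\<^sup>2"

definition x_plus :: "retrial_params \<Rightarrow> real" where
  "x_plus q = (THE x. x > 0 \<and> g q x = 0)"

definition x_minus :: "retrial_params \<Rightarrow> real" where
  "x_minus q = (THE x. x < 0 \<and> g q x = 0)"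

definition x_star :: "retrial_params \<Rightarrow> ereal" where
  "x_star q =
     (if \<exists>x. 1 < x \<and> x \<le> x_3 q \<and> h1 q x (Y0 q x) = 0
      then ereal (THE x. 1 < x \<and> x \<le> x_3 q \<and> h1 q x (Y0 q x) = 0)
      else \<infinity>)"


section \<open>The asymptotic constants\<close>

definition N :: "retrial_params \<Rightarrow> (state \<Rightarrow> real) \<Rightarrow> real \<Rightarrow> real \<Rightarrow> real" where
  "N q P x y = h2 q x y * pi2 P y + h0 q x y * P (0, 0, Busy)"

definition C1 :: "retrial_params \<Rightarrow> (state \<Rightarrow> real) \<Rightarrow> real" where
  "C1 q P =
     (lam q + mu1 q) * sqrt (Delta q (x_plus q)) * N q P (x_plus q) (Y0 q (x_plus q))
     / (muh2 q * lam q * lam1 q * x_plus q * (x_plus q - 1) * (x_plus q - x_minus q))"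

definition C2 :: "retrial_params \<Rightarrow> (state \<Rightarrow> real) \<Rightarrow> real \<Rightarrow> real" where
  "C2 q P x =
     2 / lam1 q * (N q P x (Y0 q x) / sqrt (x * (x - x_1 q) * (x - x_2 q) * (x_4 q - x)))"

definition q_fun :: "retrial_params \<Rightarrow> real \<Rightarrow> real" where
  "q_fun q x = - (1 / (2 * lamh2 q * x)) * sqrt (Delta q x / (1 - x / x_3 q))"

text \<open>At \<open>x_3 q\<close> the formula for \<open>q_fun\<close> reads \<open>0 / 0\<close>, hence the limit.\<close>

definition C3 :: "retrial_params \<Rightarrow> (state \<Rightarrow> real) \<Rightarrow> real" where
  "C3 q P =
     - (Lim (at (x_3 q)) (q_fun q) / (2 * x_3 q))
     * deriv (\<lambda>y. - (N q P (x_3 q) y / h1 q (x_3 q) y)) (Y0 q (x_3 q))"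

definition A1 :: "retrial_params \<Rightarrow> (state \<Rightarrow> real) \<Rightarrow> real \<Rightarrow> real" where
  "A1 q P x = - (b1 q x / c q x) * C1 q P"

definition A2 :: "retrial_params \<Rightarrow> (state \<Rightarrow> real) \<Rightarrow> real \<Rightarrow> real" where
  "A2 q P x = - (b1 q x / c q x) * C2 q P x"

definition A3 :: "retrial_params \<Rightarrow> (state \<Rightarrow> real) \<Rightarrow> real \<Rightarrow> real" where
  "A3 q P x = - (b1 q x / c q x) * C3 q P"

definition B3 :: "retrial_params \<Rightarrow> (state \<Rightarrow> real) \<Rightarrow> real \<Rightarrow> real" where
  "B3 q P x = - (p1 q x / c q x) * C3 q P"

text \<open>
  \<open>a m / b m \<rightarrow> 1\<close> taken literally; unlike \<open>asymp_equiv\<close> it forces \<open>b m \<noteq> 0\<close> for large \<open>m\<close>.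
\<close>

definition tail_equiv :: "(nat \<Rightarrow> real) \<Rightarrow> (nat \<Rightarrow> real) \<Rightarrow> bool" where
  "tail_equiv a b \<longleftrightarrow> (\<lambda>m. a m / b m) \<longlonglongrightarrow> 1"

end

theory Submission
  imports Defs "HOL-Real_Asymp.Real_Asymp"
begin

text \<open>
  On the kernel curve the generating functions satisfy \<open>h1 * phi + h2 * psi + h0 * P (0, 0, Busy) = 0\<close>.  The numbers
  of customers in the second orbit have geometric tails by a cut argument, so \<open>psi\<close> is analytic beyond \<open>\<sigma>\<close>, the
  value of \<open>Y0\<close> at \<open>x_3\<close>, and \<open>- N / h1\<close> evaluated along the branch \<open>Y0\<close> continues \<open>phi\<close> across its circle of
  convergence.  On that circle \<open>h1\<close> vanishes at most at the positive real point, because the real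
  parts of the non-constant terms of \<open>h1 / x\<close> are largest there.  Near this point \<open>phi\<close> is meromorphic in \<open>t = sqrt (1 - x / x_dom)\<close>, with a double
  pole, a simple pole or a regular point with a nonzero linear term in the three cases; the coefficients of
  powers of \<open>t\<close> give the asymptotics of the boundary probabilities.  The balance equations then carry
  these from one row \<open>n\<close> to the next through a linear recurrence with characteristic roots \<open>1 / Y0\<close> and \<open>1 / Y1\<close>.
\<close>

text \<open>The relation \<open>tail_equiv\<close> is a quotient tending to 1, so every limiting
  constant must be shown to be nonzero; the sign analysis of \<open>h1\<close>, \<open>h2\<close>
  and \<open>h0\<close> on the kernel curve serves this, and strictness always comes from
  \<open>P (0, 0, Busy) > 0\<close>. The dominant singularity is defined by continuation along rays
  and has first to be turned into convergence of the power series on the whole disc. The functional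
  equation is summed directly only where \<open>Y0\<close> lies below 1, that is for real
  \<open>x\<close> below \<open>muh1 / lamh1\<close>; the identity theorem spreads it over an
  annulus. The delicate point is the convergence of \<open>psi\<close> beyond
  \<open>\<sigma> = sqrt (muh2 / lamh2)\<close>. The ratio bound for the marginals gives the square
  of \<open>\<sigma>\<close> as radius, which is enough for \<open>\<sigma> > 1\<close>; boundedness
  of the probabilities is enough for \<open>\<sigma> < 1\<close>; at \<open>\<sigma> = 1\<close>
  both stop exactly at the required radius, and there the strict drift of the first orbit supplies
  the missing room.\<close>

section \<open>Coefficients of functions with a square root singularity\<close>

text \<open>Cauchy's inequality for \<open>deriv f\<close> on circles of radius below 1, followed by
  letting the radius tend to 1. Bounding the derivative instead of \<open>f\<close> is what gains
  the factor \<open>1 / n\<close>.\<close>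

lemma powser_coeff_le_deriv_bound:
  fixes a :: "nat \<Rightarrow> complex"
  assumes sums: "\<And>z. norm z < 1 \<Longrightarrow> (\<lambda>n. a n * z ^ n) sums f z"
    and hol: "f holomorphic_on ball 0 1"
    and bound: "\<And>z. norm z < 1 \<Longrightarrow> norm (deriv f z) \<le> B"
  shows "norm (a (Suc n)) * real (Suc n) \<le> B"
proof -
  have "f has_fps_expansion Abs_fps a"
  proof (rule has_fps_expansionI)
    have "\<forall>\<^sub>F u in nhds (0::complex). u \<in> ball 0 1"
      by (rule eventually_nhds_in_open) auto
    then show "\<forall>\<^sub>F u in nhds 0. (\<lambda>n. fps_nth (Abs_fps a) n * u ^ n) sums f u"
      by eventually_elim (use sums in auto)
  qed
  from fps_nth_fps_expansion[OF this, of "Suc n"]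
  have coeff: "a (Suc n) = (deriv ^^ n) (deriv f) 0 / fact (Suc n)"
    by (simp add: funpow_Suc_right del: funpow.simps)
  have le: "norm ((deriv ^^ n) (deriv f) 0) \<le> fact n * B / \<rho> ^ n" if "0 < \<rho>" "\<rho> < 1" for \<rho> :: real
  proof (rule Cauchy_inequality)
    have "deriv f holomorphic_on ball 0 1"
      by (rule holomorphic_deriv[OF hol]) auto
    moreover have "cball 0 \<rho> \<subseteq> ball (0::complex) 1"
      using that by auto
    ultimately have h: "deriv f holomorphic_on cball 0 \<rho>"
      by (rule holomorphic_on_subset)
    then show "continuous_on (cball 0 \<rho>) (deriv f)"
      by (rule holomorphic_on_imp_continuous_on)
    show "deriv f holomorphic_on ball 0 \<rho>"
      using h by (rule holomorphic_on_subset) auto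
    show "norm (deriv f x) \<le> B" if "norm (0 - x) = \<rho>" for x
      using that \<open>\<rho> < 1\<close> by (intro bound) auto
  qed (use that in auto)
  have "((\<lambda>\<rho>. fact n * B / \<rho> ^ n) \<longlongrightarrow> fact n * B / 1 ^ n) (at_left (1::real))"
    by (intro tendsto_intros) auto
  moreover have "\<forall>\<^sub>F \<rho> in at_left (1::real). norm ((deriv ^^ n) (deriv f) 0) \<le> fact n * B / \<rho> ^ n"
    using eventually_at_left_real[of 0 "1::real"] by (auto elim!: eventually_mono intro: le)
  ultimately have "norm ((deriv ^^ n) (deriv f) 0) \<le> fact n * B"
    by (intro tendsto_lowerbound[of _ "fact n * B" "at_left (1::real)"]) auto
  then have "norm (a (Suc n)) \<le> fact n * B / fact (Suc n)"
    unfolding coeff norm_divide by (simp add: divide_right_mono del: fact_Suc)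
  also have "\<dots> = B / real (Suc n)"
    unfolding fact_Suc by (simp del: of_nat_Suc)
  finally show ?thesis
    by (simp add: field_simps)
qed

text \<open>Repeated removal of the singularity of \<open>(G z - G 0) / z\<close>. It leaves a
  remainder factor that is holomorphic on the same disc.\<close>

lemma holomorphic_finite_taylor:
  assumes "H holomorphic_on ball 0 \<delta>" "0 < \<delta>"
  obtains h G where "G holomorphic_on ball (0::complex) \<delta>"
    "\<And>t. norm t < \<delta> \<Longrightarrow> H t = (\<Sum>j<J. h j * t ^ j) + t ^ J * G t"
proof -
  have "\<exists>h G. G holomorphic_on ball (0::complex) \<delta> \<and>
    (\<forall>t. norm t < \<delta> \<longrightarrow> H t = (\<Sum>j<J. h j * t ^ j) + t ^ J * G t)"
  proof (induction J)
    case 0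
    show ?case
      by (rule exI[of _ "\<lambda>_. 0"], rule exI[of _ H]) (use assms in auto)
  next
    case (Suc J)
    then obtain h G where G: "G holomorphic_on ball 0 \<delta>"
      and eq: "\<And>t. norm t < \<delta> \<Longrightarrow> H t = (\<Sum>j<J. h j * t ^ j) + t ^ J * G t"
      by blast
    define K where "K = (\<lambda>z. if z = 0 then deriv G 0 else (G z - G 0) / (z - 0))"
    have "K holomorphic_on ball 0 \<delta>"
      unfolding K_def by (rule pole_lemma[OF G]) (use assms in auto)
    moreover have "H t = (\<Sum>j<Suc J. (h(J := G 0)) j * t ^ j) + t ^ Suc J * K t" if "norm t < \<delta>" for t
    proof -
      have "G t = G 0 + t * K t"
        by (simp add: K_def)
      then have "H t = (\<Sum>j<J. h j * t ^ j) + t ^ J * (G 0 + t * K t)"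
        using eq[OF that] by simp
      also have "(\<Sum>j<J. h j * t ^ j) = (\<Sum>j<J. (h(J := G 0)) j * t ^ j)"
        by (intro sum.cong) auto
      finally show ?thesis
        by (simp add: algebra_simps)
    qed
    ultimately show ?case
      by blast
  qed
  then show ?thesis
    using that by blast
qed

lemma csqrt_Re_pos:
  assumes "z \<notin> \<real>\<^sub>\<le>\<^sub>0"
  shows "Re (csqrt z) > 0"
proof -
  have "Re (csqrt z) \<noteq> 0"
  proof
    assume "Re (csqrt z) = 0"
    then have "csqrt z = \<i> * of_real (Im (csqrt z))"
      by (simp add: complex_eq_iff)
    then have "(csqrt z)\<^sup>2 = (\<i> * of_real (Im (csqrt z)))\<^sup>2"
      by metis
    then have "z = of_real (- ((Im (csqrt z))\<^sup>2))"
      by (simp add: power_mult_distrib)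
    then have "z \<in> \<real>\<^sub>\<le>\<^sub>0"
      by (metis Re_complex_of_real complex_nonpos_Reals_iff Im_complex_of_real neg_le_0_iff_le zero_le_power2)
    with assms show False by simp
  qed
  then show ?thesis
    using csqrt_principal[of z] by auto
qed

text \<open>As \<open>Re z < 1\<close>, the point of the ray from 1 to infinity that is nearest to
  \<open>z\<close> is 1 itself.\<close>

lemma dist_one_slit:
  fixes w z :: complex
  assumes "norm z < 1" "norm (w - z) < norm (1 - z)"
  shows "1 - w \<notin> \<real>\<^sub>\<le>\<^sub>0"
proof
  assume "1 - w \<in> \<real>\<^sub>\<le>\<^sub>0"
  then have w: "Im w = 0" "Re w \<ge> 1"
    by (auto simp: complex_nonpos_Reals_iff)
  have z: "Re z < 1"
    using assms(1) complex_Re_le_cmod[of z] by linarith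
  have "(1 - Re z)\<^sup>2 \<le> (Re w - Re z)\<^sup>2"
    using w z by (intro power_mono) auto
  then have "(norm (1 - z))\<^sup>2 \<le> (norm (w - z))\<^sup>2"
    using w by (simp add: cmod_power2)
  then show False
    using assms(2) by (simp add: power2_le_iff_abs_le abs_le_square_iff[symmetric])
qed

lemma slit_deriv_bound:
  assumes hol: "r holomorphic_on {w. norm (1 - w) < \<epsilon> \<and> 1 - w \<notin> \<real>\<^sub>\<le>\<^sub>0}"
    and bound: "\<And>w. norm (1 - w) < \<epsilon> \<Longrightarrow> 1 - w \<notin> \<real>\<^sub>\<le>\<^sub>0 \<Longrightarrow> norm (r w) \<le> C * norm (1 - w)"
    and z: "norm z < 1" "norm (1 - z) < \<epsilon> / 2" and "C \<ge> 0"
  shows "norm (deriv r z) \<le> 3 * C"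
proof -
  \<comment> \<open>With half the distance to 1 as radius, \<open>norm (1 - w)\<close> is at most
    \<open>3 * \<rho>\<close> on the disc, so Cauchy's inequality divides
    \<open>C * (3 * \<rho>)\<close> by \<open>\<rho>\<close> and the bound stays uniform up to
    1.\<close>
  define \<rho> where "\<rho> = norm (1 - z) / 2"
  have \<rho>: "\<rho> > 0"
    using z by (auto simp: \<rho>_def)
  have sub: "w \<in> {w. norm (1 - w) < \<epsilon> \<and> 1 - w \<notin> \<real>\<^sub>\<le>\<^sub>0}" and le: "norm (1 - w) \<le> 3 * \<rho>"
    if "w \<in> cball z \<rho>" for w
  proof -
    have d: "norm (w - z) \<le> \<rho>"
      using that by (simp add: dist_norm norm_minus_commute)
    have "norm (1 - w) \<le> norm (1 - z) + norm (w - z)"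
      using norm_triangle_ineq4[of "1 - z" "w - z"] by simp
    with d show le: "norm (1 - w) \<le> 3 * \<rho>"
      by (simp add: \<rho>_def)
    have "1 - w \<notin> \<real>\<^sub>\<le>\<^sub>0"
      by (rule dist_one_slit[OF z(1)]) (use d \<rho> in \<open>unfold \<rho>_def, linarith\<close>)
    moreover have "norm (1 - w) < \<epsilon>"
      using le z(2) \<rho> unfolding \<rho>_def by linarith
    ultimately show "w \<in> {w. norm (1 - w) < \<epsilon> \<and> 1 - w \<notin> \<real>\<^sub>\<le>\<^sub>0}"
      by simp
  qed
  have "norm ((deriv ^^ 1) r z) \<le> fact 1 * (C * (3 * \<rho>)) / \<rho> ^ 1"
  proof (rule Cauchy_inequality)
    show "r holomorphic_on ball z \<rho>"
      by (rule holomorphic_on_subset[OF hol]) (use sub in force)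
    show "continuous_on (cball z \<rho>) r"
      by (rule holomorphic_on_imp_continuous_on, rule holomorphic_on_subset[OF hol]) (use sub in force)
    show "norm (r w) \<le> C * (3 * \<rho>)" if "norm (z - w) = \<rho>" for w
    proof -
      have w: "w \<in> cball z \<rho>"
        using that by (simp add: dist_norm)
      have "norm (r w) \<le> C * norm (1 - w)"
        using sub[OF w] by (intro bound) auto
      also have "\<dots> \<le> C * (3 * \<rho>)"
        using le[OF w] \<open>C \<ge> 0\<close> by (intro mult_left_mono)
      finally show ?thesis .
    qed
  qed (use \<rho> in auto)
  with \<rho> show ?thesis
    by simp
qed

text \<open>\<open>(-1) ^ n * (b gchoose n)\<close> is the coefficient of \<open>z ^ n\<close> in
  \<open>(1 - z) powr b\<close>. If \<open>b\<close> is a natural number, the coefficients are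
  eventually 0 and \<open>Gamma\<close> has the default value 0 at its poles, so the formula needs
  no exception.\<close>

lemma gbinomial_powr_limit:
  fixes b :: real
  shows "(\<lambda>n. (-1) ^ n * (complex_of_real b gchoose n) * of_real (real n powr (b + 1)))
           \<longlonglongrightarrow> inverse (Gamma (- complex_of_real b))"
proof (rule Lim_transform_eventually[OF gbinomial_asymptotic])
  show "\<forall>\<^sub>F n in sequentially. (complex_of_real b gchoose n) /
      ((-1) ^ n / exp ((complex_of_real b + 1) * of_real (ln (real n)))) =
      (-1) ^ n * (complex_of_real b gchoose n) * of_real (real n powr (b + 1))"
    using eventually_gt_at_top[of 0]
  proof eventually_elim
    case (elim n)
    have "exp ((complex_of_real b + 1) * of_real (ln (real n))) = of_real (exp ((b + 1) * ln (real n)))"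
      by (simp flip: exp_of_real)
    also have "exp ((b + 1) * ln (real n)) = real n powr (b + 1)"
      using elim by (simp add: powr_def)
    finally show ?case
      by (simp add: field_simps flip: power_mult_distrib)
  qed
qed

text \<open>Subtracting the terms \<open>h j * (1 - z) powr ((j - k) / 2)\<close> with \<open>j < k + 2\<close> leaves a remainder that is \<open>O(1 - z)\<close>
  on a slit neighbourhood of \<open>1\<close>.  A disc of radius \<open>\<bar>1 - z\<bar> / 2\<close> about a point of the unit disc avoids the slit, so the
  remainder has a bounded derivative on the unit disc and coefficients \<open>O(1 / n)\<close>.\<close>

lemma sqrt_transfer:
  fixes a :: "nat \<Rightarrow> complex"
  assumes sums: "\<And>z. norm z < 1 \<Longrightarrow> (\<lambda>n. a n * z ^ n) sums F z"
    and U: "open U" "F holomorphic_on U" "ball 0 1 \<subseteq> U" "sphere 0 1 - {1} \<subseteq> U"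
    and H: "H holomorphic_on ball 0 \<delta>" "\<delta> > 0"
    and local: "\<And>t. Re t > 0 \<Longrightarrow> norm t < \<delta> \<Longrightarrow> 1 - t\<^sup>2 \<in> U \<and> F (1 - t\<^sup>2) * t ^ k = H t"
    and "k \<ge> 1"
  shows "(\<lambda>n. a n * of_real (real n powr (1 - real k / 2))) \<longlonglongrightarrow> H 0 * inverse (Gamma (of_nat k / 2))"
proof -
  obtain h G where G: "G holomorphic_on ball 0 \<delta>"
    and taylor: "\<And>t. norm t < \<delta> \<Longrightarrow> H t = (\<Sum>j<k+2. h j * t ^ j) + t ^ (k+2) * G t"
    using holomorphic_finite_taylor[OF H] by blast
  \<comment> \<open>With \<open>t\<close> the square root of \<open>1 - z\<close>, the quotient
    \<open>t ^ j / t ^ k\<close> is \<open>(1 - z) powr b j\<close>.\<close>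
  define b where "b j = (real j - real k) / 2" for j
  define r where "r z = F z - (\<Sum>j<k+2. h j * (1 - z) powr of_real (b j))" for z
  define c where "c j n = (-1) ^ n * (complex_of_real (b j) gchoose n)" for j n
  define d where "d n = a n - (\<Sum>j<k+2. h j * c j n)" for n
  \<comment> \<open>Chosen so that \<open>norm (1 - w) < \<epsilon>\<close> keeps the square root in
    the closed disc of radius \<open>\<delta> / 2\<close>, on which \<open>G\<close> is bounded by
    compactness.\<close>
  define \<epsilon> where "\<epsilon> = \<delta>\<^sup>2 / 4"
  have \<epsilon>: "\<epsilon> > 0"
    using H by (simp add: \<epsilon>_def)
  define V where "V = U \<inter> {w. 1 - w \<notin> \<real>\<^sub>\<le>\<^sub>0}"
  have openV: "open V"
  proof -
    have "{w. 1 - w \<notin> \<real>\<^sub>\<le>\<^sub>0} = (\<lambda>w::complex. 1 - w) -` (- \<real>\<^sub>\<le>\<^sub>0)"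
      by auto
    moreover have "open ((\<lambda>w::complex. 1 - w) -` (- \<real>\<^sub>\<le>\<^sub>0))"
      by (intro open_vimage continuous_intros) (auto simp: open_Compl)
    ultimately show ?thesis
      unfolding V_def using U(1) by auto
  qed
  have r_hol: "r holomorphic_on V"
    unfolding r_def V_def
    by (intro holomorphic_intros holomorphic_on_subset[OF U(2)]) auto
  have unit: "1 - w \<notin> \<real>\<^sub>\<le>\<^sub>0" if "norm w \<le> 1" "w \<noteq> 1" for w :: complex
  proof
    assume "1 - w \<in> \<real>\<^sub>\<le>\<^sub>0"
    then have "Im w = 0" "Re w \<ge> 1"
      by (auto simp: complex_nonpos_Reals_iff)
    with that show False
      using complex_Re_le_cmod[of w] by (simp add: complex_eq_iff)
  qed
  have sq_root: "Re (csqrt (1 - w)) > 0" "norm (csqrt (1 - w)) < \<delta>" "(csqrt (1 - w))\<^sup>2 = 1 - w"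
      "norm (csqrt (1 - w)) \<le> \<delta> / 2"
    if "norm (1 - w) < \<epsilon>" "1 - w \<notin> \<real>\<^sub>\<le>\<^sub>0" for w
  proof -
    show "Re (csqrt (1 - w)) > 0"
      using that by (intro csqrt_Re_pos)
    show sq: "(csqrt (1 - w))\<^sup>2 = 1 - w"
      by simp
    have "(norm (csqrt (1 - w)))\<^sup>2 = norm (1 - w)"
      by (metis sq norm_power)
    then have "(norm (csqrt (1 - w)))\<^sup>2 \<le> (\<delta> / 2)\<^sup>2"
      using that by (simp add: \<epsilon>_def power_divide)
    then show "norm (csqrt (1 - w)) \<le> \<delta> / 2"
      by (rule power2_le_imp_le) (use H in auto)
    then show "norm (csqrt (1 - w)) < \<delta>"
      using H by linarith
  qed
  have slitV: "{w. norm (1 - w) < \<epsilon> \<and> 1 - w \<notin> \<real>\<^sub>\<le>\<^sub>0} \<subseteq> V"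
  proof
    fix w :: complex assume "w \<in> {w. norm (1 - w) < \<epsilon> \<and> 1 - w \<notin> \<real>\<^sub>\<le>\<^sub>0}"
    then have w: "norm (1 - w) < \<epsilon>" "1 - w \<notin> \<real>\<^sub>\<le>\<^sub>0"
      by auto
    from local[OF sq_root(1,2)[OF this]] sq_root(3)[OF this] have "w \<in> U"
      by simp
    with w show "w \<in> V"
      by (simp add: V_def)
  qed
  have r_slit: "r w = (1 - w) * G (csqrt (1 - w))" if w: "norm (1 - w) < \<epsilon>" "1 - w \<notin> \<real>\<^sub>\<le>\<^sub>0" for w
  proof -
    define t where "t = csqrt (1 - w)"
    have t: "Re t > 0" "norm t < \<delta>" "t\<^sup>2 = 1 - w"
      using sq_root[OF w] by (auto simp: t_def)
    have t0: "t \<noteq> 0" and w0: "1 - w \<noteq> 0"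
      using t by auto
    have pw: "(1 - w) powr of_real (b j) * t ^ k = t ^ j" for j
    proof -
      have tp: "t ^ i = (1 - w) powr (of_nat i * (1 / 2))" for i
        unfolding t_def csqrt_conv_powr using w0 by (simp add: powr_power)
      show ?thesis
        unfolding tp powr_add[symmetric] b_def
        by (simp add: field_simps)
    qed
    have "F w * t ^ k = H t"
      using local[OF t(1,2)] t(3) by simp
    then have "r w * t ^ k = H t - (\<Sum>j<k+2. h j * t ^ j)"
      unfolding r_def by (simp add: left_diff_distrib sum_distrib_right mult.assoc pw del: sum.lessThan_Suc)
    also have "\<dots> = (t\<^sup>2 * G t) * t ^ k"
      using taylor[OF t(2)] by (simp add: power_add power2_eq_square mult_ac)
    finally have "r w = t\<^sup>2 * G t"
      using t0 by simp
    then show ?thesis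
      unfolding t_def by simp
  qed
  obtain C where C: "C > 0" "\<And>t. norm t \<le> \<delta> / 2 \<Longrightarrow> norm (G t) \<le> C"
  proof -
    have "cball 0 (\<delta> / 2) \<subseteq> ball (0::complex) \<delta>"
      using H by auto
    then have "continuous_on (cball 0 (\<delta> / 2)) G"
      using G holomorphic_on_imp_continuous_on holomorphic_on_subset by blast
    then have "bounded (G ` cball 0 (\<delta> / 2))"
      by (intro compact_imp_bounded compact_continuous_image) auto
    then obtain C where "C > 0" "\<forall>x\<in>G ` cball 0 (\<delta> / 2). norm x \<le> C"
      unfolding bounded_pos by auto
    then show ?thesis
      using that[of C] by auto
  qed
  have near: "norm (deriv r z) \<le> 3 * C" if "norm z < 1" "norm (1 - z) < \<epsilon> / 2" for z
  proof (rule slit_deriv_bound[OF _ _ that])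
    show "r holomorphic_on {w. norm (1 - w) < \<epsilon> \<and> 1 - w \<notin> \<real>\<^sub>\<le>\<^sub>0}"
      by (rule holomorphic_on_subset[OF r_hol slitV])
    show "norm (r w) \<le> C * norm (1 - w)" if "norm (1 - w) < \<epsilon>" "1 - w \<notin> \<real>\<^sub>\<le>\<^sub>0" for w
    proof -
      have "norm (G (csqrt (1 - w))) \<le> C"
        using sq_root(4)[OF that] C by blast
      then show ?thesis
        using r_slit[OF that] by (metis norm_mult mult.commute mult_right_mono norm_ge_zero)
    qed
  qed (use C in auto)
  \<comment> \<open>Away from 1 the closed unit disc is a compact subset of \<open>V\<close>, so
    continuity of \<open>deriv r\<close> bounds it there; \<open>near\<close> handles the
    rest.\<close>
  define K where "K = cball (0::complex) 1 - ball 1 (\<epsilon> / 2)"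
  have "compact K"
    unfolding K_def by (intro compact_diff) auto
  moreover have KV: "K \<subseteq> V"
  proof
    fix w assume "w \<in> K"
    then have w: "norm w \<le> 1" "w \<noteq> 1"
      using \<epsilon> by (auto simp: K_def)
    then have "w \<in> U"
      using U(3,4) by (cases "norm w < 1") auto
    with unit[OF w] show "w \<in> V"
      by (simp add: V_def)
  qed
  moreover have "deriv r holomorphic_on V"
    by (rule holomorphic_deriv[OF r_hol openV])
  then have "continuous_on K (deriv r)"
    using KV holomorphic_on_imp_continuous_on holomorphic_on_subset by blast
  ultimately have "bounded (deriv r ` K)"
    by (intro compact_imp_bounded compact_continuous_image)
  then obtain C' where C': "\<And>w. w \<in> K \<Longrightarrow> norm (deriv r w) \<le> C'"
    unfolding bounded_iff by auto
  define B where "B = max (3 * C) C'"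
  have B: "norm (deriv r z) \<le> B" if "norm z < 1" for z
  proof (cases "norm (1 - z) < \<epsilon> / 2")
    case True
    then show ?thesis
      using near[OF that] by (simp add: B_def)
  next
    case False
    then have "z \<in> K"
      using that by (auto simp: K_def dist_norm)
    then show ?thesis
      using C' unfolding B_def by (meson max.coboundedI2)
  qed
  have d_sums: "(\<lambda>n. d n * z ^ n) sums r z" if z: "norm z < 1" for z
  proof -
    have *: "(\<lambda>n. c j n * z ^ n) sums ((1 - z) powr of_real (b j))" for j
      using gen_binomial_complex[of "- z" "of_real (b j)"] z
      by (simp add: c_def power_minus' mult_ac power_minus[of z])
    have "(\<lambda>n. a n * z ^ n - (\<Sum>j<k+2. h j * (c j n * z ^ n))) sums r z"
      unfolding r_def
      by (rule sums_diff[OF sums[OF z]], rule sums_sum, rule sums_mult, rule *)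
    moreover have "d n * z ^ n = a n * z ^ n - (\<Sum>j<k+2. h j * (c j n * z ^ n))" for n
      unfolding d_def left_diff_distrib sum_distrib_right by (simp only: mult.assoc)
    ultimately show ?thesis
      by simp
  qed
  have d_bound: "norm (d (Suc n)) * real (Suc n) \<le> B" for n
  proof (rule powser_coeff_le_deriv_bound[OF d_sums])
    show "r holomorphic_on ball 0 1"
    proof (rule holomorphic_on_subset[OF r_hol])
      show "ball 0 1 \<subseteq> V"
      proof
        fix w :: complex assume "w \<in> ball 0 1"
        then show "w \<in> V"
          using U(3) unit[of w] by (cases "w = 1") (auto simp: V_def)
      qed
    qed
  qed (use B in auto)
  \<comment> \<open>The bound \<open>B / n\<close> beats the weight by
    \<open>n powr (- k / 2)\<close>, which tends to 0 because \<open>k >= 1\<close>. The case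
    \<open>k = 0\<close> has to go through the derivative.\<close>
  have d_lim: "(\<lambda>n. d n * of_real (real n powr (1 - real k / 2))) \<longlonglongrightarrow> 0"
  proof (rule Lim_null_comparison)
    show "\<forall>\<^sub>F n in sequentially. norm (d n * of_real (real n powr (1 - real k / 2))) \<le> B * real n powr (- real k / 2)"
      using eventually_gt_at_top[of 0]
    proof eventually_elim
      case (elim n)
      then obtain m where n: "n = Suc m"
        by (cases n) auto
      have "norm (d n * of_real (real n powr (1 - real k / 2))) = norm (d n) * real n * real n powr (- real k / 2)"
      proof -
        have "real n powr (1 - real k / 2) = real n powr (1 + - real k / 2)"
          by simp
        also have "\<dots> = real n * real n powr (- real k / 2)"
          using elim by (subst powr_add) simp
        finally show ?thesis
          by (simp add: norm_mult)
      qed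
      also have "\<dots> \<le> B * real n powr (- real k / 2)"
        using d_bound[of m] by (intro mult_right_mono) (auto simp: n)
      finally show ?case .
    qed
    have "(\<lambda>n. B * real n powr (- real k / 2)) \<longlonglongrightarrow> B * 0"
      using \<open>k \<ge> 1\<close>
      by (intro tendsto_intros tendsto_neg_powr filterlim_real_sequentially) auto
    then show "(\<lambda>n. B * real n powr (- real k / 2)) \<longlonglongrightarrow> 0"
      by simp
  qed
  \<comment> \<open>Each further power of \<open>t\<close> costs a factor
    \<open>n powr (- 1 / 2)\<close>, so only the leading term \<open>j = 0\<close> survives.\<close>
  have c_lim: "(\<lambda>n. c j n * of_real (real n powr (1 - real k / 2))) \<longlonglongrightarrow>
      (if j = 0 then inverse (Gamma (of_nat k / 2)) else 0)" for j
  proof -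
    have lim: "(\<lambda>n. c j n * of_real (real n powr (b j + 1))) \<longlonglongrightarrow> inverse (Gamma (- complex_of_real (b j)))"
      unfolding c_def by (rule gbinomial_powr_limit)
    show ?thesis
    proof (cases "j = 0")
      case True
      then show ?thesis
        using lim by (simp add: b_def add.commute)
    next
      case False
      have "(\<lambda>n. real n powr (- real j / 2)) \<longlonglongrightarrow> 0"
        using False by (intro tendsto_neg_powr filterlim_real_sequentially) auto
      then have "(\<lambda>n. of_real (real n powr (- real j / 2)) :: complex) \<longlonglongrightarrow> of_real 0"
        by (rule tendsto_of_real)
      from tendsto_mult[OF lim this]
      have "(\<lambda>n. c j n * of_real (real n powr (b j + 1)) * of_real (real n powr (- real j / 2))) \<longlonglongrightarrow> 0"
        by simp
      moreover have "c j n * of_real (real n powr (b j + 1)) * of_real (real n powr (- real j / 2))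
          = c j n * of_real (real n powr (1 - real k / 2))" for n
      proof -
        have "real n powr (b j + 1) * real n powr (- real j / 2) = real n powr (b j + 1 + - real j / 2)"
          by (rule powr_add[symmetric])
        also have "b j + 1 + - real j / 2 = 1 - real k / 2"
          by (simp add: b_def field_simps)
        finally show ?thesis
          by (simp add: mult.assoc flip: of_real_mult)
      qed
      ultimately show ?thesis
        using False by (simp only: if_False)
    qed
  qed
  have "(\<lambda>n. d n * of_real (real n powr (1 - real k / 2))
        + (\<Sum>j<k+2. h j * (c j n * of_real (real n powr (1 - real k / 2)))))
      \<longlonglongrightarrow> 0 + (\<Sum>j<k+2. h j * (if j = 0 then inverse (Gamma (of_nat k / 2)) else 0))"
    by (intro tendsto_intros d_lim c_lim)
  moreover have "(\<Sum>j<k+2. h j * (if j = 0 then inverse (Gamma (of_nat k / 2)) else 0)) = h 0 * inverse (Gamma (of_nat k / 2))"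
    by (subst sum.remove[of _ 0]) auto
  moreover have "h 0 = H 0"
  proof -
    have "(\<Sum>j<k+2. h j * 0 ^ j) = h 0"
      by (subst sum.remove[of _ 0]) (auto intro!: sum.neutral)
    then show ?thesis
      using taylor[of 0] H(2) by simp
  qed
  moreover have "d n * x + (\<Sum>j<k+2. h j * (c j n * x)) = a n * x" for n x
    unfolding d_def left_diff_distrib sum_distrib_right by (simp only: mult.assoc diff_add_cancel)
  ultimately show ?thesis
    by simp
qed

lemma powser_deriv_sums:
  fixes a :: "nat \<Rightarrow> complex"
  assumes sums: "\<And>z. norm z < R \<Longrightarrow> (\<lambda>n. a n * z ^ n) sums F z" and z: "norm z < R"
  shows "(\<lambda>n. of_nat (Suc n) * a (Suc n) * z ^ n) sums deriv F z"
proof -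
  obtain K where K: "norm z < K" "K < R"
    using dense[OF z] by auto
  have smb: "summable (\<lambda>n. a n * w ^ n)" if "norm w < R" for w
    using sums[OF that] by (simp add: sums_iff)
  have "summable (\<lambda>n. diffs a n * z ^ n)"
    by (rule termdiff_converges[OF z]) (use smb in auto)
  moreover have "DERIV (\<lambda>x. \<Sum>n. a n * x ^ n) z :> (\<Sum>n. diffs a n * z ^ n)"
    by (rule termdiffs_strong[of a "of_real K"]) (use K norm_ge_zero[of z] smb[of "of_real K"] in \<open>auto simp del: norm_ge_zero\<close>)
  then have "DERIV F z :> (\<Sum>n. diffs a n * z ^ n)"
  proof (rule has_field_derivative_transform_within_open)
    show "open (ball 0 R)" "z \<in> ball 0 R"
      using z by auto
    show "(\<Sum>n. a n * x ^ n) = F x" if "x \<in> ball 0 R" for x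
      using sums[of x] that by (simp add: sums_iff)
  qed
  then have "deriv F z = (\<Sum>n. diffs a n * z ^ n)"
    by (rule DERIV_imp_deriv)
  ultimately show ?thesis
    by (simp add: sums_iff diffs_def)
qed

text \<open>Here \<open>H 0\<close> is a mere constant and the singular behaviour starts with the
  linear term. Differentiating \<open>F (1 - t ^ 2) = H t\<close> shows that \<open>deriv F\<close>
  is of the type \<open>k = 1\<close> with \<open>- deriv H / 2\<close> in place of
  \<open>H\<close>; dividing its coefficients by the index gives the exponent
  \<open>3 / 2\<close>.\<close>

lemma sqrt_transfer_0:
  fixes a :: "nat \<Rightarrow> complex"
  assumes sums: "\<And>z. norm z < 1 \<Longrightarrow> (\<lambda>n. a n * z ^ n) sums F z"
    and U: "open U" "F holomorphic_on U" "ball 0 1 \<subseteq> U" "sphere 0 1 - {1} \<subseteq> U"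
    and H: "H holomorphic_on ball 0 \<delta>" "\<delta> > 0"
    and local: "\<And>t. Re t > 0 \<Longrightarrow> norm t < \<delta> \<Longrightarrow> 1 - t\<^sup>2 \<in> U \<and> F (1 - t\<^sup>2) = H t"
  shows "(\<lambda>n. a n * of_real (real n powr (3 / 2))) \<longlonglongrightarrow> - deriv H 0 / of_real (2 * sqrt pi)"
proof -
  have local': "1 - t\<^sup>2 \<in> U \<and> deriv F (1 - t\<^sup>2) * t ^ 1 = - deriv H t / 2" if t: "Re t > 0" "norm t < \<delta>" for t
  proof -
    have inU: "1 - t\<^sup>2 \<in> U"
      using local[OF t] by auto
    have "(F has_field_derivative deriv F (1 - t\<^sup>2)) (at (1 - t\<^sup>2))"
      using U inU by (intro holomorphic_derivI[of F U])
    then have "((\<lambda>t. F (1 - t\<^sup>2)) has_field_derivative deriv F (1 - t\<^sup>2) * (- (2 * t))) (at t)"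
      by (rule DERIV_chain2) (auto intro!: derivative_eq_intros)
    moreover have "open ({t. Re t > 0} \<inter> ball 0 \<delta>)"
      by (intro open_Int open_halfspace_Re_gt open_ball)
    ultimately have "(H has_field_derivative deriv F (1 - t\<^sup>2) * (- (2 * t))) (at t)"
      by (rule has_field_derivative_transform_within_open) (use t local in auto)
    then have "deriv H t = deriv F (1 - t\<^sup>2) * (- (2 * t))"
      by (rule DERIV_imp_deriv)
    with inU show ?thesis
      by simp
  qed
  have "(\<lambda>n. (of_nat (Suc n) * a (Suc n)) * of_real (real n powr (1 - real 1 / 2)))
      \<longlonglongrightarrow> (- deriv H 0 / 2) * inverse (Gamma (of_nat 1 / 2))"
    by (rule sqrt_transfer[OF powser_deriv_sums[OF sums] U(1) holomorphic_deriv[OF U(2,1)] U(3,4) _ H(2) local'])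
      (use H(1) in \<open>auto intro!: holomorphic_intros holomorphic_deriv\<close>)
  then have "(\<lambda>n. (of_nat (Suc n) * a (Suc n)) * of_real (real n powr (1 / 2)))
      \<longlonglongrightarrow> - deriv H 0 / of_real (2 * sqrt pi)"
    by (simp add: Gamma_one_half_complex field_simps)
  \<comment> \<open>The weight so far is in \<open>n\<close>, the coefficient has index
    \<open>Suc n\<close>; this ratio adjusts the weight.\<close>
  moreover have "(\<lambda>n. real (Suc n) powr (1/2) / real n powr (1/2)) \<longlonglongrightarrow> 1"
    by real_asymp
  then have "(\<lambda>n. complex_of_real (real (Suc n) powr (1/2) / real n powr (1/2))) \<longlonglongrightarrow> of_real 1"
    by (rule tendsto_of_real)
  ultimately have "(\<lambda>n. (of_nat (Suc n) * a (Suc n)) * of_real (real n powr (1 / 2)) *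
       complex_of_real (real (Suc n) powr (1/2) / real n powr (1/2)))
      \<longlonglongrightarrow> - deriv H 0 / of_real (2 * sqrt pi) * of_real 1"
    by (rule tendsto_mult)
  then have "(\<lambda>n. (of_nat (Suc n) * a (Suc n)) * of_real (real n powr (1 / 2)) *
       complex_of_real (real (Suc n) powr (1/2) / real n powr (1/2)))
      \<longlonglongrightarrow> - deriv H 0 / of_real (2 * sqrt pi)"
    by simp
  then have "(\<lambda>n. a (Suc n) * of_real (real (Suc n) powr (3 / 2))) \<longlonglongrightarrow> - deriv H 0 / of_real (2 * sqrt pi)"
  proof (rule Lim_transform_eventually)
    show "\<forall>\<^sub>F n in sequentially. (of_nat (Suc n) * a (Suc n)) * of_real (real n powr (1 / 2)) *
       complex_of_real (real (Suc n) powr (1/2) / real n powr (1/2)) = a (Suc n) * of_real (real (Suc n) powr (3 / 2))"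
      using eventually_gt_at_top[of 0]
    proof eventually_elim
      case (elim n)
      have "real (Suc n) powr (3 / 2) = real (Suc n) powr (1 + 1 / 2)"
        by simp
      also have "\<dots> = real (Suc n) * real (Suc n) powr (1 / 2)"
        by (subst powr_add) simp
      finally show ?case
        using elim by (simp del: of_nat_Suc)
    qed
  qed
  then show ?thesis
    by (rule LIMSEQ_imp_Suc)
qed

section \<open>Continuation along rays\<close>

lemma continues_series_unique:
  fixes a :: "nat \<Rightarrow> complex"
  assumes F: "continues_series a U F" and G: "continues_series a V G" and z: "z \<in> U" "z \<in> V"
  shows "F z = G z"
proof -
  have seg: "closed_segment 0 w \<subseteq> U \<inter> V" if "w \<in> U \<inter> V" for w
    using F G that unfolding continues_series_def by blast
  have 0: "0 \<in> U \<inter> V"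
    using seg[of z] z by auto
  have "starlike (U \<inter> V)"
    unfolding starlike_def using 0 seg by blast
  then have conn: "connected (U \<inter> V)"
    by (rule starlike_imp_connected)
  have "\<forall>\<^sub>F w in nhds 0. w \<in> U \<inter> V \<and> F w - G w = 0"
  proof -
    have "\<forall>\<^sub>F w in nhds 0. w \<in> U \<inter> V"
      using F G 0 by (intro eventually_nhds_in_open) (auto simp: continues_series_def)
    moreover have "\<forall>\<^sub>F w in nhds 0. (\<lambda>k. a k * w ^ k) sums F w" "\<forall>\<^sub>F w in nhds 0. (\<lambda>k. a k * w ^ k) sums G w"
      using F G by (auto simp: continues_series_def)
    ultimately show ?thesis
      by eventually_elim (auto dest: sums_unique2)
  qed
  then obtain S where S: "open S" "0 \<in> S" "\<And>w. w \<in> S \<Longrightarrow> w \<in> U \<inter> V \<and> F w - G w = 0"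
    unfolding eventually_nhds by auto
  have "F z - G z = 0"
  proof (rule analytic_continuation[of "\<lambda>w. F w - G w" "U \<inter> V" S 0])
    show "(\<lambda>w. F w - G w) holomorphic_on U \<inter> V"
      using F G unfolding continues_series_def
      by (intro holomorphic_intros) (auto intro: holomorphic_on_subset)
    show "open (U \<inter> V)"
      using F G by (auto simp: continues_series_def)
    show "0 islimpt S"
      using S(1,2) by (intro interior_limit_point) (simp add: interior_open)
  qed (use S conn 0 z in auto)
  then show ?thesis
    by simp
qed

lemma continuation_eq:
  assumes "continues_series a U F" "z \<in> U"
  shows "continuation a z = F z"
  unfolding continuation_def
  using assms continues_series_unique[OF _ assms(1) _ assms(2)] by (intro the_equality) blast+

lemma continues_series_ball:
  assumes "R > 0" "\<And>z. norm z < R \<Longrightarrow> summable (\<lambda>n. a n * z ^ n)"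
  shows "continues_series a (ball 0 R) (\<lambda>z. \<Sum>n. a n * z ^ n)"
proof -
  have sums: "(\<lambda>n. a n * z ^ n) sums (\<Sum>n. a n * z ^ n)" if "z \<in> ball 0 R" for z
    using assms(2)[of z] that by (simp add: summable_sums)
  have "(\<lambda>z. \<Sum>n. a n * z ^ n) holomorphic_on ball 0 R"
    by (rule power_series_holomorphic[where z = 0]) (use sums in simp)
  moreover have "\<forall>\<^sub>F z in nhds 0. z \<in> ball (0::complex) R"
    using assms(1) by (intro eventually_nhds_in_open) auto
  then have "\<forall>\<^sub>F z in nhds 0. (\<lambda>n. a n * z ^ n) sums (\<Sum>n. a n * z ^ n)"
    by eventually_elim (rule sums)
  moreover have "closed_segment 0 z \<subseteq> ball 0 R" if "z \<in> ball 0 R" for z :: complex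
    using that assms(1) by (intro closed_segment_subset) auto
  ultimately show ?thesis
    unfolding continues_series_def by blast
qed

lemma open_regular: "open {z. regular_point a z}"
proof (subst open_subopen, safe)
  fix z assume "regular_point a z"
  then obtain U F where U: "continues_series a U F" "z \<in> U"
    by (auto simp: regular_point_def)
  then have "open U" "U \<subseteq> {z. regular_point a z}"
    by (auto simp: regular_point_def continues_series_def)
  with U(2) show "\<exists>T. open T \<and> z \<in> T \<and> T \<subseteq> {z. regular_point a z}"
    by blast
qed

text \<open>On the ray to a point that is not regular the irregular parameters form a closed set, so
  there is a first one; it is a singularity and would lie closer to 0 than \<open>s\<close>.\<close>

lemma regular_inside_dominant:
  fixes w :: complex
  assumes dom: "dominant_singularity a s" and zero: "regular_point a 0" and w: "norm w < norm s"
  shows "regular_point a w"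
proof (rule ccontr)
  assume nreg: "\<not> regular_point a w"
  define T where "T = {t. 0 \<le> t \<and> \<not> regular_point a (of_real t * w)}"
  have "1 \<in> T"
    using nreg by (simp add: T_def)
  have bdd: "bdd_below T"
    by (rule bdd_belowI[of _ 0]) (auto simp: T_def)
  have "closed T"
  proof -
    have "T = {0..} \<inter> (\<lambda>t. of_real t * w) -` {z. \<not> regular_point a z}"
      by (auto simp: T_def)
    moreover have "closed {z. \<not> regular_point a z}"
      using open_regular[of a] by (simp add: closed_def Collect_neg_eq)
    ultimately show ?thesis
      by (simp only:) (intro closed_Int closed_vimage continuous_intros closed_atLeast)
  qed
  define t where "t = Inf T"
  have tT: "t \<in> T"
    unfolding t_def using \<open>1 \<in> T\<close> bdd \<open>closed T\<close> by (intro closed_contains_Inf) auto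
  have "t \<le> 1"
    unfolding t_def using \<open>1 \<in> T\<close> bdd by (rule cInf_lower)
  have "t \<ge> 0"
    using tT by (simp add: T_def)
  have "singularity a (of_real t * w)"
    unfolding singularity_def
  proof (intro conjI allI impI)
    show "\<not> regular_point a (of_real t * w)"
      using tT by (simp add: T_def)
    fix u :: real assume u: "0 \<le> u \<and> u < 1"
    show "regular_point a (of_real u * (of_real t * w))"
    proof (cases "t = 0")
      case True
      then show ?thesis using zero by simp
    next
      case False
      then have "u * t < t"
        using u \<open>t \<ge> 0\<close> by simp
      then have "u * t \<notin> T"
        using bdd cInf_lower unfolding t_def by (metis not_less)
      then show ?thesis
        using u \<open>t \<ge> 0\<close> by (simp add: T_def mult.assoc)
    qed
  qed
  then have "norm s \<le> norm (of_real t * w)"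
    using dom by (simp add: dominant_singularity_def)
  also have "\<dots> \<le> 1 * norm w"
    unfolding norm_mult using \<open>t \<ge> 0\<close> \<open>t \<le> 1\<close> by (intro mult_right_mono) auto
  finally show False
    using w by simp
qed

text \<open>Regular points fill the open disc, so the continuation is holomorphic there and agrees
  with the series near 0. Its Taylor series, which converges on the disc, is therefore the given
  one.\<close>

lemma summable_inside_dominant:
  fixes z :: complex
  assumes dom: "dominant_singularity a s" and "\<rho> > 0"
    and small: "\<And>z. norm z < \<rho> \<Longrightarrow> summable (\<lambda>n. a n * z ^ n)" and z: "norm z < norm s"
  shows "summable (\<lambda>n. a n * z ^ n)"
proof -
  have zero: "regular_point a 0"
    using continues_series_ball[OF \<open>\<rho> > 0\<close> small] \<open>\<rho> > 0\<close> unfolding regular_point_def by force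
  have hol: "continuation a holomorphic_on ball 0 (norm s)"
  proof (rule holomorphic_on_open[THEN iffD2], simp, intro ballI)
    fix w :: complex assume "w \<in> ball 0 (norm s)"
    then have "regular_point a w"
      using regular_inside_dominant[OF dom zero] by simp
    then obtain U F where U: "continues_series a U F" "w \<in> U"
      by (auto simp: regular_point_def)
    then have "open U" "F holomorphic_on U"
      by (auto simp: continues_series_def)
    then have "(F has_field_derivative deriv F w) (at w)"
      using U(2) by (intro holomorphic_derivI)
    then have "(continuation a has_field_derivative deriv F w) (at w)"
      by (rule has_field_derivative_transform_within_open[OF _ \<open>open U\<close> U(2)])
        (simp add: continuation_eq[OF U(1)])
    then show "\<exists>f'. (continuation a has_field_derivative f') (at w)"
      by blast
  qed
  have "continuation a has_fps_expansion Abs_fps a"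
  proof (rule has_fps_expansionI)
    have "\<forall>\<^sub>F u in nhds (0::complex). u \<in> ball 0 \<rho>"
      using \<open>\<rho> > 0\<close> by (intro eventually_nhds_in_open) auto
    then show "\<forall>\<^sub>F u in nhds 0. (\<lambda>n. fps_nth (Abs_fps a) n * u ^ n) sums continuation a u"
    proof eventually_elim
      case (elim u)
      then show ?case
        using small[of u] by (simp add: continuation_eq[OF continues_series_ball[OF \<open>\<rho> > 0\<close> small]] summable_sums)
    qed
  qed
  then have "a n = (deriv ^^ n) (continuation a) 0 / fact n" for n
    using fps_nth_fps_expansion[of "continuation a" "Abs_fps a" n] by simp
  moreover have "(\<lambda>n. (deriv ^^ n) (continuation a) 0 / fact n * (z - 0) ^ n) sums continuation a z"
    by (rule holomorphic_power_series[OF hol]) (use z in simp)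
  ultimately show ?thesis
    by (simp add: sums_iff)
qed

section \<open>Balance equations\<close>

text \<open>Stated for bare real parameters, so that the chain with exchanged orbits is again an
  instance; \<open>p\<close> belongs to the busy and \<open>i\<close> to the idle server.\<close>

locale balance =
  fixes l1 l2 mu m1 m2 :: real and p i :: "nat \<Rightarrow> nat \<Rightarrow> real"
  assumes pos: "l1 > 0" "l2 > 0" "mu > 0" "m1 > 0" "m2 > 0"
    and nonneg: "\<And>m n. p m n \<ge> 0" "\<And>m n. i m n \<ge> 0"
    and summable_col: "\<And>n. summable (\<lambda>m. p m n)"
    and summable_row: "\<And>m. summable (\<lambda>n. p m n)"
    and idle: "\<And>m n. i m n * (l1 + l2 + (if m = 0 then 0 else m1) + (if n = 0 then 0 else m2)) = mu * p m n"
    and busy: "\<And>m n. (l1 + l2 + mu) * p m n = (l1 + l2) * i m n + m1 * i (Suc m) n + m2 * i m (Suc n)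
       + (if m = 0 then 0 else l1 * p (m - 1) n) + (if n = 0 then 0 else l2 * p m (n - 1))"
begin

abbreviation "tot \<equiv> l1 + l2 + m1 + m2"

lemma swapped: "balance l2 l1 mu m2 m1 (\<lambda>m n. p n m) (\<lambda>m n. i n m)"
proof
  fix m n
  show "i n m * (l2 + l1 + (if m = 0 then 0 else m2) + (if n = 0 then 0 else m1)) = mu * p n m"
    using idle[of n m] by (simp add: algebra_simps)
  show "(l2 + l1 + mu) * p n m = (l2 + l1) * i n m + m2 * i n (Suc m) + m1 * i (Suc n) m
       + (if m = 0 then 0 else l2 * p n (m - 1)) + (if n = 0 then 0 else l1 * p (n - 1) m)"
    using busy[of n m] by (simp add: algebra_simps)
qed (use pos nonneg summable_col summable_row in auto)

lemma idle_bounds: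
  "i m n \<le> mu / (l1 + l2) * p m n" "mu / tot * p m n \<le> i m n"
proof -
  have "i m n * (l1 + l2) \<le> mu * p m n"
    unfolding idle[of m n, symmetric] using pos nonneg by (intro mult_left_mono) auto
  then show "i m n \<le> mu / (l1 + l2) * p m n"
    using pos by (simp add: field_simps)
  have "mu * p m n \<le> i m n * tot"
    unfolding idle[of m n, symmetric] using pos nonneg by (intro mult_left_mono) auto
  then show "mu / tot * p m n \<le> i m n"
    using pos by (simp add: field_simps)
qed

lemma idle_edge:
  "i 0 (Suc n) = mu / (l1 + l2 + m2) * p 0 (Suc n)"
  "i (Suc m) 0 = mu / (l1 + l2 + m1) * p (Suc m) 0"
  "i 0 0 = mu / (l1 + l2) * p 0 0"
  "i (Suc m) (Suc n) = mu / tot * p (Suc m) (Suc n)"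
  using idle[of 0 "Suc n"] idle[of "Suc m" 0] idle[of 0 0] idle[of "Suc m" "Suc n"] pos
  by (simp_all add: field_simps)

text \<open>The right-hand side of the busy equation has only nonnegative terms, so a zero at
  \<open>(m, n)\<close> forces zeros at the idle, hence at the busy states \<open>(Suc m, n)\<close>
  and \<open>(m, Suc n)\<close>; a zero at the origin would spread everywhere.\<close>

lemma origin_pos:
  assumes "p m n > 0"
  shows "p 0 0 > 0"
proof (rule ccontr)
  assume "\<not> p 0 0 > 0"
  then have p00: "p 0 0 = 0"
    using nonneg(1)[of 0 0] by simp
  have step: "p (Suc m) n = 0 \<and> p m (Suc n) = 0" if "p m n = 0" for m n
  proof -
    have "(l1 + l2) * i m n \<ge> 0" "m1 * i (Suc m) n \<ge> 0" "m2 * i m (Suc n) \<ge> 0"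
      "(if m = 0 then 0 else l1 * p (m - 1) n) \<ge> 0" "(if n = 0 then 0 else l2 * p m (n - 1)) \<ge> 0"
      using pos nonneg by auto
    moreover have "(l1 + l2) * i m n + m1 * i (Suc m) n + m2 * i m (Suc n)
       + (if m = 0 then 0 else l1 * p (m - 1) n) + (if n = 0 then 0 else l2 * p m (n - 1)) = 0"
      using busy[of m n] that by simp
    ultimately have "m1 * i (Suc m) n = 0" "m2 * i m (Suc n) = 0"
      by linarith+
    then have "i (Suc m) n = 0" "i m (Suc n) = 0"
      using pos by auto
    then show ?thesis
      using idle[of "Suc m" n] idle[of m "Suc n"] pos by auto
  qed
  have "p m n = 0" for m n
  proof (induction m arbitrary: n)
    case 0
    show ?case
      by (induction n) (use p00 step in auto)
  qed (use step in auto)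
  with assms show False
    by simp
qed

definition \<Phi> :: "real \<Rightarrow> nat \<Rightarrow> real" where "\<Phi> x n = (\<Sum>m. p m n * x ^ m)"
definition \<Psi> :: "real \<Rightarrow> nat \<Rightarrow> real" where "\<Psi> x n = (\<Sum>m. i m n * x ^ m)"
text \<open>At \<open>x = 1\<close> this is the net probability flow across the cut between
  \<open>n\<close> and \<open>n + 1\<close> customers in the second orbit.\<close>

definition flux :: "real \<Rightarrow> nat \<Rightarrow> real" where "flux x n = l2 * \<Phi> x n - m2 * \<Psi> x (Suc n)"

context
  fixes x :: real
  assumes x: "x > 0" and smb: "\<And>n. summable (\<lambda>m. p m n * x ^ m)"
begin

lemma \<Phi>_sums: "(\<lambda>m. p m n * x ^ m) sums \<Phi> x n"
  unfolding \<Phi>_def using smb by (rule summable_sums)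

lemma \<Psi>_sums: "(\<lambda>m. i m n * x ^ m) sums \<Psi> x n"
proof -
  have "summable (\<lambda>m. i m n * x ^ m)"
  proof (rule summable_comparison_test')
    show "summable (\<lambda>m. mu / (l1 + l2) * (p m n * x ^ m))"
      using smb by (rule summable_mult)
    fix m
    show "norm (i m n * x ^ m) \<le> mu / (l1 + l2) * (p m n * x ^ m)"
      using mult_right_mono[OF idle_bounds(1)[of m n], of "x ^ m"] x nonneg by (simp add: abs_mult)
  qed
  then show ?thesis
    unfolding \<Psi>_def by (rule summable_sums)
qed

lemma \<Phi>_nonneg: "\<Phi> x n \<ge> 0"
  unfolding \<Phi>_def using x nonneg by (intro suminf_nonneg smb) auto

lemma term_le_\<Phi>: "p 0 n \<le> \<Phi> x n"
proof -
  have "(\<Sum>m<1. p m n * x ^ m) \<le> \<Phi> x n"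
    unfolding \<Phi>_def using x nonneg by (intro sum_le_suminf smb) auto
  then show ?thesis by simp
qed

lemma \<Psi>_shift: "(\<lambda>m. i (Suc m) n * x ^ Suc m) sums (\<Psi> x n - i 0 n)"
  using \<Psi>_sums[of n] by (subst sums_Suc_iff) simp

lemma idle_sum: "(l1 + l2 + m1 + (if n = 0 then 0 else m2)) * \<Psi> x n - m1 * i 0 n = mu * \<Phi> x n"
proof (rule sums_unique2)
  let ?s = "l1 + l2 + (if n = 0 then 0 else m2)"
  have "(\<lambda>m. m1 * (if m = 0 then 0 else i m n * x ^ m)) sums (m1 * (\<Psi> x n - i 0 n))"
    using \<Psi>_shift[of n] sums_Suc_iff[of "\<lambda>m. if m = 0 then 0 else i m n * x ^ m" "\<Psi> x n - i 0 n"]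
    by (intro sums_mult) simp
  from sums_add[OF sums_mult[OF \<Psi>_sums[of n], of ?s] this]
  have "(\<lambda>m. ?s * (i m n * x ^ m) + m1 * (if m = 0 then 0 else i m n * x ^ m))
      sums (?s * \<Psi> x n + m1 * (\<Psi> x n - i 0 n))" .
  moreover have "?s * (i m n * x ^ m) + m1 * (if m = 0 then 0 else i m n * x ^ m) = mu * (p m n * x ^ m)" for m
    using arg_cong[OF idle[of m n], of "\<lambda>u. u * x ^ m"] by (cases m; cases n) (simp_all add: algebra_simps)
  ultimately show "(\<lambda>m. mu * (p m n * x ^ m)) sums ((l1 + l2 + m1 + (if n = 0 then 0 else m2)) * \<Psi> x n - m1 * i 0 n)"
    by (simp add: algebra_simps)
  show "(\<lambda>m. mu * (p m n * x ^ m)) sums (mu * \<Phi> x n)"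
    by (rule sums_mult[OF \<Phi>_sums])
qed

lemma busy_sum: "(l1 + l2 + mu) * \<Phi> x n = (l1 + l2) * \<Psi> x n + m1 * ((\<Psi> x n - i 0 n) / x)
    + m2 * \<Psi> x (Suc n) + l1 * (x * \<Phi> x n) + (if n = 0 then 0 else l2 * \<Phi> x (n - 1))"
proof (rule sums_unique2)
  show "(\<lambda>m. (l1 + l2 + mu) * (p m n * x ^ m)) sums ((l1 + l2 + mu) * \<Phi> x n)"
    by (rule sums_mult[OF \<Phi>_sums])
  have "(\<lambda>m. i (Suc m) n * x ^ Suc m / x) sums ((\<Psi> x n - i 0 n) / x)"
    by (rule sums_divide[OF \<Psi>_shift])
  then have 1: "(\<lambda>m. i (Suc m) n * x ^ m) sums ((\<Psi> x n - i 0 n) / x)"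
    using x by simp
  have "(\<lambda>m. x * (p m n * x ^ m)) sums (x * \<Phi> x n)"
    by (rule sums_mult[OF \<Phi>_sums])
  then have 2: "(\<lambda>m. if m = 0 then 0 else p (m - 1) n * x ^ m) sums (x * \<Phi> x n)"
    using sums_Suc_iff[of "\<lambda>m. if m = 0 then 0 else p (m - 1) n * x ^ m" "x * \<Phi> x n"]
    by (simp add: mult_ac)
  have 3: "(\<lambda>m. if n = 0 then 0 else l2 * (p m (n - 1) * x ^ m)) sums (if n = 0 then 0 else l2 * \<Phi> x (n - 1))"
    by (auto intro: sums_mult \<Phi>_sums)
  have "(\<lambda>m. (l1 + l2) * (i m n * x ^ m) + m1 * (i (Suc m) n * x ^ m) + m2 * (i m (Suc n) * x ^ m)
       + l1 * (if m = 0 then 0 else p (m - 1) n * x ^ m) + (if n = 0 then 0 else l2 * (p m (n - 1) * x ^ m)))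
    sums ((l1 + l2) * \<Psi> x n + m1 * ((\<Psi> x n - i 0 n) / x)
    + m2 * \<Psi> x (Suc n) + l1 * (x * \<Phi> x n) + (if n = 0 then 0 else l2 * \<Phi> x (n - 1)))"
    by (intro sums_add sums_mult 1 2 3 \<Psi>_sums)
  moreover have "(l1 + l2) * (i m n * x ^ m) + m1 * (i (Suc m) n * x ^ m) + m2 * (i m (Suc n) * x ^ m)
       + l1 * (if m = 0 then 0 else p (m - 1) n * x ^ m) + (if n = 0 then 0 else l2 * (p m (n - 1) * x ^ m))
      = (l1 + l2 + mu) * (p m n * x ^ m)" for m
    using arg_cong[OF busy[of m n], of "\<lambda>u. u * x ^ m"] by (simp add: algebra_simps)
  ultimately show "(\<lambda>m. (l1 + l2 + mu) * (p m n * x ^ m)) sums ((l1 + l2) * \<Psi> x n + m1 * ((\<Psi> x n - i 0 n) / x)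
    + m2 * \<Psi> x (Suc n) + l1 * (x * \<Phi> x n) + (if n = 0 then 0 else l2 * \<Phi> x (n - 1)))"
    by simp
qed

text \<open>Adding \<open>idle_sum\<close> and \<open>busy_sum\<close> cancels the switches of the
  server. What remains besides the flux are the moves of the first orbit, each with a factor that
  vanishes at \<open>x = 1\<close>.\<close>

lemma flux_step:
  "flux x n - (if n = 0 then 0 else flux x (n - 1)) = l1 * (x - 1) * \<Phi> x n - m1 * (1 - 1 / x) * (\<Psi> x n - i 0 n)"
  using idle_sum[of n] busy_sum[of n] unfolding flux_def
  by (cases n) (auto simp: algebra_simps diff_divide_distrib)

end

section \<open>The cut equation and geometric decay of the marginals\<close>

lemma flux_one: "flux 1 n = 0"
proof (induction n)
  case 0
  then show ?case
    using flux_step[of 1 0] summable_col by simp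
next
  case (Suc n)
  then show ?case
    using flux_step[of 1 "Suc n"] summable_col by simp
qed

text \<open>An idle state has at least \<open>mu / tot\<close> times the weight of the busy state with the same orbits, so the vanishing
  of the flux turns into a ratio bound for the marginals.\<close>

lemma marginal_decay: "\<Phi> 1 n \<le> (tot * l2 / (mu * m2)) ^ n * \<Phi> 1 0"
proof (induction n)
  case (Suc n)
  have "mu / tot * \<Phi> 1 (Suc n) \<le> \<Psi> 1 (Suc n)"
  proof (rule sums_le)
    show "(\<lambda>m. mu / tot * (p m (Suc n) * 1 ^ m)) sums (mu / tot * \<Phi> 1 (Suc n))"
      by (intro sums_mult \<Phi>_sums) (auto simp: summable_col)
    show "(\<lambda>m. i m (Suc n) * 1 ^ m) sums \<Psi> 1 (Suc n)"
      by (intro \<Psi>_sums) (auto simp: summable_col)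
  qed (use idle_bounds in simp)
  also have "\<Psi> 1 (Suc n) = l2 * \<Phi> 1 n / m2"
    using flux_one[of n] pos by (simp add: flux_def field_simps)
  finally have "\<Phi> 1 (Suc n) \<le> (tot * l2 / (mu * m2)) * \<Phi> 1 n"
    using pos by (simp add: field_simps)
  also have "\<dots> \<le> (tot * l2 / (mu * m2)) * ((tot * l2 / (mu * m2)) ^ n * \<Phi> 1 0)"
    using Suc pos by (intro mult_left_mono) auto
  finally show ?case
    by (simp add: mult_ac)
qed simp

lemma edge_decay: "p 0 n \<le> \<Phi> 1 0 * (tot * l2 / (mu * m2)) ^ n"
proof -
  have "p 0 n \<le> \<Phi> 1 n"
    by (rule term_le_\<Phi>) (auto simp: summable_col)
  with marginal_decay[of n] show ?thesis
    by (simp add: mult.commute)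
qed

text \<open>\<open>marginal_decay\<close> for the chain with exchanged orbits bounds the row sums by
  a geometric sequence of ratio \<open>tot * l1 / (mu * m1)\<close>, and \<open>x\<close> is below
  the reciprocal of that ratio. The bound \<open>C\<close> is uniform in \<open>N\<close>, so the
  values \<open>\<Phi> x n\<close> are bounded and even summable in \<open>n\<close>.\<close>

lemma weighted_bound:
  assumes x: "0 < x" "x < mu * m1 / (tot * l1)"
  obtains C where "\<And>n. summable (\<lambda>m. p m n * x ^ m)" "\<And>N. (\<Sum>n<N. \<Phi> x n) \<le> C"
proof -
  interpret sw: balance l2 l1 mu m2 m1 "\<lambda>m n. p n m" "\<lambda>m n. i n m"
    by (rule swapped)
  let ?\<rho> = "tot * l1 / (mu * m1)"
  define r where "r m = (\<Sum>n. p m n)" for m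
  have r: "r m \<le> ?\<rho> ^ m * r 0" for m
    using sw.marginal_decay[of m] by (simp add: sw.\<Phi>_def r_def add_ac)
  have r0: "r m \<ge> 0" for m
    unfolding r_def using nonneg summable_row by (intro suminf_nonneg) auto
  have "tot * l1 > 0"
    using pos by simp
  then have "x * (tot * l1) < mu * m1"
    using x(2) by (simp only: pos_less_divide_eq)
  then have "?\<rho> * x < 1"
    using pos by (simp add: pos_divide_less_eq mult_ac)
  have smb_r: "summable (\<lambda>m. r m * x ^ m)"
  proof (rule summable_comparison_test')
    show "summable (\<lambda>m. r 0 * (?\<rho> * x) ^ m)"
      using \<open>?\<rho> * x < 1\<close> x pos by (intro summable_mult summable_geometric) (auto simp: abs_mult)
    fix m
    have "r m * x ^ m \<le> (?\<rho> ^ m * r 0) * x ^ m"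
      using r x by (intro mult_right_mono) auto
    then show "norm (r m * x ^ m) \<le> r 0 * (?\<rho> * x) ^ m"
      using r0[of m] x unfolding power_mult_distrib[of ?\<rho> x] by (simp add: abs_mult mult_ac)
  qed
  have part: "(\<Sum>n<N. p m n) \<le> r m" for m N
    unfolding r_def using nonneg summable_row by (intro sum_le_suminf) auto
  have single: "p m n \<le> r m" for m n
  proof -
    have "p m n \<le> (\<Sum>k<Suc n. p m k)"
      using nonneg by (intro member_le_sum) auto
    also have "\<dots> \<le> r m"
      by (rule part)
    finally show ?thesis .
  qed
  have smb: "summable (\<lambda>m. p m n * x ^ m)" for n
  proof (rule summable_comparison_test'[OF smb_r])
    fix m
    show "norm (p m n * x ^ m) \<le> r m * x ^ m"
      using mult_right_mono[OF single, of "x ^ m" m n] x nonneg by (simp add: abs_mult)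
  qed
  have "(\<Sum>n<N. \<Phi> x n) \<le> (\<Sum>m. r m * x ^ m)" for N
  proof (rule sums_le)
    show "(\<lambda>m. \<Sum>n<N. p m n * x ^ m) sums (\<Sum>n<N. \<Phi> x n)"
      by (intro sums_sum \<Phi>_sums x smb)
    show "(\<lambda>m. r m * x ^ m) sums (\<Sum>m. r m * x ^ m)"
      by (rule summable_sums[OF smb_r])
    show "(\<Sum>n<N. p m n * x ^ m) \<le> r m * x ^ m" for m
      using mult_right_mono[OF part[where m = m and N = N], of "x ^ m"] x by (simp add: sum_distrib_right)
  qed
  with smb show ?thesis
    using that by blast
qed

text \<open>\<open>flux_step\<close> summed with weights \<open>y ^ n\<close> relates the transforms
  \<open>A\<close> (busy) and \<open>B\<close> (idle) to the edge transforms \<open>E\<close> and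
  \<open>\<Psi> x 0\<close>; the idle equations then eliminate \<open>A\<close>. The kernel
  condition says exactly that the coefficient of \<open>B\<close> in the result is 0, so that only
  the two edges remain. As the terms are known to be bounded, \<open>y < 1\<close> secures
  convergence.\<close>

lemma functional_equation:
  assumes x: "0 < x" "x < mu * m1 / (tot * l1)" and y: "0 < y" "y < 1"
    and kernel: "tot * (l1 * x + l2 * y - (l1 + l2)) = mu * m1 * (1 - 1 / x) + mu * m2 * (1 - 1 / y)"
  shows "(l2 * x * y + (l1 * x\<^sup>2 - (l1 + l2 + mu * m1 / (l1 + l2 + m1)) * x + mu * m1 / (l1 + l2 + m1)))
       * (\<Sum>j. p (Suc j) 0 * x ^ j)
     + (l2 * y\<^sup>2 + (l1 * x - (l1 + l2) - mu * m2 / (l1 + l2 + m2)) * y + mu * m2 / (l1 + l2 + m2))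
       * (\<Sum>j. p 0 (Suc j) * y ^ j)
     + (l1 * x + l2 * y - (l1 + l2)) * p 0 0 = 0" (is "?h1 * ?\<phi> + ?h2 * ?\<psi> + ?h0 * p 0 0 = 0")
proof -
  obtain C where smb: "\<And>n. summable (\<lambda>m. p m n * x ^ m)" and C: "\<And>N. (\<Sum>n<N. \<Phi> x n) \<le> C"
    using weighted_bound[OF x] by blast
  note \<Phi>_nonneg' = \<Phi>_nonneg[OF x(1) smb]
  have \<Phi>_le: "\<Phi> x n \<le> C" for n
  proof -
    have "\<Phi> x n \<le> (\<Sum>k<Suc n. \<Phi> x k)"
      using \<Phi>_nonneg' by (intro member_le_sum) auto
    also have "\<dots> \<le> C"
      by (rule C)
    finally show ?thesis .
  qed
  have bounded_smb: "summable (\<lambda>n. f n * y ^ n)" if "\<And>n. 0 \<le> f n" "\<And>n. f n \<le> K" for f and K :: real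
  proof (rule summable_comparison_test')
    show "summable (\<lambda>n. K * y ^ n)"
      using y by (intro summable_mult summable_geometric) auto
    show "norm (f n * y ^ n) \<le> K * y ^ n" for n
      using mult_right_mono[OF that(2), of "y ^ n" n] that(1)[of n] y by (simp add: abs_mult)
  qed
  have \<Psi>0: "0 \<le> \<Psi> x n" for n
    using sums_le[OF _ sums_zero \<Psi>_sums[OF x(1) smb, of n]] x nonneg by auto
  have \<Psi>_le: "\<Psi> x n \<le> mu / (l1 + l2) * C" for n
  proof -
    have "\<Psi> x n \<le> mu / (l1 + l2) * \<Phi> x n"
    proof (rule sums_le[OF _ \<Psi>_sums[OF x(1) smb] sums_mult[OF \<Phi>_sums[OF x(1) smb]]])
      show "i m n * x ^ m \<le> mu / (l1 + l2) * (p m n * x ^ m)" for m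
        using mult_right_mono[OF idle_bounds(1), of "x ^ m" m n] x by (simp add: mult.assoc)
    qed
    also have "\<dots> \<le> mu / (l1 + l2) * C"
      using \<Phi>_le pos by (intro mult_left_mono) auto
    finally show ?thesis .
  qed
  have e_le: "i 0 n \<le> mu / (l1 + l2) * C" for n
    using idle_bounds(1)[of 0 n] term_le_\<Phi>[OF x(1) smb, of n] \<Phi>_le[of n] pos
    by (meson divide_nonneg_pos add_pos_pos less_imp_le mult_left_mono order_trans)
  define A where "A = (\<Sum>n. \<Phi> x n * y ^ n)"
  define B where "B = (\<Sum>n. \<Psi> x n * y ^ n)"
  define E where "E = (\<Sum>n. i 0 n * y ^ n)"
  have A: "(\<lambda>n. \<Phi> x n * y ^ n) sums A"
    unfolding A_def by (rule summable_sums[OF bounded_smb[OF \<Phi>_nonneg' \<Phi>_le]])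
  have B: "(\<lambda>n. \<Psi> x n * y ^ n) sums B"
    unfolding B_def by (rule summable_sums[OF bounded_smb[OF \<Psi>0 \<Psi>_le]])
  have E: "(\<lambda>n. i 0 n * y ^ n) sums E"
    unfolding E_def by (rule summable_sums[OF bounded_smb[OF nonneg(2) e_le]])
  define G where "G = l2 * A - m2 * ((B - \<Psi> x 0) / y)"
  have shift: "(\<lambda>n. \<Psi> x (Suc n) * y ^ Suc n) sums (B - \<Psi> x 0)"
    using B by (subst sums_Suc_iff) simp
  from sums_divide[OF this, of y] have "(\<lambda>n. \<Psi> x (Suc n) * y ^ n) sums ((B - \<Psi> x 0) / y)"
    using y by simp
  from sums_diff[OF sums_mult[OF A, of l2] sums_mult[OF this, of m2]]
  have G: "(\<lambda>n. flux x n * y ^ n) sums G"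
    by (simp add: flux_def G_def algebra_simps)
  have "(\<lambda>n. y * (flux x n * y ^ n)) sums (y * G)"
    by (rule sums_mult[OF G])
  then have G': "(\<lambda>n. (if n = 0 then 0 else flux x (n - 1)) * y ^ n) sums (y * G)"
    using sums_Suc_iff[of "\<lambda>n. (if n = 0 then 0 else flux x (n - 1)) * y ^ n" "y * G"]
    by (simp add: mult_ac)
  have "G - y * G = l1 * (x - 1) * A - m1 * (1 - 1 / x) * (B - E)"
  proof (rule sums_unique2)
    have "(\<lambda>n. l1 * (x - 1) * (\<Phi> x n * y ^ n) - m1 * (1 - 1 / x) * (\<Psi> x n * y ^ n - i 0 n * y ^ n))
        sums (l1 * (x - 1) * A - m1 * (1 - 1 / x) * (B - E))"
      by (intro sums_diff sums_mult A B E)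
    moreover have "l1 * (x - 1) * (\<Phi> x n * y ^ n) - m1 * (1 - 1 / x) * (\<Psi> x n * y ^ n - i 0 n * y ^ n)
      = flux x n * y ^ n - (if n = 0 then 0 else flux x (n - 1)) * y ^ n" for n
      using arg_cong[OF flux_step[OF x(1) smb, of n], of "\<lambda>u. u * y ^ n"] by (simp add: algebra_simps)
    ultimately show "(\<lambda>n. flux x n * y ^ n - (if n = 0 then 0 else flux x (n - 1)) * y ^ n)
        sums (l1 * (x - 1) * A - m1 * (1 - 1 / x) * (B - E))"
      by simp
  qed (rule sums_diff[OF G G'])
  then have flow: "?h0 * A = m1 * (1 - 1 / x) * (B - E) + m2 * (1 - 1 / y) * (B - \<Psi> x 0)"
  proof -
    have "(l1 * x + l2 * y - (l1 + l2)) * A = M + (y - 1) * q"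
      if "l2 * A - q - y * (l2 * A - q) = l1 * (x - 1) * A - M" for q M
      using that by (simp add: algebra_simps)
    moreover have "m2 * (1 - 1 / y) * (B - \<Psi> x 0) = (y - 1) * (m2 * ((B - \<Psi> x 0) / y))"
      using y by (simp add: field_simps)
    ultimately show ?thesis
      using \<open>G - y * G = _\<close> unfolding G_def by metis
  qed
  have idles: "tot * B - m1 * E - m2 * \<Psi> x 0 = mu * A"
  proof (rule sums_unique2)
    show "(\<lambda>n. mu * (\<Phi> x n * y ^ n)) sums (mu * A)"
      by (rule sums_mult[OF A])
    have "(\<lambda>n. if n = 0 then 0 else \<Psi> x n * y ^ n) sums (B - \<Psi> x 0)"
      using shift sums_Suc_iff[of "\<lambda>n. if n = 0 then 0 else \<Psi> x n * y ^ n" "B - \<Psi> x 0"] by simp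
    then have "(\<lambda>n. (l1 + l2 + m1) * (\<Psi> x n * y ^ n) + m2 * (if n = 0 then 0 else \<Psi> x n * y ^ n) - m1 * (i 0 n * y ^ n))
        sums ((l1 + l2 + m1) * B + m2 * (B - \<Psi> x 0) - m1 * E)"
      by (intro sums_diff sums_add sums_mult B E)
    moreover have "(l1 + l2 + m1) * (\<Psi> x n * y ^ n) + m2 * (if n = 0 then 0 else \<Psi> x n * y ^ n) - m1 * (i 0 n * y ^ n)
        = mu * (\<Phi> x n * y ^ n)" for n
      using arg_cong[OF idle_sum[OF x(1) smb, of n], of "\<lambda>u. u * y ^ n"]
      by (cases n) (simp_all add: algebra_simps)
    ultimately show "(\<lambda>n. mu * (\<Phi> x n * y ^ n)) sums (tot * B - m1 * E - m2 * \<Psi> x 0)"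
      by (simp add: algebra_simps)
  qed
  have "?h0 * (tot * B - m1 * E - m2 * \<Psi> x 0) = mu * (m1 * (1 - 1 / x) * (B - E) + m2 * (1 - 1 / y) * (B - \<Psi> x 0))"
    unfolding idles flow[symmetric] by simp
  then have main: "E * (m1 * (mu * (1 - 1 / x) - ?h0)) + \<Psi> x 0 * (m2 * (mu * (1 - 1 / y) - ?h0)) = 0"
  proof -
    have "E * (m1 * (mu * a - h)) + Q * (m2 * (mu * b - h)) = 0"
      if "h * (T * B - m1 * E - m2 * Q) = mu * (m1 * a * (B - E) + m2 * b * (B - Q))"
        and "T * h = mu * m1 * a + mu * m2 * b" for h T a b Q
      using that(1) arg_cong[OF that(2), of "\<lambda>u. u * B"] by (simp add: algebra_simps)
    then show ?thesis
      using kernel \<open>?h0 * (tot * B - m1 * E - m2 * \<Psi> x 0) = _\<close> by blast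
  qed
  \<comment> \<open>One identity for both boundary polynomials: \<open>z = y\<close> with
    \<open>k = l1 + l2 + m2\<close> gives \<open>?h2\<close>, and \<open>z = x\<close> with
    \<open>k = l1 + l2 + m1\<close> gives \<open>?h1\<close>; in both cases \<open>tot\<close> is
    split as \<open>k + a\<close>.\<close>
  have edge_poly: "z * ((k + a) * (b * v + d * z - L) - M * (1 - 1 / z) - a * (b * v + d * z - L))
      = k * (d * z\<^sup>2 + (b * v - L - M / k) * z + M / k)"
    if "k > 0" "z > 0" for k a b d v z L M :: real
    using that by (simp add: field_simps power2_eq_square)
  have "y * (m1 * (mu * (1 - 1 / x) - ?h0)) = y * (tot * ?h0 - mu * m2 * (1 - 1 / y) - m1 * ?h0)"
    unfolding kernel by (simp add: algebra_simps)
  also have "\<dots> = (l1 + l2 + m2) * ?h2"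
    using edge_poly[of "l1 + l2 + m2" y m1 l1 x l2 "l1 + l2" "mu * m2"] pos y by (simp only: add_ac add_pos_pos)
  finally have h2: "m1 * (mu * (1 - 1 / x) - ?h0) = (l1 + l2 + m2) * ?h2 / y"
    using y by (simp add: field_simps)
  have "x * (m2 * (mu * (1 - 1 / y) - ?h0)) = x * (tot * ?h0 - mu * m1 * (1 - 1 / x) - m2 * ?h0)"
    unfolding kernel by (simp add: algebra_simps)
  also have "\<dots> = (l1 + l2 + m1) * ?h1"
  proof -
    have "?h1 = l1 * x\<^sup>2 + (l2 * y - (l1 + l2) - mu * m1 / (l1 + l2 + m1)) * x + mu * m1 / (l1 + l2 + m1)"
      by (simp add: algebra_simps)
    then show ?thesis
      using edge_poly[of "l1 + l2 + m1" x m2 l2 y l1 "l1 + l2" "mu * m1"] pos x by (simp only: add_ac add_pos_pos)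
  qed
  finally have h1: "m2 * (mu * (1 - 1 / y) - ?h0) = (l1 + l2 + m1) * ?h1 / x"
    using x by (simp add: field_simps)
  have "(\<lambda>n. i 0 (Suc n) * y ^ Suc n) sums (E - i 0 0)"
    using E by (subst sums_Suc_iff) simp
  then have "(\<lambda>n. mu * y / (l1 + l2 + m2) * (p 0 (Suc n) * y ^ n)) sums (E - i 0 0)"
    by (simp add: idle_edge mult_ac)
  from sums_divide[OF this, of "mu * y / (l1 + l2 + m2)"]
  have "(\<lambda>n. p 0 (Suc n) * y ^ n) sums ((E - i 0 0) / (mu * y / (l1 + l2 + m2)))"
    using pos y by simp
  then have Ev: "E = mu / (l1 + l2) * p 0 0 + mu * y / (l1 + l2 + m2) * ?\<psi>"
    using pos y by (simp add: sums_iff idle_edge)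
  have "(\<lambda>m. i (Suc m) 0 * x ^ Suc m) sums (\<Psi> x 0 - i 0 0)"
    by (rule \<Psi>_shift[OF x(1) smb])
  then have "(\<lambda>n. mu * x / (l1 + l2 + m1) * (p (Suc n) 0 * x ^ n)) sums (\<Psi> x 0 - i 0 0)"
    by (simp add: idle_edge mult_ac)
  from sums_divide[OF this, of "mu * x / (l1 + l2 + m1)"]
  have "(\<lambda>n. p (Suc n) 0 * x ^ n) sums ((\<Psi> x 0 - i 0 0) / (mu * x / (l1 + l2 + m1)))"
    using pos x by simp
  then have Pv: "\<Psi> x 0 = mu / (l1 + l2) * p 0 0 + mu * x / (l1 + l2 + m1) * ?\<phi>"
    using pos x by (simp add: sums_iff idle_edge)
  have "E * ((l1 + l2 + m2) * ?h2 / y) + \<Psi> x 0 * ((l1 + l2 + m1) * ?h1 / x)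
     = mu * (?h1 * ?\<phi> + ?h2 * ?\<psi>) + mu / (l1 + l2) * p 0 0 * ((l1 + l2 + m2) * ?h2 / y + (l1 + l2 + m1) * ?h1 / x)"
  proof -
    have *: "(c + mu * y / k2 * q2) * (k2 * h2 / y) + (c + mu * x / k1 * q1) * (k1 * h1 / x)
       = mu * (h1 * q1 + h2 * q2) + c * (k2 * h2 / y + k1 * h1 / x)" if "k1 \<noteq> 0" "k2 \<noteq> 0" for c k1 k2 q1 q2 h1 h2 :: real
      using x y that by (simp add: field_simps)
    show ?thesis
      unfolding Ev Pv by (rule *) (use pos in auto)
  qed
  also have "(l1 + l2 + m2) * ?h2 / y + (l1 + l2 + m1) * ?h1 / x
     = m1 * (mu * (1 - 1 / x) - ?h0) + m2 * (mu * (1 - 1 / y) - ?h0)"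
    unfolding h1 h2 by simp
  also have "\<dots> = tot * ?h0 - (m1 + m2) * ?h0"
    unfolding kernel by (simp add: algebra_simps)
  also have "\<dots> = (l1 + l2) * ?h0"
    by (simp add: algebra_simps)
  finally have "0 = mu * (?h1 * ?\<phi> + ?h2 * ?\<psi>) + mu / (l1 + l2) * p 0 0 * ((l1 + l2) * ?h0)"
    unfolding main[unfolded h1 h2] .
  also have "\<dots> = mu * (?h1 * ?\<phi> + ?h2 * ?\<psi> + ?h0 * p 0 0)"
  proof -
    have *: "mu * S + mu / L * P * (L * h) = mu * (S + h * P)" if "L > 0" for S L P h
      using that by (simp add: algebra_simps)
    show ?thesis
      by (rule *) (use pos in simp)
  qed
  finally have "mu * (?h1 * ?\<phi> + ?h2 * ?\<psi> + ?h0 * p 0 0) = 0"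
    by (rule sym)
  then show ?thesis
    using pos by simp
qed

text \<open>When \<open>mu * m2 = tot * l2\<close>, lemma \<open>marginal_decay\<close> gives no decay.  The flux at a weight \<open>x > 1\<close>, corrected by a multiple
  of the unweighted marginal, is then \<open>k\<close> times the tail sum of \<open>\<Phi> x\<close> and at most a multiple of the term
  preceding that tail, so the tail sums contract.\<close>

lemma critical_edge_decay:
  assumes critical: "mu * m2 = tot * l2" and less: "tot * l1 < mu * m1"
  obtains C \<theta> where "0 \<le> \<theta>" "\<theta> < 1" "\<And>n. p 0 (Suc n) \<le> C * \<theta> ^ n"
proof -
  have tot: "tot > 0"
    using pos by simp
  have "1 < mu * m1 / (tot * l1)"
    using less pos by (simp add: less_divide_eq)
  then obtain x where x: "1 < x" "x < mu * m1 / (tot * l1)"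
    using dense by blast
  then have x0: "0 < x"
    by simp
  obtain C where smb: "\<And>n. summable (\<lambda>m. p m n * x ^ m)" and C: "\<And>N. (\<Sum>n<N. \<Phi> x n) \<le> C"
    using weighted_bound[OF x0 x(2)] by blast
  note \<Phi>_nonneg' = \<Phi>_nonneg[OF x0 smb]
  have smb1: "summable (\<lambda>m. p m n * 1 ^ m)" for n
    using summable_col by simp
  \<comment> \<open>\<open>\<kappa>\<close> comes from \<open>edge\<close>: at criticality the cut
    equation makes the edge probability a multiple of the drop of the unweighted marginal.
    \<open>k\<close> and \<open>k'\<close> are, up to sign, the coefficients of
    \<open>\<Phi> x (Suc n)\<close> and of the edge term in \<open>flux_step\<close>;
    \<open>k > 0\<close> because \<open>1 < x < mu * m1 / (tot * l1)\<close>.\<close>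
  define \<kappa> where "\<kappa> = tot * l2 * (l1 + l2 + m2) / (m1 * m2 * mu)"
  define k where "k = (x - 1) / tot * (mu * m1 / x - tot * l1)"
  define k' where "k' = (x - 1) * mu * m1 / (tot * x)"
  have "k > 0"
  proof -
    have "x * (tot * l1) < mu * m1"
      using x(2) tot pos by (simp only: pos_less_divide_eq mult_pos_pos)
    then have "tot * l1 < mu * m1 / x"
      using x0 by (simp only: pos_less_divide_eq mult.commute)
    then show ?thesis
      unfolding k_def using x(1) tot by (intro mult_pos_pos) auto
  qed
  have "k' \<ge> 0" "\<kappa> \<ge> 0"
    unfolding k'_def \<kappa>_def using x pos by auto
  have \<Psi>_eq: "tot * \<Psi> z (Suc n) = mu * \<Phi> z (Suc n) + m1 * i 0 (Suc n)"
    if "z > 0" "\<And>n. summable (\<lambda>m. p m n * z ^ m)" for z n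
    using idle_sum[OF that, of "Suc n"] by simp
  have edge1: "m1 * m2 * i 0 (Suc n) = tot * l2 * (\<Phi> 1 n - \<Phi> 1 (Suc n))" for n
  proof -
    have "tot * (l2 * \<Phi> 1 n) = m2 * (tot * \<Psi> 1 (Suc n))"
      using flux_one[of n] by (simp add: flux_def)
    also have "\<dots> = m2 * (mu * \<Phi> 1 (Suc n) + m1 * i 0 (Suc n))"
      using \<Psi>_eq[OF _ smb1, of n] by simp
    also have "\<dots> = (tot * l2) * \<Phi> 1 (Suc n) + m1 * m2 * i 0 (Suc n)"
      unfolding critical[symmetric] by (simp add: algebra_simps)
    finally show ?thesis
      by (simp add: algebra_simps)
  qed
  have edge: "p 0 (Suc n) = \<kappa> * (\<Phi> 1 n - \<Phi> 1 (Suc n))" for n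
  proof -
    have "m1 * m2 * (mu / (l1 + l2 + m2) * p 0 (Suc n)) = tot * l2 * (\<Phi> 1 n - \<Phi> 1 (Suc n))"
      using edge1[of n] by (simp add: idle_edge)
    then have "m1 * m2 * mu * p 0 (Suc n) = (l1 + l2 + m2) * (tot * l2 * (\<Phi> 1 n - \<Phi> 1 (Suc n)))"
      using pos by (simp add: field_simps)
    then show ?thesis
      unfolding \<kappa>_def using pos by (simp add: field_simps)
  qed
  \<comment> \<open>Criticality gives both marginals the coefficient \<open>l2\<close>, so the flux
    is a difference of consecutive values of \<open>l2 * (\<Phi> x n - \<Phi> 1 n)\<close>; hence it
    tends to 0 and is at most the first of these values.\<close>
  have flux_eq: "flux x n = l2 * (\<Phi> x n - \<Phi> 1 n) - l2 * (\<Phi> x (Suc n) - \<Phi> 1 (Suc n))" for n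
  proof -
    have "tot * flux x n = tot * l2 * \<Phi> x n - m2 * (tot * \<Psi> x (Suc n))"
      by (simp add: flux_def algebra_simps)
    also have "\<dots> = tot * l2 * \<Phi> x n - (mu * m2) * \<Phi> x (Suc n) - m1 * m2 * i 0 (Suc n)"
      using \<Psi>_eq[OF x0 smb, of n] by (simp add: algebra_simps)
    also have "\<dots> = tot * (l2 * (\<Phi> x n - \<Phi> 1 n) - l2 * (\<Phi> x (Suc n) - \<Phi> 1 (Suc n)))"
      unfolding critical edge1 by (simp add: algebra_simps)
    finally show ?thesis
      using tot by simp
  qed
  \<comment> \<open>By \<open>edge\<close>, \<open>k' * p 0 (Suc n)\<close> is
    \<open>k' * \<kappa>\<close> times a difference of consecutive values of
    \<open>\<Phi> 1\<close>; the correction removes it from the recursion.\<close>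
  define Z where "Z n = flux x n + k' * \<kappa> * \<Phi> 1 n" for n
  have Z_step: "Z n - Z (Suc n) = k * \<Phi> x (Suc n)" for n
  proof -
    have "flux x n - flux x (Suc n) = m1 * (1 - 1 / x) * (\<Psi> x (Suc n) - i 0 (Suc n)) - l1 * (x - 1) * \<Phi> x (Suc n)"
      using flux_step[OF x0 smb, of "Suc n"] by simp
    also have "\<Psi> x (Suc n) = (mu * \<Phi> x (Suc n) + m1 * i 0 (Suc n)) / tot"
      using \<Psi>_eq[OF x0 smb, of n] tot by (simp add: field_simps)
    also have "m1 * (1 - 1 / x) * ((mu * \<Phi> x (Suc n) + m1 * i 0 (Suc n)) / tot - i 0 (Suc n)) - l1 * (x - 1) * \<Phi> x (Suc n)
       = k * \<Phi> x (Suc n) - (x - 1) * m1 * (tot - m1) / (tot * x) * i 0 (Suc n)"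
    proof -
      have "m1 * (1 - 1 / x) * ((mu * F + m1 * e) / T - e) - l1 * (x - 1) * F
         = (x - 1) / T * (mu * m1 / x - T * l1) * F - (x - 1) * m1 * (T - m1) / (T * x) * e" if "T > 0" for T F e
        using that x0 by (simp add: field_simps)
      then show ?thesis
        unfolding k_def using tot by blast
    qed
    also have "(x - 1) * m1 * (tot - m1) / (tot * x) * i 0 (Suc n) = k' * p 0 (Suc n)"
    proof -
      have "tot - m1 = l1 + l2 + m2"
        by simp
      then have "(tot - m1) * i 0 (Suc n) = mu * p 0 (Suc n)"
        using idle[of 0 "Suc n"] by (simp add: mult.commute add_ac)
      then show ?thesis
        unfolding k'_def by (simp add: mult.assoc)
    qed
    finally show ?thesis
      unfolding Z_def edge by (simp add: algebra_simps)
  qed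
  have le: "\<Phi> 1 n \<le> \<Phi> x n" for n
  proof (rule sums_le[OF _ \<Phi>_sums[OF _ smb1] \<Phi>_sums[OF x0 smb]])
    fix m
    have "1 ^ m \<le> x ^ m"
      using x by (intro power_mono) auto
    then show "p m n * 1 ^ m \<le> p m n * x ^ m"
      using nonneg by (intro mult_left_mono) auto
  qed simp
  have nonneg1: "\<Phi> 1 n \<ge> 0" for n
    by (rule \<Phi>_nonneg[OF _ smb1]) simp
  have "summable (\<Phi> x)"
    using \<Phi>_nonneg' C by (intro bounded_imp_summable[of _ C]) (simp, metis lessThan_Suc_atMost)
  then have \<Phi>0: "\<Phi> x \<longlonglongrightarrow> 0"
    by (rule summable_LIMSEQ_zero)
  have \<Phi>10: "\<Phi> 1 \<longlonglongrightarrow> 0"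
    by (rule tendsto_sandwich[OF _ _ tendsto_const \<Phi>0]) (auto simp: nonneg1 le)
  have "(\<lambda>n. l2 * (\<Phi> x n - \<Phi> 1 n) - l2 * (\<Phi> x (Suc n) - \<Phi> 1 (Suc n)) + k' * \<kappa> * \<Phi> 1 n)
     \<longlonglongrightarrow> l2 * (0 - 0) - l2 * (0 - 0) + k' * \<kappa> * 0"
    by (intro tendsto_intros \<Phi>0 \<Phi>10 LIMSEQ_Suc[OF \<Phi>0] LIMSEQ_Suc[OF \<Phi>10])
  then have Z0: "Z \<longlonglongrightarrow> 0"
    unfolding Z_def flux_eq by simp
  have tail: "(\<lambda>j. k * \<Phi> x (Suc (N + j))) sums Z N" for N
    using telescope_sums'[of "\<lambda>j. Z (N + j)" 0] LIMSEQ_ignore_initial_segment[OF Z0, of N]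
    by (simp add: Z_step add.commute)
  have Z_ge: "k * \<Phi> x (Suc N) \<le> Z N" for N
  proof -
    have "(\<Sum>j<1. k * \<Phi> x (Suc (N + j))) \<le> (\<Sum>j. k * \<Phi> x (Suc (N + j)))"
      using tail[of N] \<open>k > 0\<close> \<Phi>_nonneg' by (intro sum_le_suminf) (auto simp: sums_iff)
    then show ?thesis
      using tail[of N] by (simp add: sums_iff)
  qed
  define D where "D = l2 + k' * \<kappa>"
  have "D > 0"
    unfolding D_def using pos \<open>k' \<ge> 0\<close> \<open>\<kappa> \<ge> 0\<close> by (intro add_pos_nonneg) auto
  have contract: "(k + D) * Z (Suc N) \<le> D * Z N" for N
  proof -
    have "l2 * (\<Phi> x (Suc N) - \<Phi> 1 (Suc N)) \<le> l2 * \<Phi> x (Suc N)" "l2 * (\<Phi> x (Suc (Suc N)) - \<Phi> 1 (Suc (Suc N))) \<ge> 0"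
      "k' * \<kappa> * \<Phi> 1 (Suc N) \<le> k' * \<kappa> * \<Phi> x (Suc N)"
      using pos le nonneg1 \<open>k' \<ge> 0\<close> \<open>\<kappa> \<ge> 0\<close> by (auto intro!: mult_left_mono)
    then have "Z (Suc N) \<le> D * \<Phi> x (Suc N)"
      unfolding Z_def flux_eq D_def by (simp add: algebra_simps)
    then have "k * Z (Suc N) \<le> D * (k * \<Phi> x (Suc N))"
      using \<open>k > 0\<close> by (simp add: mult.left_commute)
    then show ?thesis
      by (simp add: Z_step[symmetric] algebra_simps)
  qed
  define \<theta> where "\<theta> = D / (k + D)"
  have \<theta>: "0 \<le> \<theta>" "\<theta> < 1"
    unfolding \<theta>_def using \<open>k > 0\<close> \<open>D > 0\<close> by auto
  have Zn: "Z n \<le> \<theta> ^ n * Z 0" for n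
  proof (induction n)
    case (Suc n)
    have "Z (Suc n) \<le> \<theta> * Z n"
      using contract[of n] \<open>k > 0\<close> \<open>D > 0\<close> unfolding \<theta>_def by (simp add: field_simps)
    also have "\<dots> \<le> \<theta> * (\<theta> ^ n * Z 0)"
      using Suc \<theta> by (intro mult_left_mono) auto
    finally show ?case
      by simp
  qed simp
  have "p 0 (Suc n) \<le> (Z 0 / k) * \<theta> ^ n" for n
  proof -
    have "k * p 0 (Suc n) \<le> k * \<Phi> x (Suc n)"
      using term_le_\<Phi>[OF x0 smb, of "Suc n"] \<open>k > 0\<close> by simp
    also have "\<dots> \<le> \<theta> ^ n * Z 0"
      using Z_ge[of n] Zn[of n] by linarith
    finally show ?thesis
      using \<open>k > 0\<close> by (simp add: field_simps)
  qed
  with \<theta> show ?thesis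
    using that by blast
qed

text \<open>With the idle probabilities eliminated, the busy equation at \<open>(Suc m, n)\<close>
  expresses \<open>p (Suc m) (n + 1)\<close> through the rows \<open>n\<close> and
  \<open>n - 1\<close>. After division by \<open>w\<close>, a shift of \<open>m\<close> by one only
  costs a factor \<open>x\<close> or \<open>1 / x\<close>, so a row inherits its limit from the two
  before it; the induction therefore carries two consecutive rows.\<close>

lemma interior_ratio_limit:
  assumes w: "\<And>m. w m \<noteq> 0" "(\<lambda>m. w (Suc m) / w m) \<longlonglongrightarrow> 1 / x" and "x \<noteq> 0"
    and base: "(\<lambda>m. p m 0 / w m) \<longlonglongrightarrow> u 0"
    and first: "u 1 = tot / (mu * m2) * (l1 + l2 + mu * m1 / (l1 + l2 + m1) - mu * m1 / (l1 + l2 + m1) / x - l1 * x) * u 0"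
    and rec: "\<And>n. mu * m2 * u (n + 2) = (tot * (l1 + l2) + mu * (m1 + m2) - mu * m1 / x - tot * l1 * x) * u (n + 1) - tot * l2 * u n"
  shows "(\<lambda>m. p m n / w m) \<longlonglongrightarrow> u n"
proof -
  have up: "(\<lambda>m. f (Suc m) / w m) \<longlonglongrightarrow> L / x" if "(\<lambda>m. f m / w m) \<longlonglongrightarrow> L" for f :: "nat \<Rightarrow> real" and L
    using tendsto_mult[OF LIMSEQ_Suc[OF that] w(2)] w(1) by simp
  have down: "(\<lambda>m. f m / w (Suc m)) \<longlonglongrightarrow> L * x" if "(\<lambda>m. f m / w m) \<longlonglongrightarrow> L" for f :: "nat \<Rightarrow> real" and L
  proof -
    have "(\<lambda>m. (f m / w m) / (w (Suc m) / w m)) \<longlonglongrightarrow> L / (1 / x)"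
      using \<open>x \<noteq> 0\<close> by (intro tendsto_divide that w) auto
    then show ?thesis
      using w(1) by simp
  qed
  have tot: "tot > 0"
    using pos by simp
  \<comment> \<open>On the row \<open>n = 0\<close> there are no retrials from the second orbit, so
    \<open>l1 + l2 + m1\<close> replaces \<open>tot\<close> in the idle equation; this is why the
    first step differs from the recursion.\<close>
  have step0: "p (Suc m) 1 = tot / (mu * m2) * ((l1 + l2 + mu * m1 / (l1 + l2 + m1)) * p (Suc m) 0
     - mu * m1 / (l1 + l2 + m1) * p (Suc (Suc m)) 0 - l1 * p m 0)" for m
  proof -
    have "l1 + l2 + mu - (l1 + l2) * (mu / (l1 + l2 + m1)) = l1 + l2 + mu * m1 / (l1 + l2 + m1)"
      using pos by (simp add: field_simps)
    moreover have "m2 * (mu / tot * p (Suc m) 1) = (l1 + l2 + mu - (l1 + l2) * (mu / (l1 + l2 + m1))) * p (Suc m) 0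
       - m1 * (mu / (l1 + l2 + m1) * p (Suc (Suc m)) 0) - l1 * p m 0"
      using busy[of "Suc m" 0] by (simp add: idle_edge left_diff_distrib)
    ultimately have "m2 * (mu / tot * p (Suc m) 1) = (l1 + l2 + mu * m1 / (l1 + l2 + m1)) * p (Suc m) 0
       - mu * m1 / (l1 + l2 + m1) * p (Suc (Suc m)) 0 - l1 * p m 0"
      by (simp only: times_divide_eq_left times_divide_eq_right mult_ac)
    then have "tot / (mu * m2) * (m2 * (mu / tot * p (Suc m) 1)) = tot / (mu * m2) * ((l1 + l2 + mu * m1 / (l1 + l2 + m1)) * p (Suc m) 0
       - mu * m1 / (l1 + l2 + m1) * p (Suc (Suc m)) 0 - l1 * p m 0)"
      by (rule arg_cong)
    then show ?thesis
      using pos tot by simp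
  qed
  have step: "p (Suc m) (n + 2) = ((tot * (l1 + l2) + mu * (m1 + m2)) * p (Suc m) (n + 1) - mu * m1 * p (Suc (Suc m)) (n + 1)
      - tot * l1 * p m (n + 1) - tot * l2 * p (Suc m) n) / (mu * m2)" for m n
  proof -
    have "m2 * (mu / tot * p (Suc m) (n + 2)) = (l1 + l2 + mu - (l1 + l2) * (mu / tot)) * p (Suc m) (n + 1)
       - m1 * (mu / tot * p (Suc (Suc m)) (n + 1)) - l1 * p m (n + 1) - l2 * p (Suc m) n"
      using busy[of "Suc m" "Suc n"] by (simp add: idle_edge left_diff_distrib)
    then have "tot * (m2 * (mu / tot * p (Suc m) (n + 2))) = tot * ((l1 + l2 + mu - (l1 + l2) * (mu / tot)) * p (Suc m) (n + 1)
       - m1 * (mu / tot * p (Suc (Suc m)) (n + 1)) - l1 * p m (n + 1) - l2 * p (Suc m) n)"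
      by (rule arg_cong)
    moreover have "T * (m2 * (mu / T * A)) = mu * m2 * A" "T * ((l1 + l2 + mu - (l1 + l2) * (mu / T)) * B - m1 * (mu / T * A) - C - D)
      = (T * (l1 + l2 + mu) - (l1 + l2) * mu) * B - mu * m1 * A - T * C - T * D" if "T > 0" for T A B C D
      using that by (simp_all add: field_simps)
    ultimately have "mu * m2 * p (Suc m) (n + 2) = (tot * (l1 + l2 + mu) - (l1 + l2) * mu) * p (Suc m) (n + 1)
       - mu * m1 * p (Suc (Suc m)) (n + 1) - tot * (l1 * p m (n + 1)) - tot * (l2 * p (Suc m) n)"
      using tot by metis
    then show ?thesis
      using pos by (simp add: field_simps)
  qed
  have "(\<lambda>m. p m n / w m) \<longlonglongrightarrow> u n \<and> (\<lambda>m. p m (n + 1) / w m) \<longlonglongrightarrow> u (n + 1)"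
  proof (induction n)
    case 0
    have "(\<lambda>m. tot / (mu * m2) * ((l1 + l2 + mu * m1 / (l1 + l2 + m1)) * (p (Suc m) 0 / w (Suc m))
     - mu * m1 / (l1 + l2 + m1) * (p (Suc (Suc m)) 0 / w (Suc m)) - l1 * (p m 0 / w (Suc m))))
     \<longlonglongrightarrow> tot / (mu * m2) * ((l1 + l2 + mu * m1 / (l1 + l2 + m1)) * u 0
     - mu * m1 / (l1 + l2 + m1) * (u 0 / x) - l1 * (u 0 * x))"
      by (intro tendsto_intros LIMSEQ_Suc[OF base] LIMSEQ_Suc[OF up[OF base]] down[OF base])
    also have "tot / (mu * m2) * ((l1 + l2 + mu * m1 / (l1 + l2 + m1)) * u 0
     - mu * m1 / (l1 + l2 + m1) * (u 0 / x) - l1 * (u 0 * x)) = u 1"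
    proof -
      have "T * ((L + c) * v - c * (v / x) - l1 * (v * x)) = T * (L + c - c / x - l1 * x) * v" for T L c v
        by (simp add: algebra_simps)
      then show ?thesis
        unfolding first by blast
    qed
    also have "(\<lambda>m. tot / (mu * m2) * ((l1 + l2 + mu * m1 / (l1 + l2 + m1)) * (p (Suc m) 0 / w (Suc m))
     - mu * m1 / (l1 + l2 + m1) * (p (Suc (Suc m)) 0 / w (Suc m)) - l1 * (p m 0 / w (Suc m)))) = (\<lambda>m. p (Suc m) 1 / w (Suc m))"
    proof -
      have "T * (A * (a / v) - B * (b / v) - C * (c / v)) = T * (A * a - B * b - C * c) / v" for T A B C a b c v :: real
        by (cases "v = 0") (simp_all add: field_simps)
      then show ?thesis
        unfolding step0 by (intro ext)
    qed
    finally have "(\<lambda>m. p m 1 / w m) \<longlonglongrightarrow> u 1"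
      by (rule LIMSEQ_imp_Suc)
    with base show ?case
      by simp
  next
    case (Suc n)
    then have l0: "(\<lambda>m. p m n / w m) \<longlonglongrightarrow> u n" and l1': "(\<lambda>m. p m (n + 1) / w m) \<longlonglongrightarrow> u (n + 1)"
      by auto
    have "(\<lambda>m. ((tot * (l1 + l2) + mu * (m1 + m2)) * (p (Suc m) (n + 1) / w (Suc m)) - mu * m1 * (p (Suc (Suc m)) (n + 1) / w (Suc m))
      - tot * l1 * (p m (n + 1) / w (Suc m)) - tot * l2 * (p (Suc m) n / w (Suc m))) / (mu * m2))
      \<longlonglongrightarrow> ((tot * (l1 + l2) + mu * (m1 + m2)) * u (n + 1) - mu * m1 * (u (n + 1) / x)
      - tot * l1 * (u (n + 1) * x) - tot * l2 * u n) / (mu * m2)"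
      using pos
      by (intro tendsto_intros LIMSEQ_Suc[OF l0] LIMSEQ_Suc[OF l1'] LIMSEQ_Suc[OF up[OF l1']] down[OF l1']) auto
    also have "((tot * (l1 + l2) + mu * (m1 + m2)) * u (n + 1) - mu * m1 * (u (n + 1) / x)
      - tot * l1 * (u (n + 1) * x) - tot * l2 * u n) / (mu * m2) = mu * m2 * u (n + 2) / (mu * m2)"
      unfolding rec by (simp add: algebra_simps)
    also have "\<dots> = u (n + 2)"
      using pos by simp
    also have "(\<lambda>m. ((tot * (l1 + l2) + mu * (m1 + m2)) * (p (Suc m) (n + 1) / w (Suc m)) - mu * m1 * (p (Suc (Suc m)) (n + 1) / w (Suc m))
      - tot * l1 * (p m (n + 1) / w (Suc m)) - tot * l2 * (p (Suc m) n / w (Suc m))) / (mu * m2)) = (\<lambda>m. p (Suc m) (n + 2) / w (Suc m))"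
    proof -
      have "(A * (a / v) - B * (b / v) - C * (c / v) - D * (d / v)) / T = (A * a - B * b - C * c - D * d) / T / v"
        for T A B C D a b c d v :: real
        by (cases "v = 0"; cases "T = 0") (simp_all add: field_simps)
      then show ?thesis
        unfolding step by (intro ext)
    qed
    finally have "(\<lambda>m. p m (n + 2) / w m) \<longlonglongrightarrow> u (n + 2)"
      by (rule LIMSEQ_imp_Suc)
    with l1' show ?case
      by simp
  qed
  then show ?thesis
    by blast
qed

end

section \<open>The retrial queue and its kernel on the real axis\<close>

lemma infsum_finite_support:
  fixes f :: "'a \<Rightarrow> real"
  assumes "finite S" "\<And>t. t \<notin> S \<Longrightarrow> f t = 0"
  shows "(\<Sum>\<^sub>\<infinity>t. f t) = sum f S"
proof -
  have "infsum f UNIV = infsum f S"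
    by (rule infsum_cong_neutral) (use assms in auto)
  with assms(1) show ?thesis
    by simp
qed

lemma positive_quadratic_factor:
  fixes A M s :: real
  assumes "A > 0" "M > 0" "s > 0" "s\<^sup>2 > 4 * A * M"
  obtains r1 r2 where "0 < r1" "r1 < r2" "r1 * r2 = M / A" "\<And>x. A * x\<^sup>2 - s * x + M = A * (x - r1) * (x - r2)"
proof -
  define D where "D = sqrt (s\<^sup>2 - 4 * A * M)"
  have D: "D > 0" "D\<^sup>2 = s\<^sup>2 - 4 * A * M"
    unfolding D_def using assms by auto
  have "D\<^sup>2 < s\<^sup>2"
    using D(2) mult_pos_pos[OF assms(1,2)] by simp
  then have "D < s"
    using assms by (simp add: power2_less_imp_less)
  have "((s - D) / (2 * A)) * ((s + D) / (2 * A)) = (s\<^sup>2 - D\<^sup>2) / (4 * A\<^sup>2)"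
    by (simp add: power2_eq_square algebra_simps)
  also have "\<dots> = M / A"
    unfolding D(2) using assms by (simp add: power2_eq_square)
  finally have prod: "((s - D) / (2 * A)) * ((s + D) / (2 * A)) = M / A" .
  have "A * x\<^sup>2 - s * x + M = A * (x - (s - D) / (2 * A)) * (x - (s + D) / (2 * A))" for x
  proof -
    have "A * (x - (s - D) / (2 * A)) * (x - (s + D) / (2 * A))
      = A * x\<^sup>2 - A * x * ((s - D) / (2 * A) + (s + D) / (2 * A)) + A * (((s - D) / (2 * A)) * ((s + D) / (2 * A)))"
    proof -
      have "A * (x - u) * (x - v) = A * x\<^sup>2 - A * x * (u + v) + A * (u * v)" for u v
        by (simp add: power2_eq_square algebra_simps)
      then show ?thesis by blast
    qed
    also have "(s - D) / (2 * A) + (s + D) / (2 * A) = s / A"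
      using assms by (simp add: field_simps)
    finally show ?thesis
      unfolding prod using assms by simp
  qed
  then show ?thesis
    using that[of "(s - D) / (2 * A)" "(s + D) / (2 * A)"] prod D \<open>D < s\<close> assms
    by (simp add: divide_strict_right_mono)
qed

text \<open>With \<open>c = muh1 / (lam + mu1)\<close> the left-hand side is, up to the factor \<open>alpha\<close>, the product of \<open>h1\<close> over both
  roots of the kernel, and the last factor on the right is \<open>g\<close>.\<close>

lemma boundary_product_identity:
  fixes l1 l2 mu m1 m2 x c :: "'a :: field"
  assumes c: "c * (l1 + l2 + m1) = mu * m1"
  shows "(l1 + l2 + m1)\<^sup>2 * ((l1 + l2 + m1 + m2) * (l1 * x\<^sup>2 - (l1 + l2 + c) * x + c)\<^sup>2
      - (l1 * x\<^sup>2 - (l1 + l2 + c) * x + c) * ((l1 + l2 + m1 + m2) * l1 * x\<^sup>2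
         - ((l1 + l2 + m1 + m2) * l1 + (l1 + l2 + m1 + m2) * l2 + mu * m1 + mu * m2) * x + mu * m1)
      + l2 * mu * m2 * x\<^sup>2)
    = mu * m2 * (x - 1) * ((l1 + l2) * l1 * (l1 + l2 + m1) * x\<^sup>2
      + (l1 + l2) * m1 * (l1 + l2 + m1 - mu) * x - mu * m1\<^sup>2)"
proof -
  define k where "k = l1 + l2 + m1"
  define b where "b = l1 * x\<^sup>2 - (l1 + l2 + c) * x + c"
  have m1: "mu * m1 = c * k" and l2: "l1 + l2 = k - m1"
    using c by (simp_all add: k_def)
  \<comment> \<open>This quadratic is \<open>bhat\<close>. Written as \<open>k + m2\<close> times
    \<open>b\<close> minus a remainder with factor \<open>m2\<close>, it cancels the square of
    \<open>b\<close>.\<close>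
  have eq1: "(k + m2) * l1 * x\<^sup>2 - ((k + m2) * l1 + (k + m2) * l2 + mu * m1 + mu * m2) * x + mu * m1
      = (k + m2) * b - (c * m2 * (1 - x) + mu * m2 * x)"
    unfolding b_def m1 using l2 by (simp add: algebra_simps)
  have "(k + m2) * b\<^sup>2 - b * ((k + m2) * l1 * x\<^sup>2 - ((k + m2) * l1 + (k + m2) * l2 + mu * m1 + mu * m2) * x + mu * m1)
      + l2 * mu * m2 * x\<^sup>2 = m2 * (c * (1 - x) * b + mu * x * (b + l2 * x))"
    unfolding eq1 by (simp add: power2_eq_square algebra_simps)
  also have "b + l2 * x = (x - 1) * (l1 * x - c)"
    by (simp add: b_def power2_eq_square algebra_simps)
  finally have eq2: "(k + m2) * b\<^sup>2 - b * ((k + m2) * l1 * x\<^sup>2 - ((k + m2) * l1 + (k + m2) * l2 + mu * m1 + mu * m2) * x + mu * m1)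
      + l2 * mu * m2 * x\<^sup>2 = m2 * (c * (1 - x) * b + mu * x * ((x - 1) * (l1 * x - c)))" .
  have "k\<^sup>2 * ((k + m2) * b\<^sup>2 - b * ((k + m2) * l1 * x\<^sup>2 - ((k + m2) * l1 + (k + m2) * l2 + mu * m1 + mu * m2) * x + mu * m1)
      + l2 * mu * m2 * x\<^sup>2) = m2 * (x - 1) * (k\<^sup>2 * mu * x * (l1 * x - c) - k\<^sup>2 * c * b)"
    unfolding eq2 by (simp add: algebra_simps)
  also have "k\<^sup>2 * mu * x * (l1 * x - c) - k\<^sup>2 * c * b
     = k * (k * mu - k * c) * l1 * x\<^sup>2 + (k * c) * (k * (l1 + l2) + k * c - k * mu) * x - (k * c)\<^sup>2"
    by (simp add: b_def power2_eq_square algebra_simps)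
  also have "\<dots> = mu * ((k - m1) * l1 * k * x\<^sup>2 + m1 * (k * (k - m1) - mu * (k - m1)) * x - mu * m1\<^sup>2)"
    unfolding l2 m1[symmetric, unfolded mult.commute[of c]] by (simp add: power2_eq_square algebra_simps)
  also have "m2 * (x - 1) * (mu * ((k - m1) * l1 * k * x\<^sup>2 + m1 * (k * (k - m1) - mu * (k - m1)) * x - mu * m1\<^sup>2))
    = mu * m2 * (x - 1) * ((k - m1) * l1 * k * x\<^sup>2 + (k - m1) * m1 * (k - mu) * x - mu * m1\<^sup>2)"
    by (simp add: algebra_simps)
  finally show ?thesis
    unfolding b_def k_def by (simp only: add_diff_cancel_right')
qed

locale retrial =
  fixes q :: retrial_params and P :: "state \<Rightarrow> real"
  assumes model: "retrial_model q"
    and drift1: "lamh1 q < muh1 q"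
    and stationary: "stationary_distribution q P"
begin

section \<open>Passage from the Markov chain to the balance equations\<close>

lemma param_pos: "lam1 q > 0" "lam2 q > 0" "mu q > 0" "mu1 q > 0" "mu2 q > 0"
  using model by (auto simp: retrial_model_def)

lemma rate_pos: "lam q > 0" "alpha q > 0" "lamh1 q > 0" "lamh2 q > 0" "muh1 q > 0" "muh2 q > 0"
  using param_pos by (auto simp: lam_def alpha_def lamh1_def lamh2_def muh1_def muh2_def)

lemma balance_at: "P s * (\<Sum>\<^sub>\<infinity>t. rate q s t) = (\<Sum>\<^sub>\<infinity>t. P t * rate q t s)"
  using stationary unfolding stationary_distribution_def by blast

lemma P_nonneg: "P s \<ge> 0"
  using stationary unfolding stationary_distribution_def by blast

text \<open>For \<open>m = 0\<close> or \<open>n = 0\<close> truncated subtraction makes some of the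
  listed target states coincide; as they form a set, none is counted twice.\<close>

lemma out_idle: "(\<Sum>\<^sub>\<infinity>t. rate q (m, n, Idle) t) = lam1 q + lam2 q + (if m = 0 then 0 else mu1 q) + (if n = 0 then 0 else mu2 q)"
proof -
  have "(\<Sum>\<^sub>\<infinity>t. rate q (m, n, Idle) t) = sum (rate q (m, n, Idle)) {(m, n, Busy), (m - 1, n, Busy), (m, n - 1, Busy)}"
    by (rule infsum_finite_support) auto
  also have "\<dots> = lam1 q + lam2 q + (if m = 0 then 0 else mu1 q) + (if n = 0 then 0 else mu2 q)"
    by (cases m; cases n) (auto simp: lam_def insert_commute)
  finally show ?thesis .
qed

lemma out_busy: "(\<Sum>\<^sub>\<infinity>t. rate q (m, n, Busy) t) = lam1 q + lam2 q + mu q"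
proof -
  have "(\<Sum>\<^sub>\<infinity>t. rate q (m, n, Busy) t) = sum (rate q (m, n, Busy)) {(m + 1, n, Busy), (m, n + 1, Busy), (m, n, Idle)}"
    by (rule infsum_finite_support) auto
  also have "\<dots> = lam1 q + lam2 q + mu q"
    by auto
  finally show ?thesis .
qed

lemma rate_eq_0_idle: "rate q t (m, n, Idle) = 0" if "t \<noteq> (m, n, Busy)"
proof (cases t)
  case (fields a b k)
  then show ?thesis
    using that by (cases k) auto
qed

lemma in_idle: "(\<Sum>\<^sub>\<infinity>t. P t * rate q t (m, n, Idle)) = P (m, n, Busy) * mu q"
proof -
  have "(\<Sum>\<^sub>\<infinity>t. P t * rate q t (m, n, Idle)) = (\<Sum>t\<in>{(m, n, Busy)}. P t * rate q t (m, n, Idle))"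
    by (rule infsum_finite_support) (use rate_eq_0_idle in auto)
  then show ?thesis
    by simp
qed

lemma in_busy: "(\<Sum>\<^sub>\<infinity>t. P t * rate q t (m, n, Busy)) = (lam1 q + lam2 q) * P (m, n, Idle) + mu1 q * P (Suc m, n, Idle)
   + mu2 q * P (m, Suc n, Idle) + (if m = 0 then 0 else lam1 q * P (m - 1, n, Busy)) + (if n = 0 then 0 else lam2 q * P (m, n - 1, Busy))"
proof -
  define S where "S = {(m, n, Idle), (Suc m, n, Idle), (m, Suc n, Idle)}
    \<union> (if m = 0 then {} else {(m - 1, n, Busy)}) \<union> (if n = 0 then {} else {(m, n - 1, Busy)})"
  have "rate q t (m, n, Busy) = 0" if "t \<notin> S" for t
  proof (cases t)
    case (fields a b k)
    then show ?thesis
      using that by (cases k) (auto simp: S_def split: if_splits)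
  qed
  then have "(\<Sum>\<^sub>\<infinity>t. P t * rate q t (m, n, Busy)) = (\<Sum>t\<in>S. P t * rate q t (m, n, Busy))"
    by (intro infsum_finite_support) (auto simp: S_def)
  also have "\<dots> = (lam1 q + lam2 q) * P (m, n, Idle) + mu1 q * P (Suc m, n, Idle)
   + mu2 q * P (m, Suc n, Idle) + (if m = 0 then 0 else lam1 q * P (m - 1, n, Busy)) + (if n = 0 then 0 else lam2 q * P (m, n - 1, Busy))"
    unfolding S_def by (cases m; cases n) (auto simp: lam_def)
  finally show ?thesis .
qed

lemma summable_injective:
  assumes "inj f"
  shows "summable (\<lambda>n::nat. P (f n))"
proof -
  have "P summable_on UNIV"
    using stationary by (auto simp: stationary_distribution_def has_sum_imp_summable)
  then have "P summable_on range f"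
    by (rule summable_on_subset_banach) simp
  then have "(P \<circ> f) summable_on UNIV"
    using summable_on_reindex[OF assms, of P] by simp
  then show ?thesis
    using summable_on_UNIV_nonneg_real_iff[of "P \<circ> f"] P_nonneg by (simp add: o_def)
qed

sublocale bal: balance "lam1 q" "lam2 q" "mu q" "mu1 q" "mu2 q" "\<lambda>m n. P (m, n, Busy)" "\<lambda>m n. P (m, n, Idle)"
proof
  fix m n
  show "P (m, n, Idle) * (lam1 q + lam2 q + (if m = 0 then 0 else mu1 q) + (if n = 0 then 0 else mu2 q)) = mu q * P (m, n, Busy)"
    using balance_at[of "(m, n, Idle)"] by (simp only: out_idle in_idle mult.commute)
  show "(lam1 q + lam2 q + mu q) * P (m, n, Busy) = (lam1 q + lam2 q) * P (m, n, Idle) + mu1 q * P (Suc m, n, Idle)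
   + mu2 q * P (m, Suc n, Idle) + (if m = 0 then 0 else lam1 q * P (m - 1, n, Busy)) + (if n = 0 then 0 else lam2 q * P (m, n - 1, Busy))"
    using balance_at[of "(m, n, Busy)"] by (simp only: out_busy in_busy mult.commute[of "P (m, n, Busy)"])
qed (auto simp: param_pos P_nonneg intro!: summable_injective injI)

text \<open>Otherwise \<open>origin_pos\<close> makes all busy, hence all idle probabilities vanish,
  against total mass 1.\<close>

lemma P00_pos: "P (0, 0, Busy) > 0"
proof (rule ccontr)
  assume neg: "\<not> P (0, 0, Busy) > 0"
  have busy0: "P (m, n, Busy) = 0" for m n
    using bal.origin_pos[of m n] neg P_nonneg[of "(m, n, Busy)"] by (cases "P (m, n, Busy) > 0") auto
  have "P (m, n, Idle) = 0" for m n
    using bal.idle[of m n] busy0 param_pos by (auto split: if_splits)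
  then have "P s = 0" for s
    using busy0 by (cases s; cases "snd (snd s)") auto
  then have "P = (\<lambda>_. 0)"
    by auto
  then have "((\<lambda>_. 0) has_sum (1::real)) (UNIV :: state set)"
    using stationary by (simp add: stationary_distribution_def)
  moreover have "((\<lambda>_. 0) has_sum (0::real)) (UNIV :: state set)"
    by simp
  ultimately show False
    using has_sum_unique by fastforce
qed

section \<open>Branch points and the two branches for real arguments\<close>

definition s0 :: real where "s0 = sqrt (muh1 q / lamh1 q)"
text \<open>By Vieta for the kernel in \<open>y\<close>, the geometric mean of \<open>Y0\<close> and
  \<open>Y1\<close> at every \<open>x\<close> between 1 and \<open>x_3\<close>. Likewise
  \<open>s0\<close> is the geometric mean of \<open>x_2\<close> and \<open>x_3\<close> and of
  \<open>x_1\<close> and \<open>x_4\<close>, so its circle separates inner from outer branch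
  points.\<close>

definition \<sigma> :: real where "\<sigma> = sqrt (muh2 q / lamh2 q)"

lemma s0: "1 < s0" "s0 < muh1 q / lamh1 q" "s0\<^sup>2 = muh1 q / lamh1 q"
proof -
  have gt1: "1 < muh1 q / lamh1 q"
    using drift1 rate_pos by simp
  then show "1 < s0" and sq: "s0\<^sup>2 = muh1 q / lamh1 q"
    by (simp_all add: s0_def)
  then have "s0 * 1 < s0 * s0"
    by (intro mult_strict_left_mono) auto
  then show "s0 < muh1 q / lamh1 q"
    using sq by (simp add: power2_eq_square)
qed

lemma \<sigma>: "\<sigma> > 0" "\<sigma>\<^sup>2 = muh2 q / lamh2 q"
  using rate_pos by (auto simp: \<sigma>_def)

text \<open>The arithmetic-geometric mean inequality gives \<open>b_plus <= 0\<close> at 1, so 1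
  lies between \<open>x_2\<close> and \<open>x_3\<close>; as their product is
  \<open>muh1 / lamh1\<close>, that quotient is a lower bound of \<open>x_3\<close>. The roots are
  nested because \<open>b_minus\<close> is negative at \<open>x_3\<close> and both quadratics have
  the same product of roots.\<close>

lemma branch_points:
  "0 < x_1 q" "x_1 q < x_2 q" "x_2 q < s0" "s0 < x_3 q" "x_3 q < x_4 q" "x_2 q \<le> 1" "muh1 q / lamh1 q \<le> x_3 q"
  "b_plus q x = lamh1 q * (x - x_2 q) * (x - x_3 q)"
  "b_minus q x = lamh1 q * (x - x_1 q) * (x - x_4 q)"
proof -
  define d where "d = sqrt (lamh2 q * muh2 q)"
  define S where "S = lamh1 q + lamh2 q + muh1 q + muh2 q"
  have d: "d > 0" "d\<^sup>2 = lamh2 q * muh2 q"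
    unfolding d_def using rate_pos by auto
  have amgm: "2 * d \<le> lamh2 q + muh2 q"
    using arith_geo_mean_sqrt[of "lamh2 q" "muh2 q"] rate_pos by (simp add: d_def)
  have big: "s > 0 \<and> s\<^sup>2 > 4 * lamh1 q * muh1 q" if "s \<ge> lamh1 q + muh1 q" for s
  proof
    show "s > 0"
      using that rate_pos by linarith
    have "0 < (lamh1 q - muh1 q)\<^sup>2"
      using drift1 by simp
    then have "4 * lamh1 q * muh1 q < (lamh1 q + muh1 q)\<^sup>2"
      by (simp add: power2_eq_square algebra_simps)
    also have "\<dots> \<le> s\<^sup>2"
      using that rate_pos by (intro power_mono) auto
    finally show "s\<^sup>2 > 4 * lamh1 q * muh1 q" .
  qed
  have plus: "b_plus q x = lamh1 q * x\<^sup>2 - (S - 2 * d) * x + muh1 q" for x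
    by (simp add: b_plus_def bhat_def S_def d_def algebra_simps)
  have minus: "b_minus q x = lamh1 q * x\<^sup>2 - (S + 2 * d) * x + muh1 q" for x
    by (simp add: b_minus_def bhat_def S_def d_def algebra_simps)
  obtain r2 r3 where r: "0 < r2" "r2 < r3" "r2 * r3 = muh1 q / lamh1 q"
    and fp: "\<And>x. b_plus q x = lamh1 q * (x - r2) * (x - r3)"
    using positive_quadratic_factor[of "lamh1 q" "muh1 q" "S - 2 * d"] big[of "S - 2 * d"] amgm rate_pos
    unfolding plus S_def by (smt (verit, best))
  obtain r1 r4 where r': "0 < r1" "r1 < r4" "r1 * r4 = muh1 q / lamh1 q"
    and fm: "\<And>x. b_minus q x = lamh1 q * (x - r1) * (x - r4)"
    using positive_quadratic_factor[of "lamh1 q" "muh1 q" "S + 2 * d"] big[of "S + 2 * d"] d rate_pos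
    unfolding minus S_def by (smt (verit, best))
  have "{x. b_plus q x = 0} = {r2, r3}" "{x. b_minus q x = 0} = {r1, r4}"
    unfolding fp fm using rate_pos by auto
  then have eq: "x_2 q = r2" "x_3 q = r3" "x_1 q = r1" "x_4 q = r4"
    using r r' by (auto simp: x_1_def x_2_def x_3_def x_4_def)
  have "r3 < r4"
  proof -
    have "b_minus q r3 = b_plus q r3 - 4 * d * r3"
      unfolding plus minus by (simp add: algebra_simps)
    also have "\<dots> < 0"
      unfolding fp using d r by simp
    finally have "(r3 - r1) * (r3 - r4) < 0"
      unfolding fm using rate_pos by (simp add: mult.assoc mult_less_0_iff)
    then show ?thesis
      using r' by (auto simp: mult_less_0_iff)
  qed
  have "r1 < r2"
  proof (rule ccontr)
    assume "\<not> r1 < r2"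
    then have "r2 * r3 < r1 * r4"
      using \<open>r3 < r4\<close> r by (intro mult_le_less_imp_less) auto
    then show False
      using r r' by simp
  qed
  have "b_plus q 1 \<le> 0"
    unfolding plus S_def using amgm by simp
  then have "(1 - r2) * (1 - r3) \<le> 0"
    unfolding fp using rate_pos by (simp add: mult.assoc mult_le_0_iff)
  then have le1: "r2 \<le> 1" "1 \<le> r3"
    using r by (auto simp: mult_le_0_iff)
  have "muh1 q / lamh1 q \<le> 1 * r3"
    unfolding r(3)[symmetric] using le1 r by (intro mult_right_mono) auto
  then have "muh1 q / lamh1 q \<le> r3"
    by simp
  moreover have "s0 < r3"
    using calculation s0 by linarith
  moreover have "r2 < s0"
    using le1 s0 by linarith
  ultimately show "0 < x_1 q" "x_1 q < x_2 q" "x_2 q < s0" "s0 < x_3 q" "x_3 q < x_4 q" "x_2 q \<le> 1" "muh1 q / lamh1 q \<le> x_3 q"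
  "b_plus q x = lamh1 q * (x - x_2 q) * (x - x_3 q)"
  "b_minus q x = lamh1 q * (x - x_1 q) * (x - x_4 q)"
    unfolding eq using r r' le1 \<open>r3 < r4\<close> \<open>r1 < r2\<close> fp fm by simp_all
qed

definition ca :: real where "ca = muh1 q / (lam q + mu1 q)"
definition cb :: real where "cb = muh2 q / (lam q + mu2 q)"

lemma ca: "0 < ca" "ca < mu q" "ca * (lam q + mu1 q) = muh1 q" "alpha q * ca - muh1 q = ca * mu2 q"
proof -
  have k: "lam q + mu1 q > 0"
    using rate_pos param_pos by simp
  show "0 < ca"
    unfolding ca_def using k rate_pos by simp
  show e: "ca * (lam q + mu1 q) = muh1 q"
    unfolding ca_def using k by simp
  show "ca < mu q"
    unfolding ca_def muh1_def using k rate_pos param_pos by (simp add: field_simps)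
  show "alpha q * ca - muh1 q = ca * mu2 q"
    unfolding e[symmetric] alpha_def by (simp add: algebra_simps)
qed

lemma cb: "0 < cb" "cb < mu q" "cb * (lam q + mu2 q) = muh2 q" "alpha q * cb - muh2 q = cb * mu1 q"
proof -
  have k: "lam q + mu2 q > 0"
    using rate_pos param_pos by simp
  show "0 < cb"
    unfolding cb_def using k rate_pos by simp
  show e: "cb * (lam q + mu2 q) = muh2 q"
    unfolding cb_def using k by simp
  show "cb < mu q"
    unfolding cb_def muh2_def using k rate_pos param_pos by (simp add: field_simps)
  show "alpha q * cb - muh2 q = cb * mu1 q"
    unfolding e[symmetric] alpha_def by (simp add: algebra_simps)
qed

lemma Delta_eq: "Delta q x = (bhat q x)\<^sup>2 - 4 * x\<^sup>2 * (lamh2 q * muh2 q)"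
proof -
  have "(2 * x * sqrt (lamh2 q * muh2 q))\<^sup>2 = 4 * x\<^sup>2 * (lamh2 q * muh2 q)"
    using rate_pos by (simp add: power_mult_distrib)
  moreover have "Delta q x = (bhat q x)\<^sup>2 - (2 * x * sqrt (lamh2 q * muh2 q))\<^sup>2"
    unfolding Delta_def b_plus_def b_minus_def by (simp add: power2_eq_square algebra_simps)
  ultimately show ?thesis
    by simp
qed

lemma Delta_factor: "Delta q x = (lamh1 q)\<^sup>2 * (x - x_1 q) * (x - x_2 q) * (x_3 q - x) * (x_4 q - x)"
  unfolding Delta_def branch_points(8,9) by (simp add: power2_eq_square algebra_simps)

lemma between_branch_points:
  assumes "1 < x" "x \<le> x_3 q"
  shows "bhat q x < 0" "Delta q x \<ge> 0" "x < x_3 q \<Longrightarrow> Delta q x > 0"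
proof -
  have bp: "b_plus q x \<le> 0"
    unfolding branch_points(8) using assms branch_points(6) rate_pos
    by (intro mult_nonneg_nonpos) auto
  have "sqrt (lamh2 q * muh2 q) > 0"
    using rate_pos by simp
  then have "2 * x * sqrt (lamh2 q * muh2 q) > 0"
    using assms by simp
  with bp show "bhat q x < 0"
    by (simp add: b_plus_def)
  show "Delta q x \<ge> 0"
    unfolding Delta_factor using assms branch_points(1-7) by (intro mult_nonneg_nonneg) auto
  show "Delta q x > 0" if "x < x_3 q"
    unfolding Delta_factor using assms that branch_points(1-7) rate_pos by (intro mult_pos_pos) auto
qed

text \<open>\<open>bhat\<close> is negative on this range, so the minus sign selects the smaller
  modulus. The last two claims are Vieta's formulas, and the product also yields the sign of
  \<open>Y0\<close>.\<close>

lemma branch_values: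
  assumes "1 < x" "x \<le> x_3 q"
  shows "Y0 q x = Y_minus q x" "Y1 q x = Y_plus q x"
    "0 < Y0 q x" "Y0 q x \<le> Y1 q x" "x < x_3 q \<Longrightarrow> Y0 q x < Y1 q x"
    "Y0 q x + Y1 q x = - bhat q x / (lamh2 q * x)" "Y0 q x * Y1 q x = muh2 q / lamh2 q"
proof -
  note b = between_branch_points[OF assms]
  have den: "2 * lamh2 q * x > 0"
    using rate_pos assms by simp
  have sq: "sqrt (Delta q x) \<ge> 0" "(sqrt (Delta q x))\<^sup>2 = Delta q x"
    using b by auto
  have le: "\<bar>- bhat q x - sqrt (Delta q x)\<bar> \<le> \<bar>- bhat q x + sqrt (Delta q x)\<bar>"
    using b(1) sq(1) by linarith
  have "\<bar>Y_minus q x\<bar> \<le> \<bar>Y_plus q x\<bar>"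
    unfolding Y_minus_def Y_plus_def abs_divide using le den by (intro divide_right_mono) auto
  then show Y0: "Y0 q x = Y_minus q x" and Y1: "Y1 q x = Y_plus q x"
    by (simp_all add: Y0_def Y1_def)
  have "(Y0 q x) * (Y1 q x) = ((bhat q x)\<^sup>2 - (sqrt (Delta q x))\<^sup>2) / (2 * lamh2 q * x)\<^sup>2"
    unfolding Y0 Y1 Y_minus_def Y_plus_def times_divide_times_eq by (simp add: power2_eq_square algebra_simps)
  also have "\<dots> = (4 * x\<^sup>2 * (lamh2 q * muh2 q)) / (2 * lamh2 q * x)\<^sup>2"
    unfolding sq(2) unfolding Delta_eq by simp
  also have "\<dots> = muh2 q / lamh2 q"
    using rate_pos assms(1) by (simp add: power2_eq_square)
  finally show prod: "Y0 q x * Y1 q x = muh2 q / lamh2 q" .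
  show "Y0 q x + Y1 q x = - bhat q x / (lamh2 q * x)"
    unfolding Y0 Y1 Y_minus_def Y_plus_def add_divide_distrib[symmetric] by simp
  show "Y0 q x \<le> Y1 q x"
    unfolding Y0 Y1 Y_minus_def Y_plus_def using den sq by (intro divide_right_mono) auto
  show "Y0 q x < Y1 q x" if "x < x_3 q"
    unfolding Y0 Y1 Y_minus_def Y_plus_def using den b(3)[OF that] by (intro divide_strict_right_mono) auto
  have "Y1 q x > 0"
    unfolding Y1 Y_plus_def using den sq(1) b(1) by (intro divide_pos_pos; linarith)
  then show "0 < Y0 q x"
    using prod rate_pos by (metis divide_pos_pos zero_less_mult_pos2)
qed

lemma Y0_le_\<sigma>:
  assumes "1 < x" "x \<le> x_3 q"
  shows "Y0 q x \<le> \<sigma>" "x < x_3 q \<Longrightarrow> Y0 q x < \<sigma>"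
proof -
  note b = branch_values[OF assms]
  have "(Y0 q x)\<^sup>2 \<le> \<sigma>\<^sup>2"
    unfolding \<sigma>(2) b(7)[symmetric] unfolding power2_eq_square using b by (intro mult_left_mono) auto
  then show "Y0 q x \<le> \<sigma>"
    by (rule power2_le_imp_le) (use \<sigma>(1) in simp)
  assume "x < x_3 q"
  then have "(Y0 q x)\<^sup>2 < \<sigma>\<^sup>2"
    unfolding \<sigma>(2) b(7)[symmetric] unfolding power2_eq_square using b by (intro mult_strict_left_mono) auto
  then show "Y0 q x < \<sigma>"
    by (rule power2_less_imp_less) (use \<sigma>(1) in simp)
qed

lemma Y0_x3: "Y0 q (x_3 q) = \<sigma>" "Y1 q (x_3 q) = \<sigma>"
proof -
  have x3: "1 < x_3 q"
    using branch_points s0 by linarith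
  note b = branch_values[OF x3 order.refl]
  have "Delta q (x_3 q) = 0"
    by (simp add: Delta_factor)
  then have eq: "Y0 q (x_3 q) = Y1 q (x_3 q)"
    unfolding b(1,2) Y_minus_def Y_plus_def by simp
  then have "(Y0 q (x_3 q))\<^sup>2 = \<sigma>\<^sup>2"
    using b(7) \<sigma>(2) by (simp add: power2_eq_square)
  then show "Y0 q (x_3 q) = \<sigma>"
    using b(3) \<sigma>(1) by (simp add: power2_eq_iff_nonneg)
  with eq show "Y1 q (x_3 q) = \<sigma>"
    by simp
qed

section \<open>Signs of \<open>h1\<close>, \<open>h2\<close> and \<open>h0\<close> on the kernel
  curve\<close>

definition on_kernel :: "real \<Rightarrow> real \<Rightarrow> bool" where
  "on_kernel x y \<longleftrightarrow> alpha q * h0 q x y = muh1 q * (1 - 1 / x) + muh2 q * (1 - 1 / y)"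

text \<open>The kernel polynomial divided by \<open>x * y\<close>. This form replaces
  \<open>alpha * h0\<close> by terms in \<open>1 - 1 / x\<close> and \<open>1 - 1 / y\<close>, which
  is what \<open>h1_kernel\<close> and \<open>h2_kernel\<close> exploit.\<close>

lemma on_kernelI:
  assumes "x \<noteq> 0" "y \<noteq> 0" "lamh2 q * x * y\<^sup>2 + bhat q x * y + muh2 q * x = 0"
  shows "on_kernel x y"
proof -
  have "lamh1 q * x + lamh2 q * y - lamh1 q - lamh2 q - (muh1 q * (1 - 1 / x) + muh2 q * (1 - 1 / y))
     = (lamh2 q * x * y\<^sup>2 + bhat q x * y + muh2 q * x) / (x * y)"
    using assms(1,2) by (simp add: bhat_def field_simps power2_eq_square)
  then show ?thesis
    using assms(3) unfolding on_kernel_def h0_def lam_def lamh1_def lamh2_def by (simp add: algebra_simps)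
qed

lemma on_kernel_branch:
  assumes "1 < x" "x \<le> x_3 q"
  shows "on_kernel x (Y0 q x)"
proof -
  note b = branch_values[OF assms]
  have bh: "bhat q x = - lamh2 q * x * (Y0 q x + Y1 q x)"
    unfolding b(6) using rate_pos assms by (simp add: field_simps)
  have m: "muh2 q = lamh2 q * (Y0 q x * Y1 q x)"
    unfolding b(7) using rate_pos by simp
  show ?thesis
    by (rule on_kernelI) (use assms b(3) in \<open>auto simp: bh m power2_eq_square algebra_simps\<close>)
qed

lemma h1_alt: "x \<noteq> 0 \<Longrightarrow> h1 q x y = x * (h0 q x y - ca * (1 - 1 / x))"
  unfolding h1_def a1_def b1_def h0_def ca_def[symmetric] by (simp add: field_simps power2_eq_square)

lemma h2_alt: "y \<noteq> 0 \<Longrightarrow> h2 q x y = y * (h0 q x y - cb * (1 - 1 / y))"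
  unfolding h2_def h0_def cb_def[symmetric] by (simp add: field_simps power2_eq_square)

lemma h1_kernel:
  assumes "on_kernel x y" "x \<noteq> 0"
  shows "alpha q * h1 q x y = x * mu2 q * (mu q * (1 - 1 / y) - ca * (1 - 1 / x))"
proof -
  have "alpha q * h1 q x y = x * (alpha q * h0 q x y - alpha q * ca * (1 - 1 / x))"
    unfolding h1_alt[OF assms(2)] by (simp add: algebra_simps)
  also have "\<dots> = x * (muh2 q * (1 - 1 / y) - (alpha q * ca - muh1 q) * (1 - 1 / x))"
    unfolding assms(1)[unfolded on_kernel_def] by (simp add: algebra_simps)
  also have "\<dots> = x * mu2 q * (mu q * (1 - 1 / y) - ca * (1 - 1 / x))"
    unfolding ca(4) muh2_def by (simp add: algebra_simps)
  finally show ?thesis .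
qed

lemma h2_kernel:
  assumes "on_kernel x y" "y \<noteq> 0"
  shows "alpha q * h2 q x y = y * mu1 q * (mu q * (1 - 1 / x) - cb * (1 - 1 / y))"
proof -
  have "alpha q * h2 q x y = y * (alpha q * h0 q x y - alpha q * cb * (1 - 1 / y))"
    unfolding h2_alt[OF assms(2)] by (simp add: algebra_simps)
  also have "\<dots> = y * (muh1 q * (1 - 1 / x) - (alpha q * cb - muh2 q) * (1 - 1 / y))"
    unfolding assms(1)[unfolded on_kernel_def] by (simp add: algebra_simps)
  also have "\<dots> = y * mu1 q * (mu q * (1 - 1 / x) - cb * (1 - 1 / y))"
    unfolding cb(4) muh1_def by (simp add: algebra_simps)
  finally show ?thesis .
qed

text \<open>With \<open>a = 1 - 1 / x\<close> and \<open>b = 1 - 1 / y\<close> the condition on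
  \<open>h1\<close> reads \<open>mu * b <= ca * a\<close>; since \<open>ca\<close> and
  \<open>cb\<close> are below \<open>mu\<close>, it forces \<open>cb * b < mu * a\<close>, which is
  the claim.\<close>

lemma h2_pos:
  assumes "on_kernel x y" "1 < x" "0 < y" "h1 q x y \<le> 0"
  shows "h2 q x y > 0"
proof -
  have "alpha q * h1 q x y \<le> 0"
    using assms(4) rate_pos by (simp add: mult_nonneg_nonpos)
  then have "x * mu2 q * (mu q * (1 - 1 / y) - ca * (1 - 1 / x)) \<le> 0"
    using h1_kernel[OF assms(1)] assms by simp
  then have le: "mu q * (1 - 1 / y) \<le> ca * (1 - 1 / x)"
    using assms param_pos by (simp add: mult_le_0_iff zero_less_mult_iff)
  have a: "1 - 1 / x > 0"
    using assms by simp
  have "mu q * (cb * (1 - 1 / y)) \<le> cb * (ca * (1 - 1 / x))"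
    using mult_left_mono[OF le, of cb] cb by (simp add: mult.left_commute)
  also have "\<dots> < mu q * (mu q * (1 - 1 / x))"
    using ca cb a param_pos by (simp add: mult.assoc[symmetric] mult_strict_mono)
  finally have "cb * (1 - 1 / y) < mu q * (1 - 1 / x)"
    using param_pos by simp
  then have "alpha q * h2 q x y > 0"
    unfolding h2_kernel[OF assms(1) less_imp_neq[OF assms(3), symmetric]] using assms param_pos by simp
  then show "h2 q x y > 0"
    using rate_pos by (simp add: zero_less_mult_iff)
qed

lemma h0_pos_at_zero:
  assumes "1 < x" "h1 q x y = 0"
  shows "h0 q x y > 0"
proof -
  have "h0 q x y = ca * (1 - 1 / x)"
    using assms h1_alt[of x y] by simp
  then show ?thesis
    using assms ca by simp
qed

text \<open>Writing \<open>a = 1 - 1 / x\<close> and \<open>b = 1 - 1 / y\<close> makes \<open>h1 / x\<close> and \<open>h2 / y\<close> linear in \<open>a\<close> and \<open>b\<close> on the kernel; the signs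
  below give the non-vanishing of the constant of the third type.\<close>

lemma derivative_sign:
  assumes ker: "on_kernel x \<sigma>" and x: "1 < x" and neg: "h1 q x \<sigma> < 0"
  shows "lam2 q * x * h2 q x \<sigma> - h1 q x \<sigma> * (2 * lam2 q * \<sigma> + lam1 q * x - lam q - cb) > 0"
    "lam2 q * x * h0 q x \<sigma> - h1 q x \<sigma> * lam2 q > 0"
proof -
  define a b where "a = 1 - 1 / x" and "b = 1 - 1 / \<sigma>"
  let ?M = "mu q"
  have a: "0 < a" "a < 1"
    using x by (auto simp: a_def)
  have \<sigma>0: "\<sigma> \<noteq> 0"
    using \<sigma> by simp
  have H1: "alpha q * h1 q x \<sigma> = x * mu2 q * (?M * b - ca * a)"
    unfolding a_def b_def using h1_kernel[OF ker] x by simp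
  have H2: "alpha q * h2 q x \<sigma> = \<sigma> * mu1 q * (?M * a - cb * b)"
    unfolding a_def b_def using h2_kernel[OF ker \<sigma>0] by simp
  have H0: "alpha q * h0 q x \<sigma> = ?M * mu1 q * a + ?M * mu2 q * b"
    using ker unfolding on_kernel_def a_def b_def muh1_def muh2_def by simp
  have b: "?M * b < ca * a"
  proof -
    have "alpha q * h1 q x \<sigma> < 0"
      using neg rate_pos by (simp add: mult_pos_neg)
    then show ?thesis
      unfolding H1 using x param_pos by (simp add: mult_less_0_iff)
  qed
  have "lamh2 q * \<sigma>\<^sup>2 = muh2 q"
    using \<sigma>(2) rate_pos by simp
  then have "alpha q * lam2 q * \<sigma> = muh2 q / \<sigma>"
    using \<sigma>0 by (simp add: lamh2_def power2_eq_square field_simps)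
  also have "\<dots> = ?M * mu2 q * (1 - b)"
    unfolding b_def muh2_def by simp
  finally have L2: "alpha q * lam2 q * \<sigma> = ?M * mu2 q * (1 - b)" .
  have split: "2 * lam2 q * \<sigma> + lam1 q * x - lam q - cb = h0 q x \<sigma> + lam2 q * \<sigma> - cb"
    by (simp add: h0_def)
  have "alpha q * (2 * lam2 q * \<sigma> + lam1 q * x - lam q - cb) = alpha q * h0 q x \<sigma> + alpha q * lam2 q * \<sigma> - alpha q * cb"
    unfolding split by (simp add: algebra_simps)
  also have "\<dots> = mu1 q * (?M * a - cb)"
  proof -
    have "alpha q * cb = ?M * mu2 q + cb * mu1 q"
      using cb(4) unfolding muh2_def by linarith
    then show ?thesis
      unfolding H0 L2 by (simp add: algebra_simps)
  qed
  finally have D2: "alpha q * (2 * lam2 q * \<sigma> + lam1 q * x - lam q - cb) = mu1 q * (?M * a - cb)" .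
  have pos: "?M * (1 - b) * (?M * a - cb * b) - (?M * b - ca * a) * (?M * a - cb) > 0" (is "?E > 0")
  proof -
    have expand: "?E = a * (?M\<^sup>2 - ca * cb) - 2 * ?M\<^sup>2 * (a * b) + ?M * cb * b\<^sup>2 + ?M * ca * a\<^sup>2"
      by (simp add: power2_eq_square algebra_simps)
    have gap: "?M\<^sup>2 - ca * cb > 0"
      using mult_strict_mono[OF ca(2) cb(2)] ca cb param_pos by (simp add: power2_eq_square)
    \<comment> \<open>Multiplied by \<open>mu\<close>, the expression splits into two products whose
      factors are positive by \<open>mu * b < ca * a\<close> and \<open>ca * cb < mu ^ 2\<close>,
      whatever the sign of \<open>b\<close>.\<close>
    have split: "?M * ?E = a * (?M\<^sup>2 - ca * cb) * (?M - ca * a) + (ca * a - ?M * b) * (2 * ?M\<^sup>2 * a - cb * (?M * b + ca * a))"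
      unfolding expand by (simp add: power2_eq_square algebra_simps)
    have "ca * a < ?M"
      using mult_strict_mono[OF ca(2) a(2)] ca a param_pos by simp
    then have "a * (?M\<^sup>2 - ca * cb) * (?M - ca * a) > 0"
      using gap a by simp
    moreover have "cb * (?M * b + ca * a) \<le> cb * (2 * (ca * a))"
      using b cb(1) by (intro mult_left_mono; linarith)
    then have "2 * ?M\<^sup>2 * a - cb * (?M * b + ca * a) \<ge> 2 * a * (?M\<^sup>2 - ca * cb)"
      by (simp add: algebra_simps)
    then have "2 * ?M\<^sup>2 * a - cb * (?M * b + ca * a) > 0"
      using gap a by (smt (verit) mult_pos_pos)
    then have "(ca * a - ?M * b) * (2 * ?M\<^sup>2 * a - cb * (?M * b + ca * a)) > 0"
      using b by simp
    ultimately have "?M * ?E > 0"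
      unfolding split by (rule add_pos_pos)
    then show ?thesis
      using param_pos by (simp add: zero_less_mult_iff)
  qed
  have "(alpha q)\<^sup>2 * (lam2 q * x * h2 q x \<sigma> - h1 q x \<sigma> * (2 * lam2 q * \<sigma> + lam1 q * x - lam q - cb))
     = x * (alpha q * lam2 q * (alpha q * h2 q x \<sigma>)) - (alpha q * h1 q x \<sigma>) * (alpha q * (2 * lam2 q * \<sigma> + lam1 q * x - lam q - cb))"
    by (simp add: power2_eq_square algebra_simps)
  also have "alpha q * lam2 q * (alpha q * h2 q x \<sigma>) = (alpha q * lam2 q * \<sigma>) * (mu1 q * (?M * a - cb * b))"
    unfolding H2 by (simp add: mult_ac)
  also have "x * ((alpha q * lam2 q * \<sigma>) * (mu1 q * (?M * a - cb * b))) - (alpha q * h1 q x \<sigma>) * (alpha q * (2 * lam2 q * \<sigma> + lam1 q * x - lam q - cb))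
     = x * mu1 q * mu2 q * ?E"
    unfolding L2 D2 H1 by (simp add: algebra_simps)
  finally have "(alpha q)\<^sup>2 * (lam2 q * x * h2 q x \<sigma> - h1 q x \<sigma> * (2 * lam2 q * \<sigma> + lam1 q * x - lam q - cb)) > 0"
    using pos x param_pos by simp
  then show "lam2 q * x * h2 q x \<sigma> - h1 q x \<sigma> * (2 * lam2 q * \<sigma> + lam1 q * x - lam q - cb) > 0"
    by (simp add: zero_less_mult_iff)
  have "lam2 q * x * h0 q x \<sigma> - h1 q x \<sigma> * lam2 q = lam2 q * x * (ca * a)"
  proof -
    have eq: "h1 q x \<sigma> = x * (h0 q x \<sigma> - ca * a)"
      using x h1_alt[of x \<sigma>] by (simp add: a_def)
    show ?thesis
      unfolding eq by (simp add: algebra_simps)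
  qed
  then show "lam2 q * x * h0 q x \<sigma> - h1 q x \<sigma> * lam2 q > 0"
    using param_pos x ca a by simp
qed

text \<open>At \<open>y = 1\<close> the kernel polynomial is
  \<open>(x - 1) * (lamh1 * x - muh1)\<close>, which is not positive here, so 1 lies between the two
  roots.\<close>

lemma Y0_le_one:
  assumes "1 < x" "x \<le> muh1 q / lamh1 q"
  shows "Y0 q x \<le> 1" "x < muh1 q / lamh1 q \<Longrightarrow> Y0 q x < 1"
proof -
  have x3: "x \<le> x_3 q"
    using assms branch_points(7) by linarith
  note b = branch_values[OF assms(1) x3]
  have "lamh2 q * x * ((1 - Y0 q x) * (1 - Y1 q x)) = lamh2 q * x * (1 - (Y0 q x + Y1 q x) + Y0 q x * Y1 q x)"
    by (simp add: algebra_simps)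
  also have "\<dots> = lamh2 q * x + bhat q x + muh2 q * x"
    unfolding b(6,7) using rate_pos assms by (simp add: field_simps)
  also have "\<dots> = (x - 1) * (lamh1 q * x - muh1 q)"
    by (simp add: bhat_def power2_eq_square algebra_simps)
  finally have eq: "lamh2 q * x * ((1 - Y0 q x) * (1 - Y1 q x)) = (x - 1) * (lamh1 q * x - muh1 q)" .
  have pos: "lamh2 q * x > 0"
    using rate_pos assms by simp
  have "lamh1 q * x \<le> muh1 q"
    using assms(2) rate_pos by (simp add: le_divide_eq mult.commute)
  then have "(x - 1) * (lamh1 q * x - muh1 q) \<le> 0"
    using assms by (intro mult_nonneg_nonpos) auto
  then have "(1 - Y0 q x) * (1 - Y1 q x) \<le> 0"
    unfolding eq[symmetric] using pos by (meson mult_pos_pos not_le)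
  then show "Y0 q x \<le> 1"
    using b(4) by (auto simp: mult_le_0_iff)
  assume "x < muh1 q / lamh1 q"
  then have "lamh1 q * x < muh1 q"
    using rate_pos by (simp add: less_divide_eq mult.commute)
  then have "(x - 1) * (lamh1 q * x - muh1 q) < 0"
    using assms by (intro mult_pos_neg) auto
  then have "(1 - Y0 q x) * (1 - Y1 q x) < 0"
    unfolding eq[symmetric] using pos by (meson less_imp_le mult_nonneg_nonneg not_le)
  then show "Y0 q x < 1"
    using b(4) by (auto simp: mult_less_0_iff)
qed

text \<open>\<open>h1\<close> increases with \<open>y\<close> and \<open>Y0 <= 1\<close>, while at
  \<open>y = 1\<close> it factors as \<open>(x - 1) * (lam1 * x - ca)\<close>. Zeros of
  \<open>h1\<close> along the branch are thereby confined to
  \<open>x > muh1 / lamh1\<close>.\<close>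

lemma h1_neg_low:
  assumes "1 < x" "x \<le> muh1 q / lamh1 q"
  shows "h1 q x (Y0 q x) < 0"
proof -
  have "h1 q x (Y0 q x) \<le> h1 q x 1"
    unfolding h1_def a1_def using Y0_le_one(1)[OF assms] assms param_pos by (intro add_right_mono mult_left_mono) auto
  also have "h1 q x 1 = (x - 1) * (lam1 q * x - ca)"
    unfolding h1_def a1_def b1_def ca_def[symmetric] by (simp add: lam_def power2_eq_square algebra_simps)
  also have "\<dots> < 0"
  proof -
    have "lamh1 q * x \<le> muh1 q"
      using assms(2) rate_pos by (simp add: le_divide_eq mult.commute)
    also have "\<dots> < alpha q * ca"
      using ca(1,4) param_pos by (smt (verit) mult_pos_pos)
    finally have "alpha q * (lam1 q * x) < alpha q * ca"
      by (simp add: lamh1_def mult.assoc)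
    then have "lam1 q * x < ca"
      using rate_pos by simp
    then show ?thesis
      using assms by (intro mult_pos_neg) auto
  qed
  finally show ?thesis .
qed

section \<open>Zeros of \<open>h1\<close> along the branch \<open>Y0\<close>\<close>

lemma g_factor:
  "x_minus q < 0" "0 < x_plus q" "g q x = lam q * lam1 q * (lam q + mu1 q) * (x - x_plus q) * (x - x_minus q)"
proof -
  define A where "A = lam q * lam1 q * (lam q + mu1 q)"
  define B where "B = lam q * mu1 q * (lam q + mu1 q - mu q)"
  define C where "C = mu q * (mu1 q)\<^sup>2"
  have A: "A > 0" and C: "C > 0"
    unfolding A_def C_def using rate_pos param_pos by auto
  define D where "D = sqrt (B\<^sup>2 + 4 * A * C)"
  have D: "D\<^sup>2 = B\<^sup>2 + 4 * A * C"
    unfolding D_def using A C by simp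
  have "D > \<bar>B\<bar>"
    unfolding D_def using A C by (intro real_less_rsqrt) simp
  define u where "u = (- B + D) / (2 * A)"
  define v where "v = (- B - D) / (2 * A)"
  have uv: "v < 0" "0 < u"
    unfolding u_def v_def using \<open>D > \<bar>B\<bar>\<close> A by (auto intro: divide_neg_pos)
  have "A * (u * v) = A * ((B\<^sup>2 - D\<^sup>2) / (4 * A\<^sup>2))"
    unfolding u_def v_def by (simp add: power2_eq_square algebra_simps)
  then have prod: "A * (u * v) = - C"
    unfolding D using A by (simp add: power2_eq_square)
  have sum: "A * (u + v) = - B"
    unfolding u_def v_def using A by (simp add: field_simps)
  have g: "g q x = A * (x - u) * (x - v)" for x
  proof -
    have "A * (x - u) * (x - v) = A * x\<^sup>2 - A * (u + v) * x + A * (u * v)"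
      by (simp add: power2_eq_square algebra_simps)
    also have "\<dots> = A * x\<^sup>2 + B * x - C"
      unfolding prod sum by simp
    finally show ?thesis
      by (simp add: g_def A_def B_def C_def)
  qed
  have "x_plus q = u" "x_minus q = v"
    unfolding x_plus_def x_minus_def g using A uv by (auto intro!: the_equality)
  then show "x_minus q < 0" "0 < x_plus q" "g q x = lam q * lam1 q * (lam q + mu1 q) * (x - x_plus q) * (x - x_minus q)"
    using uv g[of x] by (simp_all add: A_def)
qed

lemma h1_product:
  assumes "1 < x" "x \<le> x_3 q"
  shows "alpha q * (lam q + mu1 q)\<^sup>2 * (h1 q x (Y0 q x) * h1 q x (Y1 q x)) = muh2 q * (x - 1) * g q x"
proof -
  note b = branch_values[OF assms]
  have "alpha q * (h1 q x (Y0 q x) * h1 q x (Y1 q x))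
     = alpha q * (b1 q x)\<^sup>2 + b1 q x * (alpha q * lam2 q * x * (Y0 q x + Y1 q x)) + alpha q * lam2 q * (lam2 q * x\<^sup>2) * (Y0 q x * Y1 q x)"
    unfolding h1_def a1_def by (simp add: power2_eq_square algebra_simps)
  also have "alpha q * lam2 q * x * (Y0 q x + Y1 q x) = - bhat q x"
    unfolding b(6) lamh2_def using assms param_pos rate_pos by simp
  also have "alpha q * lam2 q * (lam2 q * x\<^sup>2) * (Y0 q x * Y1 q x) = lam2 q * mu q * mu2 q * x\<^sup>2"
    unfolding b(7) lamh2_def muh2_def using param_pos rate_pos by simp
  finally have E: "alpha q * (h1 q x (Y0 q x) * h1 q x (Y1 q x)) = alpha q * (b1 q x)\<^sup>2 - b1 q x * bhat q x + lam2 q * mu q * mu2 q * x\<^sup>2"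
    by simp
  have "alpha q * (lam q + mu1 q)\<^sup>2 * (h1 q x (Y0 q x) * h1 q x (Y1 q x))
     = (lam q + mu1 q)\<^sup>2 * (alpha q * (h1 q x (Y0 q x) * h1 q x (Y1 q x)))"
    by (simp add: mult_ac)
  also have "\<dots>
     = (lam q + mu1 q)\<^sup>2 * (alpha q * (b1 q x)\<^sup>2 - b1 q x * bhat q x + lam2 q * mu q * mu2 q * x\<^sup>2)"
    unfolding E ..
  also have "\<dots> = muh2 q * (x - 1) * g q x"
  proof -
    have eqs: "alpha q = lam1 q + lam2 q + mu1 q + mu2 q" "lam q = lam1 q + lam2 q"
      "b1 q x = lam1 q * x\<^sup>2 - (lam q + ca) * x + ca"
      "bhat q x = alpha q * lam1 q * x\<^sup>2 - (alpha q * lam1 q + alpha q * lam2 q + mu q * mu1 q + mu q * mu2 q) * x + mu q * mu1 q"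
      "g q x = lam q * lam1 q * (lam q + mu1 q) * x\<^sup>2 + lam q * mu1 q * (lam q + mu1 q - mu q) * x - mu q * (mu1 q)\<^sup>2"
      by (simp_all add: alpha_def lam_def b1_def ca_def bhat_def lamh1_def lamh2_def muh1_def muh2_def g_def)
    have "ca * (lam1 q + lam2 q + mu1 q) = mu q * mu1 q"
      using ca(3) by (simp add: lam_def muh1_def)
    then show ?thesis
      unfolding eqs(3-5) unfolding eqs(1,2) muh2_def by (rule boundary_product_identity)
  qed
  finally show ?thesis .
qed

text \<open>By \<open>h1_product\<close> every such zero is a zero of \<open>g\<close>, and
  \<open>g\<close> has only one positive zero.\<close>

lemma h1_zero_unique:
  assumes "1 < x" "x \<le> x_3 q" "h1 q x (Y0 q x) = 0"
  shows "x = x_plus q"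
proof -
  have "muh2 q * (x - 1) * g q x = 0"
    using h1_product[OF assms(1,2)] assms(3) by simp
  then have "g q x = 0"
    using assms(1) rate_pos by simp
  then show ?thesis
    unfolding g_factor(3) using assms(1) g_factor(1) rate_pos param_pos by auto
qed

text \<open>The lower bound, which comes from \<open>h1_neg_low\<close>, places
  \<open>x_plus\<close> beyond \<open>s0\<close>, where the complex branches are defined.\<close>

lemma x_star_finite:
  assumes "x_star q = ereal (x_plus q)"
  shows "muh1 q / lamh1 q < x_plus q" "x_plus q \<le> x_3 q" "h1 q (x_plus q) (Y0 q (x_plus q)) = 0"
proof -
  have "\<exists>x. 1 < x \<and> x \<le> x_3 q \<and> h1 q x (Y0 q x) = 0"
    using assms by (auto simp: x_star_def split: if_splits)
  then obtain x where x: "1 < x" "x \<le> x_3 q" "h1 q x (Y0 q x) = 0"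
    by blast
  with h1_zero_unique[OF x] have *: "1 < x_plus q" "x_plus q \<le> x_3 q" "h1 q (x_plus q) (Y0 q (x_plus q)) = 0"
    by auto
  then show "x_plus q \<le> x_3 q" "h1 q (x_plus q) (Y0 q (x_plus q)) = 0"
    by auto
  show "muh1 q / lamh1 q < x_plus q"
    using h1_neg_low[of "x_plus q"] * by (cases "x_plus q \<le> muh1 q / lamh1 q") auto
qed

text \<open>Along \<open>Y0\<close>, \<open>h1\<close> is negative at \<open>muh1 / lamh1\<close>
  and continuous up to \<open>x_3\<close>; without a zero it cannot change sign. Continuity is read
  off \<open>Y_minus\<close>, since \<open>Y0\<close> is defined by cases.\<close>

lemma x_star_infinite:
  assumes "x_star q = \<infinity>"
  shows "h1 q (x_3 q) (Y0 q (x_3 q)) < 0"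
proof (rule ccontr)
  assume neg: "\<not> h1 q (x_3 q) (Y0 q (x_3 q)) < 0"
  have none: "\<not> (1 < x \<and> x \<le> x_3 q \<and> h1 q x (Y0 q x) = 0)" for x
    using assms by (auto simp: x_star_def split: if_splits)
  define r where "r = muh1 q / lamh1 q"
  have r: "1 < r" "r \<le> x_3 q"
    using s0 branch_points(7) by (auto simp: r_def)
  have "continuous_on {r..x_3 q} (\<lambda>x. h1 q x (Y_minus q x))"
    unfolding h1_def a1_def b1_def Y_minus_def Delta_def b_plus_def b_minus_def bhat_def
    using r rate_pos by (intro continuous_intros) auto
  then have "continuous_on {r..x_3 q} (\<lambda>x. h1 q x (Y0 q x))"
    by (rule continuous_on_eq) (use r branch_values(1) in auto)
  moreover have "h1 q r (Y0 q r) \<le> 0"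
    using h1_neg_low[of r] r by (simp add: r_def)
  ultimately have "\<exists>x. r \<le> x \<and> x \<le> x_3 q \<and> h1 q x (Y0 q x) = 0"
    using neg r by (intro IVT') auto
  then show False
    using none r by force
qed

section \<open>The branches of the kernel in the complex plane\<close>

definition bhat_c :: "complex \<Rightarrow> complex" where
  "bhat_c x = of_real (lamh1 q) * x\<^sup>2 - of_real (lamh1 q + lamh2 q + muh1 q + muh2 q) * x + of_real (muh1 q)"

definition h1_c :: "complex \<Rightarrow> complex \<Rightarrow> complex" where
  "h1_c x y = of_real (lam2 q) * x * y + (of_real (lam1 q) * x\<^sup>2 - of_real (lam q + ca) * x + of_real ca)"

definition h2_c :: "complex \<Rightarrow> complex \<Rightarrow> complex" where
  "h2_c x y = of_real (lam2 q) * y\<^sup>2 + (of_real (lam1 q) * x - of_real (lam q + cb)) * y + of_real cb"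

definition h0_c :: "complex \<Rightarrow> complex \<Rightarrow> complex" where
  "h0_c x y = of_real (lam1 q) * x + of_real (lam2 q) * y - of_real (lam q)"

lemma of_real_boundary:
  "bhat_c (of_real x) = of_real (bhat q x)"
  "h1_c (of_real x) (of_real y) = of_real (h1 q x y)"
  "h2_c (of_real x) (of_real y) = of_real (h2 q x y)"
  "h0_c (of_real x) (of_real y) = of_real (h0 q x y)"
  by (simp_all add: bhat_c_def bhat_def h1_c_def h1_def a1_def b1_def ca_def h2_c_def h2_def cb_def h0_c_def h0_def algebra_simps)

definition cofactor :: "complex \<Rightarrow> complex" where
  "cofactor x = of_real (lamh1 q) * x * csqrt (1 - of_real (x_1 q) / x) * csqrt (1 - of_real (x_2 q) / x) * csqrt (of_real (x_4 q) - x)"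

text \<open>The square root of the discriminant, cut along the ray from \<open>x_3\<close>; the two inner branch points lie inside
  the circle of radius \<open>s0\<close>.\<close>

definition disc_root :: "complex \<Rightarrow> complex" where
  "disc_root x = cofactor x * csqrt (of_real (x_3 q) - x)"

definition Y0_c :: "complex \<Rightarrow> complex" where
  "Y0_c x = (- bhat_c x - disc_root x) / (2 * of_real (lamh2 q) * x)"

definition Y1_c :: "complex \<Rightarrow> complex" where
  "Y1_c x = (- bhat_c x + disc_root x) / (2 * of_real (lamh2 q) * x)"

definition slit_dom :: "complex set" where
  "slit_dom = {x. s0 < norm x \<and> of_real (x_3 q) - x \<notin> \<real>\<^sub>\<le>\<^sub>0}"

lemma s0_pos: "0 < s0"
  using s0 by linarith

lemma inner_sqrt_arg:
  fixes x :: complex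
  assumes "s0 < norm x" "0 \<le> r" "r < s0"
  shows "1 - of_real r / x \<notin> \<real>\<^sub>\<le>\<^sub>0"
proof -
  have "norm (of_real r / x) < 1"
    using assms less_trans[OF s0_pos assms(1)] by (simp add: norm_divide del: zero_less_norm_iff)
  then have "Re (1 - of_real r / x) > 0"
    using complex_Re_le_cmod[of "of_real r / x"] by simp
  then show ?thesis
    by (auto simp: complex_nonpos_Reals_iff)
qed

lemma disc_root_sq:
  assumes "x \<noteq> 0"
  shows "(disc_root x)\<^sup>2 = (bhat_c x)\<^sup>2 - 4 * x\<^sup>2 * of_real (lamh2 q * muh2 q)"
proof -
  define d where "d = sqrt (lamh2 q * muh2 q)"
  have d2: "lamh2 q * muh2 q = d\<^sup>2"
    unfolding d_def using rate_pos by simp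
  have plus: "bhat q t + 2 * t * d = lamh1 q * (t - x_2 q) * (t - x_3 q)" for t
    using branch_points(8)[of t] by (simp add: b_plus_def d_def)
  have minus: "bhat q t - 2 * t * d = lamh1 q * (t - x_1 q) * (t - x_4 q)" for t
    using branch_points(9)[of t] by (simp add: b_minus_def d_def)
  let ?S = "lamh1 q + lamh2 q + muh1 q + muh2 q"
  \<comment> \<open>The values at 0 and 1 identify the coefficients, which carries the real
    factorization over to complex arguments.\<close>
  have p0: "muh1 q = lamh1 q * (x_2 q * x_3 q)" and p1: "?S - 2 * d = lamh1 q * (x_2 q + x_3 q)"
    using plus[of 0] plus[of 1] by (simp_all add: bhat_def algebra_simps)
  have m0: "muh1 q = lamh1 q * (x_1 q * x_4 q)" and m1: "?S + 2 * d = lamh1 q * (x_1 q + x_4 q)"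
    using minus[of 0] minus[of 1] by (simp_all add: bhat_def algebra_simps)
  have "bhat_c x + 2 * x * of_real d = of_real (lamh1 q) * x\<^sup>2 - of_real (?S - 2 * d) * x + of_real (muh1 q)"
    by (simp add: bhat_c_def algebra_simps)
  also have "\<dots> = of_real (lamh1 q) * (x - of_real (x_2 q)) * (x - of_real (x_3 q))"
    unfolding p1 unfolding p0 by (simp add: power2_eq_square algebra_simps)
  finally have plus_c: "bhat_c x + 2 * x * of_real d = of_real (lamh1 q) * (x - of_real (x_2 q)) * (x - of_real (x_3 q))" .
  have "bhat_c x - 2 * x * of_real d = of_real (lamh1 q) * x\<^sup>2 - of_real (?S + 2 * d) * x + of_real (muh1 q)"
    by (simp add: bhat_c_def algebra_simps)
  also have "\<dots> = of_real (lamh1 q) * (x - of_real (x_1 q)) * (x - of_real (x_4 q))"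
    unfolding m1 unfolding m0 by (simp add: power2_eq_square algebra_simps)
  finally have minus_c: "bhat_c x - 2 * x * of_real d = of_real (lamh1 q) * (x - of_real (x_1 q)) * (x - of_real (x_4 q))" .
  have "(disc_root x)\<^sup>2 = (of_real (lamh1 q))\<^sup>2 * (x\<^sup>2 * (1 - of_real (x_1 q) / x) * (1 - of_real (x_2 q) / x))
      * (of_real (x_4 q) - x) * (of_real (x_3 q) - x)"
    unfolding disc_root_def cofactor_def power_mult_distrib by simp
  also have "x\<^sup>2 * (1 - of_real (x_1 q) / x) * (1 - of_real (x_2 q) / x) = (x - of_real (x_1 q)) * (x - of_real (x_2 q))"
    using assms by (simp add: power2_eq_square field_simps)
  also have "(of_real (lamh1 q))\<^sup>2 * ((x - of_real (x_1 q)) * (x - of_real (x_2 q))) * (of_real (x_4 q) - x) * (of_real (x_3 q) - x)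
      = (bhat_c x + 2 * x * of_real d) * (bhat_c x - 2 * x * of_real d)"
    unfolding plus_c minus_c by (simp add: power2_eq_square algebra_simps)
  also have "\<dots> = (bhat_c x)\<^sup>2 - 4 * x\<^sup>2 * of_real (lamh2 q * muh2 q)"
    unfolding d2 by (simp add: power2_eq_square algebra_simps)
  finally show ?thesis .
qed

lemma Y_c_sum_prod:
  assumes "x \<noteq> 0"
  shows "of_real (lamh2 q) * x * (Y0_c x + Y1_c x) = - bhat_c x" "Y0_c x * Y1_c x = of_real (muh2 q / lamh2 q)"
proof -
  have L: "complex_of_real (lamh2 q) \<noteq> 0"
    using rate_pos by simp
  have "Y0_c x + Y1_c x = - bhat_c x / (of_real (lamh2 q) * x)"
    unfolding Y0_c_def Y1_c_def add_divide_distrib[symmetric] by simp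
  then show "of_real (lamh2 q) * x * (Y0_c x + Y1_c x) = - bhat_c x"
    using L assms by simp
  have "Y0_c x * Y1_c x = ((bhat_c x)\<^sup>2 - (disc_root x)\<^sup>2) / (2 * of_real (lamh2 q) * x)\<^sup>2"
    unfolding Y0_c_def Y1_c_def times_divide_times_eq by (simp add: power2_eq_square algebra_simps)
  also have "\<dots> = (4 * x\<^sup>2 * of_real (lamh2 q * muh2 q)) / (2 * of_real (lamh2 q) * x)\<^sup>2"
    unfolding disc_root_sq[OF assms] by simp
  also have "\<dots> = of_real (muh2 q / lamh2 q)"
    using L assms by (simp add: power2_eq_square)
  finally show "Y0_c x * Y1_c x = of_real (muh2 q / lamh2 q)" .
qed

lemma Y0_c_nonzero: "x \<noteq> 0 \<Longrightarrow> Y0_c x \<noteq> 0"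
  using Y_c_sum_prod(2)[of x] rate_pos by auto

text \<open>The kernel with separated variables. Up to a constant both sides are of Joukowski type
  \<open>A * z + B / z\<close>, so \<open>norm (Y0_c x)\<close> can be controlled by comparing real
  parts.\<close>

lemma Y0_c_kernel:
  assumes "x \<noteq> 0"
  shows "of_real (lamh2 q) * Y0_c x + of_real (muh2 q) / Y0_c x
     = of_real (lamh1 q + lamh2 q + muh1 q + muh2 q) - (of_real (lamh1 q) * x + of_real (muh1 q) / x)"
proof -
  have L: "complex_of_real (lamh2 q) \<noteq> 0"
    using rate_pos by simp
  have "of_real (muh2 q) = of_real (lamh2 q) * (Y0_c x * Y1_c x)"
    unfolding Y_c_sum_prod(2)[OF assms] using L by simp
  then have "of_real (muh2 q) / Y0_c x = of_real (lamh2 q) * Y1_c x"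
    using Y0_c_nonzero[OF assms] by simp
  then have "of_real (lamh2 q) * Y0_c x + of_real (muh2 q) / Y0_c x = (of_real (lamh2 q) * x * (Y0_c x + Y1_c x)) / x"
    using assms by (simp add: field_simps)
  also have "\<dots> = of_real (lamh1 q + lamh2 q + muh1 q + muh2 q) - (of_real (lamh1 q) * x + of_real (muh1 q) / x)"
    unfolding Y_c_sum_prod(1)[OF assms] bhat_c_def using assms by (simp add: field_simps power2_eq_square)
  finally show ?thesis .
qed

lemma Y_c_of_real:
  assumes "s0 < x" "x \<le> x_3 q"
  shows "Y0_c (of_real x) = of_real (Y0 q x)" "Y1_c (of_real x) = of_real (Y1 q x)"
proof -
  have x: "1 < x" "0 < x"
    using assms s0 by linarith+
  note bp = branch_points(1-7)
  have nn: "0 \<le> 1 - x_1 q / x" "0 \<le> 1 - x_2 q / x" "0 \<le> x_4 q - x" "0 \<le> x_3 q - x"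
    using assms bp x by auto
  have c: "csqrt (1 - of_real r / of_real x) = of_real (sqrt (1 - r / x))" if "0 \<le> 1 - r / x" for r
  proof -
    have "1 - of_real r / of_real x = complex_of_real (1 - r / x)"
      by simp
    then show ?thesis
      using that by (simp only: csqrt_of_real_nonneg Im_complex_of_real Re_complex_of_real)
  qed
  have c': "csqrt (of_real r - of_real x) = of_real (sqrt (r - x))" if "0 \<le> r - x" for r
  proof -
    have "of_real r - of_real x = complex_of_real (r - x)"
      by simp
    then show ?thesis
      using that by (simp only: csqrt_of_real_nonneg Im_complex_of_real Re_complex_of_real)
  qed
  have "Delta q x = (lamh1 q)\<^sup>2 * (x\<^sup>2 * (1 - x_1 q / x) * (1 - x_2 q / x)) * (x_4 q - x) * (x_3 q - x)"
  proof -
    have eq: "x\<^sup>2 * (1 - x_1 q / x) * (1 - x_2 q / x) = (x - x_1 q) * (x - x_2 q)"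
      using x by (simp add: power2_eq_square field_simps)
    show ?thesis
      unfolding Delta_factor eq by (simp add: algebra_simps)
  qed
  then have "sqrt (Delta q x) = lamh1 q * x * sqrt (1 - x_1 q / x) * sqrt (1 - x_2 q / x) * sqrt (x_4 q - x) * sqrt (x_3 q - x)"
    using rate_pos x by (simp add: real_sqrt_mult)
  then have d: "disc_root (of_real x) = of_real (sqrt (Delta q x))"
    unfolding disc_root_def cofactor_def using nn by (simp add: c c')
  show "Y0_c (of_real x) = of_real (Y0 q x)" "Y1_c (of_real x) = of_real (Y1 q x)"
    unfolding Y0_c_def Y1_c_def d of_real_boundary branch_values(1,2)[OF x(1) assms(2)] Y_minus_def Y_plus_def
    by simp_all
qed

lemma cofactor_holomorphic: "cofactor holomorphic_on {x. s0 < norm x \<and> of_real (x_4 q) - x \<notin> \<real>\<^sub>\<le>\<^sub>0}"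
  unfolding cofactor_def
  using inner_sqrt_arg[of _ "x_1 q"] inner_sqrt_arg[of _ "x_2 q"] branch_points(1-3) s0_pos
  by (intro holomorphic_intros holomorphic_on_csqrt') auto

lemma slit_dom_x4: "x \<in> slit_dom \<Longrightarrow> of_real (x_4 q) - x \<notin> \<real>\<^sub>\<le>\<^sub>0"
  using branch_points(5) by (auto simp: slit_dom_def complex_nonpos_Reals_iff)

lemma open_slit_dom: "open slit_dom"
proof -
  have "slit_dom = {x. s0 < norm x} \<inter> (\<lambda>x. of_real (x_3 q) - x) -` (- \<real>\<^sub>\<le>\<^sub>0)"
    by (auto simp: slit_dom_def)
  moreover have "open {x::complex. s0 < norm x}"
    by (intro open_Collect_less continuous_intros)
  moreover have "open ((\<lambda>x. of_real (x_3 q) - x) -` (- \<real>\<^sub>\<le>\<^sub>0) :: complex set)"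
    by (intro open_vimage continuous_intros) (auto simp: open_Compl)
  ultimately show ?thesis
    by auto
qed

lemma slit_dom_nonzero: "x \<in> slit_dom \<Longrightarrow> x \<noteq> 0"
  using s0_pos by (auto simp: slit_dom_def)

lemma disc_root_holomorphic: "disc_root holomorphic_on slit_dom"
  unfolding disc_root_def
proof (intro holomorphic_intros holomorphic_on_csqrt')
  show "cofactor holomorphic_on slit_dom"
    by (rule holomorphic_on_subset[OF cofactor_holomorphic]) (use slit_dom_x4 in \<open>auto simp: slit_dom_def\<close>)
qed (auto simp: slit_dom_def)

lemma Y_c_holomorphic: "Y0_c holomorphic_on slit_dom" "Y1_c holomorphic_on slit_dom"
  unfolding Y0_c_def Y1_c_def bhat_c_def using rate_pos slit_dom_nonzero
  by (auto intro!: holomorphic_intros disc_root_holomorphic)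

text \<open>The real part equals \<open>(A + B / (norm x) ^ 2) * Re x\<close>, hence on each circle
  it is largest exactly at the positive real point.\<close>

lemma Re_joukowski:
  assumes "x \<noteq> 0" "0 < A" "0 < B"
  shows "Re (of_real A * x + of_real B / x) \<le> A * norm x + B / norm x"
    "x \<noteq> of_real (norm x) \<Longrightarrow> Re (of_real A * x + of_real B / x) < A * norm x + B / norm x"
proof -
  have eq: "Re (of_real A * x + of_real B / x) = (A + B / (norm x)\<^sup>2) * Re x"
    using assms(1) by (simp add: Re_divide cmod_power2 algebra_simps)
  have eq': "A * norm x + B / norm x = (A + B / (norm x)\<^sup>2) * norm x"
    using assms(1) by (simp add: power2_eq_square field_simps)
  have pos: "A + B / (norm x)\<^sup>2 > 0"
    using assms by (simp add: add_pos_pos)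
  show "Re (of_real A * x + of_real B / x) \<le> A * norm x + B / norm x"
    unfolding eq eq' using pos complex_Re_le_cmod[of x] by (intro mult_left_mono) auto
  assume ne: "x \<noteq> of_real (norm x)"
  have "Re x \<noteq> norm x"
  proof
    assume r: "Re x = norm x"
    then have "(Im x)\<^sup>2 = 0"
      using cmod_power2[of x] by simp
    then show False
      using ne r by (simp add: complex_eq_iff)
  qed
  then have "Re x < norm x"
    using complex_Re_le_cmod[of x] by simp
  then show "Re (of_real A * x + of_real B / x) < A * norm x + B / norm x"
    unfolding eq eq' using pos by (intro mult_strict_left_mono)
qed

lemma slit_dom_ne_norm:
  assumes "x \<in> slit_dom" "norm x = x_3 q"
  shows "x \<noteq> of_real (norm x)"
  using assms by (auto simp: slit_dom_def)

lemma kernel_at_radius: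
  assumes "s0 < r" "r \<le> x_3 q"
  shows "lamh2 q * Y0 q r + muh2 q / Y0 q r = lamh1 q + lamh2 q + muh1 q + muh2 q - (lamh1 q * r + muh1 q / r)"
proof -
  have "complex_of_real r \<noteq> 0"
    using assms s0_pos by simp
  from Y0_c_kernel[OF this] have "complex_of_real (lamh2 q * Y0 q r + muh2 q / Y0 q r)
     = complex_of_real (lamh1 q + lamh2 q + muh1 q + muh2 q - (lamh1 q * r + muh1 q / r))"
    unfolding Y_c_of_real(1)[OF assms] by simp
  then show ?thesis
    by (simp only: of_real_eq_iff)
qed

text \<open>If \<open>norm y = \<sigma>\<close>, the real part of
  \<open>lamh2 * y + muh2 / y\<close> is at most its value at \<open>\<sigma>\<close>, the minimum
  over positive reals; the separated kernel makes it at least the value at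
  \<open>Y0 (norm x)\<close>. Both can hold only for \<open>norm x = x_3\<close>, and there the
  second comparison is strict because the slit removes the positive real point.\<close>

lemma norm_Y0_c_ne_\<sigma>:
  assumes "x \<in> slit_dom" "norm x \<le> x_3 q"
  shows "norm (Y0_c x) \<noteq> \<sigma>"
proof
  assume eq: "norm (Y0_c x) = \<sigma>"
  define r where "r = norm x"
  have r: "s0 < r" "r \<le> x_3 q"
    using assms by (auto simp: slit_dom_def r_def)
  have r1: "1 < r"
    using r s0 by linarith
  have x0: "x \<noteq> 0"
    using slit_dom_nonzero assms by blast
  have "lamh1 q + lamh2 q + muh1 q + muh2 q - (lamh1 q * r + muh1 q / r)
      \<le> Re (of_real (lamh1 q + lamh2 q + muh1 q + muh2 q) - (of_real (lamh1 q) * x + of_real (muh1 q) / x))"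
    using Re_joukowski(1)[OF x0, of "lamh1 q" "muh1 q"] rate_pos by (simp add: r_def)
  also have "\<dots> = Re (of_real (lamh2 q) * Y0_c x + of_real (muh2 q) / Y0_c x)"
    unfolding Y0_c_kernel[OF x0] ..
  also have "\<dots> \<le> lamh2 q * \<sigma> + muh2 q / \<sigma>"
    using Re_joukowski(1)[OF Y0_c_nonzero[OF x0], of "lamh2 q" "muh2 q"] rate_pos by (simp add: eq)
  finally have le: "lamh2 q * Y0 q r + muh2 q / Y0 q r \<le> lamh2 q * \<sigma> + muh2 q / \<sigma>"
    unfolding kernel_at_radius[OF r] .
  have Yr: "0 < Y0 q r" "Y0 q r \<le> \<sigma>" "r < x_3 q \<Longrightarrow> Y0 q r < \<sigma>"
    using branch_values[OF r1 r(2)] Y0_le_\<sigma>[OF r1 r(2)] by auto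
  have m: "muh2 q = lamh2 q * \<sigma> * \<sigma>"
    using \<sigma>(2) rate_pos by (simp add: power2_eq_square field_simps)
  have "lamh2 q * (\<sigma> - Y0 q r)\<^sup>2 / Y0 q r = (lamh2 q * Y0 q r + muh2 q / Y0 q r) - (lamh2 q * \<sigma> + muh2 q / \<sigma>)"
    unfolding m using Yr \<sigma>(1) by (simp add: power2_eq_square field_simps)
  with le have "lamh2 q * (\<sigma> - Y0 q r)\<^sup>2 / Y0 q r \<le> 0"
    by simp
  then have "(\<sigma> - Y0 q r)\<^sup>2 \<le> 0"
    using Yr rate_pos by (simp add: divide_le_0_iff mult_le_0_iff)
  then have "Y0 q r = \<sigma>"
    by simp
  with Yr r have "r = x_3 q"
    by force
  then have "Re (of_real (lamh1 q) * x + of_real (muh1 q) / x) < lamh1 q * r + muh1 q / r"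
    using Re_joukowski(2)[OF x0, of "lamh1 q" "muh1 q"] rate_pos slit_dom_ne_norm[OF assms(1)] by (simp add: r_def)
  then have "lamh2 q * Y0 q r + muh2 q / Y0 q r < Re (of_real (lamh2 q) * Y0_c x + of_real (muh2 q) / Y0_c x)"
    unfolding kernel_at_radius[OF r] Y0_c_kernel[OF x0] by simp
  also have "\<dots> \<le> lamh2 q * \<sigma> + muh2 q / \<sigma>"
    using Re_joukowski(1)[OF Y0_c_nonzero[OF x0], of "lamh2 q" "muh2 q"] rate_pos by (simp add: eq)
  finally show False
    using \<open>Y0 q r = \<sigma>\<close> by simp
qed

lemma annulus_slit_dom:
  assumes "s0 < norm x" "norm x < x_3 q"
  shows "x \<in> slit_dom"
proof -
  have "Re (of_real (x_3 q) - x) > 0"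
    using assms complex_Re_le_cmod[of x] by simp
  then show ?thesis
    using assms by (auto simp: slit_dom_def complex_nonpos_Reals_iff)
qed

text \<open>The annulus is connected, the modulus never equals \<open>\<sigma>\<close> on it, and it
  is below \<open>\<sigma>\<close> at a real point.\<close>

lemma norm_Y0_c_less:
  assumes "s0 < norm x" "norm x < x_3 q"
  shows "norm (Y0_c x) < \<sigma>"
proof (rule ccontr)
  assume neg: "\<not> norm (Y0_c x) < \<sigma>"
  define A where "A = {x::complex. s0 < norm (x - 0) \<and> norm (x - 0) < x_3 q}"
  have sub: "A \<subseteq> slit_dom"
    using annulus_slit_dom by (auto simp: A_def)
  have "connected A"
    unfolding A_def by (rule connected_annulus) simp
  moreover have "continuous_on A (\<lambda>x. norm (Y0_c x))"
    using holomorphic_on_imp_continuous_on[OF holomorphic_on_subset[OF Y_c_holomorphic(1) sub]] by (intro continuous_intros)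
  ultimately have conn: "connected ((\<lambda>x. norm (Y0_c x)) ` A)"
    by (intro connected_continuous_image)
  define t where "t = (s0 + x_3 q) / 2"
  have t: "s0 < t" "t < x_3 q"
    using branch_points(4) by (auto simp: t_def)
  have "of_real t \<in> A"
    using t s0_pos by (auto simp: A_def)
  moreover have "norm (Y0_c (of_real t)) < \<sigma>"
  proof -
    have "1 < t"
      using t s0 by linarith
    then show ?thesis
      using Y_c_of_real(1)[of t] Y0_le_\<sigma>(2)[of t] branch_values(3)[of t] t by simp
  qed
  moreover have "x \<in> A"
    using assms by (simp add: A_def)
  ultimately have "\<sigma> \<in> (\<lambda>x. norm (Y0_c x)) ` A"
    using neg conn by (meson connectedD_interval imageI less_imp_le not_le)
  then show False
    using norm_Y0_c_ne_\<sigma> sub by (force simp: A_def)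
qed

text \<open>On the outer circle, approached radially from the annulus, only the weak inequality
  survives the limit; \<open>norm_Y0_c_ne_\<sigma>\<close> restores strictness.\<close>

lemma norm_Y0_c_le:
  assumes "x \<in> slit_dom" "norm x \<le> x_3 q"
  shows "norm (Y0_c x) < \<sigma>"
proof (cases "norm x < x_3 q")
  case True
  then show ?thesis
    using norm_Y0_c_less assms(1) by (simp add: slit_dom_def)
next
  case False
  then have nx: "norm x = x_3 q"
    using assms by simp
  have "isCont Y0_c x"
    using holomorphic_on_imp_continuous_on[OF Y_c_holomorphic(1)] open_slit_dom assms(1) by (simp add: continuous_on_eq_continuous_at)
  moreover have "((\<lambda>t. of_real t * x) \<longlongrightarrow> of_real 1 * x) (at_left (1::real))"
    by (intro tendsto_intros)
  ultimately have "((\<lambda>t. Y0_c (of_real t * x)) \<longlongrightarrow> Y0_c x) (at_left (1::real))"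
    using isCont_tendsto_compose[of x Y0_c] by simp
  then have "((\<lambda>t. norm (Y0_c (of_real t * x))) \<longlongrightarrow> norm (Y0_c x)) (at_left (1::real))"
    by (rule tendsto_norm)
  moreover have "\<forall>\<^sub>F t in at_left (1::real). norm (Y0_c (of_real t * x)) \<le> \<sigma>"
  proof -
    have lt: "s0 / x_3 q < 1"
      using branch_points(4) s0_pos by simp
    have "norm (Y0_c (of_real t * x)) \<le> \<sigma>" if "t \<in> {s0 / x_3 q<..<1}" for t
    proof -
      have "0 < t"
        using that s0_pos branch_points(4) by (auto intro: less_trans[of 0 "s0 / x_3 q"])
      then have "norm (of_real t * x) = t * x_3 q"
        using nx by (simp add: norm_mult)
      moreover have "s0 < t * x_3 q" "t * x_3 q < x_3 q"
        using that s0_pos branch_points(4) by (auto simp: field_simps)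
      ultimately show ?thesis
        using norm_Y0_c_less[of "of_real t * x"] by simp
    qed
    with eventually_at_left_real[OF lt] show ?thesis
      by (auto elim: eventually_mono)
  qed
  ultimately have "norm (Y0_c x) \<le> \<sigma>"
    by (intro tendsto_upperbound) auto
  with norm_Y0_c_ne_\<sigma>[OF assms] show ?thesis
    by simp
qed

text \<open>\<open>lamh2 * \<rho> + muh2 / \<rho>\<close> strictly decreases in
  \<open>\<rho>\<close> below \<open>\<sigma>\<close>, so a modulus larger than at the real point
  would contradict the comparison of real parts. This controls the \<open>y\<close>-term in
  \<open>h1_c_nonzero\<close>.\<close>

lemma norm_Y0_c_le_real:
  assumes "x \<in> slit_dom" "norm x \<le> x_3 q"
  shows "norm (Y0_c x) \<le> Y0 q (norm x)"
proof (rule ccontr)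
  assume neg: "\<not> norm (Y0_c x) \<le> Y0 q (norm x)"
  define r where "r = norm x"
  define \<rho> where "\<rho> = norm (Y0_c x)"
  have r: "s0 < r" "r \<le> x_3 q"
    using assms by (auto simp: slit_dom_def r_def)
  have r1: "1 < r"
    using r s0 by linarith
  have x0: "x \<noteq> 0"
    using slit_dom_nonzero assms by blast
  have \<rho>: "\<rho> < \<sigma>" "Y0 q r < \<rho>" "0 < Y0 q r"
    using norm_Y0_c_le[OF assms] neg branch_values(3)[OF r1 r(2)] by (auto simp: \<rho>_def r_def)
  have "lamh2 q * Y0 q r + muh2 q / Y0 q r
      \<le> Re (of_real (lamh1 q + lamh2 q + muh1 q + muh2 q) - (of_real (lamh1 q) * x + of_real (muh1 q) / x))"
    unfolding kernel_at_radius[OF r] using Re_joukowski(1)[OF x0, of "lamh1 q" "muh1 q"] rate_pos by (simp add: r_def)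
  also have "\<dots> = Re (of_real (lamh2 q) * Y0_c x + of_real (muh2 q) / Y0_c x)"
    unfolding Y0_c_kernel[OF x0] ..
  also have "\<dots> \<le> lamh2 q * \<rho> + muh2 q / \<rho>"
    using Re_joukowski(1)[OF Y0_c_nonzero[OF x0], of "lamh2 q" "muh2 q"] rate_pos by (simp add: \<rho>_def)
  finally have le: "lamh2 q * Y0 q r + muh2 q / Y0 q r \<le> lamh2 q * \<rho> + muh2 q / \<rho>" .
  have m: "muh2 q = lamh2 q * \<sigma>\<^sup>2"
    using \<sigma>(2) rate_pos by (simp add: field_simps)
  have "lamh2 q * ((\<rho> - Y0 q r) * (\<sigma>\<^sup>2 - \<rho> * Y0 q r) / (\<rho> * Y0 q r))
     = (lamh2 q * Y0 q r + muh2 q / Y0 q r) - (lamh2 q * \<rho> + muh2 q / \<rho>)"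
    unfolding m using \<rho> by (simp add: field_simps power2_eq_square)
  with le have "lamh2 q * ((\<rho> - Y0 q r) * (\<sigma>\<^sup>2 - \<rho> * Y0 q r) / (\<rho> * Y0 q r)) \<le> 0"
    by simp
  moreover have "\<rho> * Y0 q r < \<sigma>\<^sup>2"
    unfolding power2_eq_square using \<rho> by (intro mult_strict_mono) auto
  then have "lamh2 q * ((\<rho> - Y0 q r) * (\<sigma>\<^sup>2 - \<rho> * Y0 q r) / (\<rho> * Y0 q r)) > 0"
    using \<rho> rate_pos by (intro mult_pos_pos divide_pos_pos) auto
  ultimately show False
    by simp
qed

lemma h1_c_nonzero:
  assumes x: "x \<in> slit_dom" "norm x \<le> x_3 q" "x \<noteq> of_real (norm x)" and le: "h1 q (norm x) (Y0 q (norm x)) \<le> 0"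
  shows "h1_c x (Y0_c x) \<noteq> 0"
proof
  assume zero: "h1_c x (Y0_c x) = 0"
  define r where "r = norm x"
  have x0: "x \<noteq> 0"
    using slit_dom_nonzero x by blast
  then have r: "r > 0"
    by (simp add: r_def)
  have "h1_c x (Y0_c x) = x * (of_real (lam2 q) * Y0_c x + (of_real (lam1 q) * x + of_real ca / x) - of_real (lam q + ca))"
    unfolding h1_c_def using x0 by (simp add: field_simps power2_eq_square)
  then have "of_real (lam2 q) * Y0_c x + (of_real (lam1 q) * x + of_real ca / x) = of_real (lam q + ca)"
    using zero x0 by simp
  then have "Re (of_real (lam2 q) * Y0_c x) + Re (of_real (lam1 q) * x + of_real ca / x) = lam q + ca"
    by (metis Re_complex_of_real plus_complex.sel(1))
  moreover have "Re (of_real (lam2 q) * Y0_c x) \<le> lam2 q * Y0 q r"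
  proof -
    have "Re (Y0_c x) \<le> Y0 q r"
      using norm_Y0_c_le_real[OF x(1,2)] complex_Re_le_cmod[of "Y0_c x"] by (simp add: r_def)
    then show ?thesis
      using param_pos by simp
  qed
  moreover have "Re (of_real (lam1 q) * x + of_real ca / x) < lam1 q * r + ca / r"
    unfolding r_def using Re_joukowski(2)[OF x0 param_pos(1) ca(1) x(3)] .
  ultimately have "lam q + ca < lam2 q * Y0 q r + lam1 q * r + ca / r"
    by linarith
  then have "r * (lam q + ca) < r * (lam2 q * Y0 q r + lam1 q * r + ca / r)"
    using r by simp
  also have "\<dots> = h1 q r (Y0 q r) + r * (lam q + ca)"
    unfolding h1_def a1_def b1_def ca_def[symmetric] using r by (simp add: power2_eq_square algebra_simps)
  finally show False
    using le by (simp add: r_def)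
qed

end

section \<open>Continuation of the generating function\<close>

lemma suminf_complex_of_real:
  assumes "summable (\<lambda>n. complex_of_real (f n))"
  shows "(\<Sum>n. complex_of_real (f n)) = of_real (\<Sum>n. f n)"
  using assms by (intro suminf_of_real[symmetric]) (simp add: summable_of_real_iff)

context retrial begin

definition phi :: "complex \<Rightarrow> complex" where "phi x = (\<Sum>j. gf1 P j * x ^ j)"
definition psi :: "complex \<Rightarrow> complex" where "psi y = (\<Sum>j. gf2 P j * y ^ j)"

lemma tot_eq: "lam1 q + lam2 q + mu1 q + mu2 q = alpha q"
  by (simp add: alpha_def lam_def)

lemma geometric_coeffs_summable:
  assumes "\<And>j. 0 \<le> f j" "\<And>j. f j \<le> C * \<theta> ^ j" "\<theta> > 0" "norm (z::complex) < 1 / \<theta>"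
  shows "summable (\<lambda>j. complex_of_real (f j) * z ^ j)"
proof (rule summable_comparison_test')
  have "\<theta> * norm z < 1"
    using assms by (simp add: field_simps)
  then show "summable (\<lambda>j. C * (\<theta> * norm z) ^ j)"
    using assms by (intro summable_mult summable_geometric) simp
  fix j
  have "norm (complex_of_real (f j) * z ^ j) = f j * norm z ^ j"
    using assms(1) by (simp add: norm_mult norm_power)
  also have "\<dots> \<le> C * \<theta> ^ j * norm z ^ j"
    using assms(2) by (intro mult_right_mono) auto
  finally show "norm (complex_of_real (f j) * z ^ j) \<le> C * (\<theta> * norm z) ^ j"
    by (simp add: power_mult_distrib)
qed

lemma P_le_one: "P s \<le> 1"
proof -
  have "(P has_sum P s) {s}"
    using has_sum_finite[of "{s}" P] by simp
  moreover have "(P has_sum 1) UNIV"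
    using stationary by (simp add: stationary_distribution_def)
  ultimately show ?thesis
    by (rule has_sum_mono2) (auto simp: P_nonneg)
qed

lemma gf_summable_unit:
  assumes "norm z < 1"
  shows "summable (\<lambda>j. gf1 P j * z ^ j)" "summable (\<lambda>j. gf2 P j * z ^ j)"
  unfolding gf1_def gf2_def
  by (rule geometric_coeffs_summable[of _ 1 1]; use assms P_nonneg P_le_one in simp)+

lemma psi_radius:
  obtains R2 where "\<sigma> < R2" "1 \<le> R2" "\<And>z. norm z < R2 \<Longrightarrow> summable (\<lambda>j. gf2 P j * z ^ j)"
proof -
  consider "muh2 q < lamh2 q" | "lamh2 q < muh2 q" | "muh2 q = lamh2 q"
    by linarith
  then show ?thesis
  proof cases
    case 1
    then have "\<sigma> < 1"
      unfolding \<sigma>_def using rate_pos by simp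
    then show ?thesis
      using that[of 1] gf_summable_unit by auto
  next
    case 2
    let ?r = "lamh2 q / muh2 q"
    have r: "0 < ?r" "1 < 1 / ?r"
      using 2 rate_pos by auto
    have "\<sigma>\<^sup>2 * 1 < (1 / ?r) * (1 / ?r)"
      unfolding \<sigma>(2) using r rate_pos by (intro mult_le_less_imp_less) auto
    then have "\<sigma>\<^sup>2 < (1 / ?r)\<^sup>2"
      by (simp only: power2_eq_square mult_1_right)
    then have "\<sigma> < 1 / ?r"
      by (rule power2_less_imp_less) (use rate_pos in auto)
    moreover have "summable (\<lambda>j. gf2 P j * z ^ j)" if "norm z < 1 / ?r" for z
      unfolding gf2_def
    proof (rule geometric_coeffs_summable[OF P_nonneg _ r(1) that])
      fix j
      show "P (0, j + 1, Busy) \<le> (bal.\<Phi> 1 0 * ?r) * ?r ^ j"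
        using bal.edge_decay[of "j + 1"] unfolding tot_eq by (simp add: lamh2_def muh2_def mult_ac)
    qed
    ultimately show ?thesis
      using that[of "1 / ?r"] r by auto
  next
    case 3
    have "mu q * mu2 q = (lam1 q + lam2 q + mu1 q + mu2 q) * lam2 q" "(lam1 q + lam2 q + mu1 q + mu2 q) * lam1 q < mu q * mu1 q"
      unfolding tot_eq using 3 drift1 by (auto simp: lamh1_def lamh2_def muh1_def muh2_def)
    then obtain C \<theta> where \<theta>: "0 \<le> \<theta>" "\<theta> < 1" and le: "\<And>n. P (0, Suc n, Busy) \<le> C * \<theta> ^ n"
      by (rule bal.critical_edge_decay) blast
    have C: "C \<ge> 0"
      using le[of 0] P_nonneg[of "(0, Suc 0, Busy)"] by simp
    \<comment> \<open>The ratio is enlarged so that it is positive even when \<open>\<theta>\<close>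
      is 0, since \<open>geometric_coeffs_summable\<close> divides by it.\<close>
    define r where "r = (1 + \<theta>) / 2"
    have r: "0 < r" "\<theta> \<le> r" "r < 1"
      using \<theta> by (auto simp: r_def)
    have "summable (\<lambda>j. gf2 P j * z ^ j)" if "norm z < 1 / r" for z
      unfolding gf2_def
    proof (rule geometric_coeffs_summable[OF P_nonneg _ r(1) that])
      fix j
      have "C * \<theta> ^ j \<le> C * r ^ j"
        using C \<theta> r by (intro mult_left_mono power_mono) auto
      then show "P (0, j + 1, Busy) \<le> C * r ^ j"
        using le[of j] by simp
    qed
    moreover have "\<sigma> = 1"
      unfolding \<sigma>_def using 3 rate_pos by simp
    ultimately show ?thesis
      using that[of "1 / r"] r by auto
  qed
qed

text \<open>Not necessarily the radius of convergence: any radius beyond \<open>\<sigma>\<close>, the largest modulus that \<open>Y0\<close> attains, will do.\<close>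

definition R2 :: real where
  "R2 = (SOME R2. \<sigma> < R2 \<and> 1 \<le> R2 \<and> (\<forall>z::complex. norm z < R2 \<longrightarrow> summable (\<lambda>j. gf2 P j * z ^ j)))"

lemma R2: "\<sigma> < R2" "1 \<le> R2" "\<And>z::complex. norm z < R2 \<Longrightarrow> summable (\<lambda>j. gf2 P j * z ^ j)"
proof -
  have "\<exists>R2. \<sigma> < R2 \<and> 1 \<le> R2 \<and> (\<forall>z::complex. norm z < R2 \<longrightarrow> summable (\<lambda>j. gf2 P j * z ^ j))"
    using psi_radius by blast
  from someI_ex[OF this] show "\<sigma> < R2" "1 \<le> R2" "\<And>z::complex. norm z < R2 \<Longrightarrow> summable (\<lambda>j. gf2 P j * z ^ j)"
    unfolding R2_def by blast+
qed

lemma psi_holomorphic: "psi holomorphic_on ball 0 R2"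
  using continues_series_ball[of R2 "gf2 P"] R2 unfolding continues_series_def psi_def by auto

text \<open>\<open>pi2\<close> is defined through continuation along rays; within radius
  \<open>R2\<close> this is the power series itself.\<close>

lemma psi_of_real:
  assumes "\<bar>y\<bar> < R2"
  shows "psi (of_real y) = of_real (pi2 P y)" "pi2 P y = (\<Sum>j. P (0, j + 1, Busy) * y ^ j)"
proof -
  have "R2 > 0"
    using R2 by linarith
  have smb: "summable (\<lambda>j. complex_of_real (P (0, j + 1, Busy) * y ^ j))"
    using R2(3)[of "of_real y"] assms by (simp add: gf2_def)
  have "psi (of_real y) = (\<Sum>j. complex_of_real (P (0, j + 1, Busy) * y ^ j))"
    by (simp add: psi_def gf2_def)
  also have "\<dots> = of_real (\<Sum>j. P (0, j + 1, Busy) * y ^ j)"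
    by (rule suminf_complex_of_real[OF smb])
  finally have eq: "psi (of_real y) = of_real (\<Sum>j. P (0, j + 1, Busy) * y ^ j)" .
  have "continuation (gf2 P) (of_real y) = psi (of_real y)"
    unfolding psi_def
    by (rule continuation_eq[OF continues_series_ball[OF \<open>R2 > 0\<close>, of "gf2 P"]]) (use assms R2(3) in auto)
  then show "pi2 P y = (\<Sum>j. P (0, j + 1, Busy) * y ^ j)"
    unfolding pi2_def eq by simp
  then show "psi (of_real y) = of_real (pi2 P y)"
    using eq by simp
qed

lemma pi2_nonneg:
  assumes "0 \<le> y" "y < R2"
  shows "pi2 P y \<ge> 0"
proof -
  have "summable (\<lambda>j. complex_of_real (P (0, j + 1, Busy) * y ^ j))"
    using R2(3)[of "of_real y"] assms by (simp add: gf2_def)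
  then have "summable (\<lambda>j. P (0, j + 1, Busy) * y ^ j)"
    by (simp only: summable_of_real_iff)
  then show ?thesis
    using psi_of_real(2)[of y] assms P_nonneg by (simp add: suminf_nonneg)
qed

text \<open>The differentiated series has nonnegative coefficients; the sign of \<open>d\<close>
  enters \<open>slope_pos\<close>.\<close>

lemma psi_deriv_real:
  assumes "0 \<le> y" "y < R2"
  obtains d where "d \<ge> 0" "deriv psi (of_real y) = of_real d"
proof -
  have sums: "(\<lambda>n. gf2 P n * z ^ n) sums psi z" if "norm z < R2" for z
    unfolding psi_def using R2(3)[OF that] by (rule summable_sums)
  have "(\<lambda>n. of_nat (Suc n) * gf2 P (Suc n) * of_real y ^ n) sums deriv psi (of_real y)"
    by (rule powser_deriv_sums[OF sums]) (use assms in auto)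
  then have s: "(\<lambda>n. complex_of_real (real (Suc n) * P (0, Suc n + 1, Busy) * y ^ n)) sums deriv psi (of_real y)"
    by (simp add: gf2_def)
  then have smb: "summable (\<lambda>n. complex_of_real (real (Suc n) * P (0, Suc n + 1, Busy) * y ^ n))"
    by (simp add: sums_iff)
  have "deriv psi (of_real y) = of_real (\<Sum>n. real (Suc n) * P (0, Suc n + 1, Busy) * y ^ n)"
    using s suminf_complex_of_real[OF smb] by (simp add: sums_iff)
  moreover have "summable (\<lambda>n. real (Suc n) * P (0, Suc n + 1, Busy) * y ^ n)"
    using smb by (simp only: summable_of_real_iff)
  then have "(\<Sum>n. real (Suc n) * P (0, Suc n + 1, Busy) * y ^ n) \<ge> 0"
    using P_nonneg assms by (intro suminf_nonneg) auto
  ultimately show ?thesis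
    using that by blast
qed

section \<open>Extension of \<open>phi\<close> through the functional equation\<close>

definition N_c :: "complex \<Rightarrow> complex \<Rightarrow> complex" where
  "N_c x y = h2_c x y * psi y + h0_c x y * of_real (P (0, 0, Busy))"

lemma N_c_of_real: "\<bar>y\<bar> < R2 \<Longrightarrow> N_c (of_real x) (of_real y) = of_real (N q P x y)"
  by (simp add: N_c_def N_def of_real_boundary psi_of_real(1))

text \<open>Below \<open>muh1 / lamh1\<close> the branch \<open>Y0\<close> is less than 1, so the
  summed balance equations apply; above \<open>s0\<close> it agrees with
  \<open>Y0_c\<close>.\<close>

lemma functional_equation_real:
  assumes x: "s0 < x" "x < muh1 q / lamh1 q" and smb: "summable (\<lambda>j. gf1 P j * of_real x ^ j)"
  shows "h1_c (of_real x) (Y0_c (of_real x)) * phi (of_real x) + N_c (of_real x) (Y0_c (of_real x)) = 0"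
proof -
  have x1: "1 < x" "x \<le> x_3 q"
    using x s0 branch_points(7) by linarith+
  define y where "y = Y0 q x"
  have y: "0 < y" "y < 1"
    using branch_values(3)[OF x1] Y0_le_one(2)[of x] x x1 by (auto simp: y_def)
  have yR: "\<bar>y\<bar> < R2"
    using y R2 by linarith
  have smb': "summable (\<lambda>j. complex_of_real (P (Suc j, 0, Busy) * x ^ j))"
    using smb by (simp add: gf1_def)
  have phi: "phi (of_real x) = of_real (\<Sum>j. P (Suc j, 0, Busy) * x ^ j)"
    using suminf_complex_of_real[OF smb'] by (simp add: phi_def gf1_def)
  have ker: "alpha q * (lam1 q * x + lam2 q * y - (lam1 q + lam2 q)) = mu q * mu1 q * (1 - 1 / x) + mu q * mu2 q * (1 - 1 / y)"
    using on_kernel_branch[OF x1] unfolding on_kernel_def h0_def y_def lam_def muh1_def muh2_def .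
  have xlt: "x < mu q * mu1 q / (alpha q * lam1 q)"
    using x(2) by (simp add: muh1_def lamh1_def)
  have x0: "0 < x"
    using x1 by simp
  have "h1 q x y * (\<Sum>j. P (Suc j, 0, Busy) * x ^ j) + h2 q x y * (\<Sum>j. P (0, Suc j, Busy) * y ^ j) + h0 q x y * P (0, 0, Busy) = 0"
    using bal.functional_equation[unfolded tot_eq, OF x0 xlt y ker]
    unfolding h1_def a1_def b1_def h2_def h0_def lam_def muh1_def muh2_def by (simp only: diff_diff_eq add.assoc)
  then have "h1 q x y * (\<Sum>j. P (Suc j, 0, Busy) * x ^ j) + N q P x y = 0"
    unfolding N_def psi_of_real(2)[OF yR] by (simp add: add.assoc)
  then have "complex_of_real (h1 q x y * (\<Sum>j. P (Suc j, 0, Busy) * x ^ j) + N q P x y) = 0"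
    by simp
  then show ?thesis
    unfolding Y_c_of_real(1)[OF x(1) x1(2)] y_def[symmetric] phi of_real_boundary N_c_of_real[OF yR]
    by (simp only: of_real_add of_real_mult)
qed

lemma h_c_holomorphic [holomorphic_intros]:
  assumes "f holomorphic_on A" "w holomorphic_on A"
  shows "(\<lambda>x. h1_c (f x) (w x)) holomorphic_on A" "(\<lambda>x. h2_c (f x) (w x)) holomorphic_on A" "(\<lambda>x. h0_c (f x) (w x)) holomorphic_on A"
  unfolding h1_c_def h2_c_def h0_c_def by (intro holomorphic_intros assms)+

lemma N_c_holomorphic [holomorphic_intros]:
  assumes "f holomorphic_on A" "w holomorphic_on A" "\<And>x. x \<in> A \<Longrightarrow> norm (w x) < R2"
  shows "(\<lambda>x. N_c (f x) (w x)) holomorphic_on A"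
proof -
  have "(psi \<circ> w) holomorphic_on A"
    by (rule holomorphic_on_compose_gen[OF assms(2) psi_holomorphic]) (use assms(3) in auto)
  then show ?thesis
    unfolding N_c_def o_def by (intro holomorphic_intros assms)
qed

definition ext :: "complex \<Rightarrow> complex" where
  "ext x = - N_c x (Y0_c x) / h1_c x (Y0_c x)"

definition ext_dom :: "complex set" where
  "ext_dom = {x \<in> slit_dom. norm (Y0_c x) < R2 \<and> h1_c x (Y0_c x) \<noteq> 0}"

lemma open_ext_dom: "open ext_dom"
proof -
  have c1: "continuous_on slit_dom (\<lambda>x. norm (Y0_c x))"
    by (intro continuous_intros holomorphic_on_imp_continuous_on Y_c_holomorphic)
  have c2: "continuous_on slit_dom (\<lambda>x. h1_c x (Y0_c x))"
    by (intro holomorphic_on_imp_continuous_on holomorphic_intros Y_c_holomorphic)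
  have "ext_dom = (slit_dom \<inter> (\<lambda>x. norm (Y0_c x)) -` {..<R2}) \<inter> (slit_dom \<inter> (\<lambda>x. h1_c x (Y0_c x)) -` (- {0}))"
    by (auto simp: ext_dom_def)
  moreover have "open (slit_dom \<inter> (\<lambda>x. norm (Y0_c x)) -` {..<R2})"
    by (rule continuous_open_preimage[OF c1 open_slit_dom]) auto
  moreover have "open (slit_dom \<inter> (\<lambda>x. h1_c x (Y0_c x)) -` (- {0}))"
    by (rule continuous_open_preimage[OF c2 open_slit_dom]) auto
  ultimately show ?thesis
    by auto
qed

lemma ext_holomorphic: "ext holomorphic_on ext_dom"
  unfolding ext_def
  by (intro holomorphic_intros holomorphic_on_subset[OF Y_c_holomorphic(1)]) (auto simp: ext_dom_def)

end

text \<open>\<open>R\<close> stands for the dominant singularity. The weak inequality for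
  \<open>h1\<close> covers all three types: equality if the singularity is \<open>x_plus\<close>,
  strict inequality at a branch point reached before any zero.\<close>

locale retrial_disc = retrial +
  fixes R :: real
  assumes R: "s0 < R" "R \<le> x_3 q"
    and phi_summable: "\<And>z. norm z < R \<Longrightarrow> summable (\<lambda>j. gf1 P j * z ^ j)"
    and h1_R: "h1 q R (Y0 q R) \<le> 0"
begin

lemma R_pos: "0 < R"
  using R s0_pos by linarith

lemma phi_holomorphic: "phi holomorphic_on ball 0 R"
  using continues_series_ball[OF R_pos phi_summable] unfolding continues_series_def phi_def by auto

text \<open>Identity theorem: the equation is known on a real segment just outside
  \<open>s0\<close>, whose points accumulate inside the connected annulus.\<close>

lemma functional_equation_annulus:
  assumes "s0 < norm x" "norm x < R"
  shows "h1_c x (Y0_c x) * phi x + N_c x (Y0_c x) = 0"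
proof -
  define A where "A = {x::complex. s0 < norm (x - 0) \<and> norm (x - 0) < R}"
  have sub: "A \<subseteq> slit_dom"
    using annulus_slit_dom R by (auto simp: A_def)
  \<comment> \<open>Keeps the segment inside both the disc of convergence and the range of
    \<open>functional_equation_real\<close>.\<close>
  define T where "T = min R (muh1 q / lamh1 q)"
  have T: "s0 < T" "T \<le> R" "T \<le> muh1 q / lamh1 q"
    using R s0 by (auto simp: T_def)
  define t where "t = (s0 + T) / 2"
  have t: "s0 < t" "t < T"
    using T by (auto simp: t_def)
  show ?thesis
  proof (rule analytic_continuation[of "\<lambda>x. h1_c x (Y0_c x) * phi x + N_c x (Y0_c x)" A "of_real ` {s0<..<T}" "of_real t"])
    show "(\<lambda>x. h1_c x (Y0_c x) * phi x + N_c x (Y0_c x)) holomorphic_on A"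
    proof (intro holomorphic_intros holomorphic_on_subset[OF Y_c_holomorphic(1) sub])
      show "phi holomorphic_on A"
        by (rule holomorphic_on_subset[OF phi_holomorphic]) (auto simp: A_def)
      show "norm (Y0_c x) < R2" if "x \<in> A" for x
        using norm_Y0_c_le[of x] sub that R R2 by (force simp: A_def)
    qed
    show "open A"
      unfolding A_def by (intro open_Collect_conj open_Collect_less continuous_intros)
    show "connected A"
      unfolding A_def by (rule connected_annulus) simp
    show "of_real ` {s0<..<T} \<subseteq> A"
      using T s0_pos by (auto simp: A_def)
    show "of_real t \<in> A"
      using t T s0_pos by (auto simp: A_def)
    show "complex_of_real t islimpt complex_of_real ` {s0<..<T}"
    proof (rule islimpt_isCont_image)
      show "t islimpt {s0<..<T}"
        using t by (intro interior_limit_point) (simp add: interior_open)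
      show "\<forall>\<^sub>F y in at t. complex_of_real y \<noteq> complex_of_real t"
        by (auto simp: eventually_at intro: exI[of _ 1])
    qed auto
    show "h1_c z (Y0_c z) * phi z + N_c z (Y0_c z) = 0" if "z \<in> of_real ` {s0<..<T}" for z
    proof -
      from that obtain r where r: "z = of_real r" and "r \<in> {s0<..<T}"
        by (rule imageE)
      then have r2: "s0 < r" "r < T"
        by simp_all
      then have "norm (complex_of_real r) < R"
        using T s0_pos r2 by simp
      then show ?thesis
        unfolding r using r2 T by (intro functional_equation_real phi_summable) auto
    qed
    show "x \<in> A"
      using assms by (simp add: A_def)
  qed
qed

definition cont :: "complex \<Rightarrow> complex" where
  "cont x = (if norm x < R then phi x else ext x)"

lemma cont_ext:
  assumes "x \<in> ext_dom"
  shows "cont x = ext x"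
proof (cases "norm x < R")
  case True
  have x: "s0 < norm x" "h1_c x (Y0_c x) \<noteq> 0"
    using assms by (simp_all add: ext_dom_def slit_dom_def)
  have "h1_c x (Y0_c x) * phi x = - N_c x (Y0_c x)"
    using functional_equation_annulus[OF x(1) True] by (simp only: eq_neg_iff_add_eq_0)
  then have "phi x = ext x"
    unfolding ext_def using x(2) by (metis nonzero_mult_div_cancel_left)
  with True show ?thesis
    by (simp add: cont_def)
qed (simp add: cont_def)

lemma cont_holomorphic: "cont holomorphic_on ball 0 R \<union> ext_dom"
proof (rule holomorphic_on_Un)
  show "cont holomorphic_on ball 0 R"
    by (rule holomorphic_transform[OF phi_holomorphic]) (simp add: cont_def)
  show "cont holomorphic_on ext_dom"
    by (rule holomorphic_transform[OF ext_holomorphic]) (simp add: cont_ext)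
qed (auto simp: open_ext_dom)

lemma sphere_ext_dom:
  assumes "norm x = R" "x \<noteq> of_real R"
  shows "x \<in> ext_dom"
proof -
  have sd: "x \<in> slit_dom"
  proof -
    have "of_real (x_3 q) - x \<notin> \<real>\<^sub>\<le>\<^sub>0"
    proof
      assume "of_real (x_3 q) - x \<in> \<real>\<^sub>\<le>\<^sub>0"
      then have *: "Im x = 0" "x_3 q \<le> Re x"
        by (auto simp: complex_nonpos_Reals_iff)
      then have "Re x = R"
        using complex_Re_le_cmod[of x] assms(1) R by simp
      with * assms(2) show False
        by (simp add: complex_eq_iff)
    qed
    then show ?thesis
      using assms(1) R by (simp add: slit_dom_def)
  qed
  moreover have "norm (Y0_c x) < R2"
    using norm_Y0_c_le[OF sd] assms R R2 by simp
  moreover have "h1_c x (Y0_c x) \<noteq> 0"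
    by (rule h1_c_nonzero[OF sd]) (use assms R h1_R in auto)
  ultimately show ?thesis
    by (simp add: ext_dom_def)
qed

lemma scaled_disc:
  "open ((\<lambda>z. of_real R * z) -` (ball 0 R \<union> ext_dom))"
  "(\<lambda>z. cont (of_real R * z)) holomorphic_on (\<lambda>z. of_real R * z) -` (ball 0 R \<union> ext_dom)"
  "ball 0 1 \<subseteq> (\<lambda>z. of_real R * z) -` (ball 0 R \<union> ext_dom)"
  "sphere 0 1 - {1} \<subseteq> (\<lambda>z. of_real R * z) -` (ball 0 R \<union> ext_dom)"
proof -
  show "open ((\<lambda>z. of_real R * z) -` (ball 0 R \<union> ext_dom))"
    by (intro open_vimage open_Un open_ext_dom continuous_intros) auto
  have "(cont \<circ> (\<lambda>z. of_real R * z)) holomorphic_on (\<lambda>z. of_real R * z) -` (ball 0 R \<union> ext_dom)"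
    by (rule holomorphic_on_compose_gen[OF _ cont_holomorphic]) (auto intro!: holomorphic_intros)
  then show "(\<lambda>z. cont (of_real R * z)) holomorphic_on (\<lambda>z. of_real R * z) -` (ball 0 R \<union> ext_dom)"
    by (simp add: o_def)
  show "ball 0 1 \<subseteq> (\<lambda>z. of_real R * z) -` (ball 0 R \<union> ext_dom)"
    using R_pos by (auto simp: norm_mult)
  show "sphere 0 1 - {1} \<subseteq> (\<lambda>z. of_real R * z) -` (ball 0 R \<union> ext_dom)"
    using R_pos by (auto intro!: sphere_ext_dom simp: norm_mult)
qed

lemma cont_sums:
  assumes "norm z < 1"
  shows "(\<lambda>n. complex_of_real (P (Suc n, 0, Busy) * R ^ n) * z ^ n) sums cont (of_real R * z)"
proof -
  have "norm (of_real R * z) < R"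
    using assms R_pos by (simp add: norm_mult)
  then show ?thesis
    using summable_sums[OF phi_summable, of "of_real R * z"]
    by (simp add: cont_def phi_def gf1_def power_mult_distrib mult_ac)
qed

lemma coeff_limit:
  assumes H: "H holomorphic_on ball 0 \<delta>" "\<delta> > 0" "H 0 = of_real h"
    and local: "\<And>t. Re t > 0 \<Longrightarrow> norm t < \<delta> \<Longrightarrow>
      of_real R * (1 - t\<^sup>2) \<in> ext_dom \<and> ext (of_real R * (1 - t\<^sup>2)) * t ^ k = H t"
    and "k \<ge> 1"
  shows "(\<lambda>n. P (Suc n, 0, Busy) * R ^ n * real n powr (1 - real k / 2)) \<longlonglongrightarrow> h / Gamma (real k / 2)"
proof -
  have "(\<lambda>n. complex_of_real (P (Suc n, 0, Busy) * R ^ n) * of_real (real n powr (1 - real k / 2)))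
      \<longlonglongrightarrow> H 0 * inverse (Gamma (of_nat k / 2))"
    by (rule sqrt_transfer[OF cont_sums scaled_disc H(1,2) _ \<open>k \<ge> 1\<close>]) (use local cont_ext in auto)
  moreover have "H 0 * inverse (Gamma (of_nat k / 2)) = of_real (h / Gamma (real k / 2))"
  proof -
    have "Gamma (of_nat k / 2) = complex_of_real (Gamma (real k / 2))"
      by (simp flip: Gamma_complex_of_real)
    then show ?thesis
      unfolding H(3) by (simp only: divide_inverse of_real_mult of_real_inverse)
  qed
  ultimately have "(\<lambda>n. complex_of_real (P (Suc n, 0, Busy) * R ^ n * real n powr (1 - real k / 2)))
      \<longlonglongrightarrow> of_real (h / Gamma (real k / 2))"
    by (simp only: of_real_mult)
  then show ?thesis
    by (simp only: tendsto_of_real_iff)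
qed

lemma coeff_limit_0:
  assumes H: "H holomorphic_on ball 0 \<delta>" "\<delta> > 0" "deriv H 0 = of_real h"
    and local: "\<And>t. Re t > 0 \<Longrightarrow> norm t < \<delta> \<Longrightarrow>
      of_real R * (1 - t\<^sup>2) \<in> ext_dom \<and> ext (of_real R * (1 - t\<^sup>2)) = H t"
  shows "(\<lambda>n. P (Suc n, 0, Busy) * R ^ n * real n powr (3 / 2)) \<longlonglongrightarrow> - h / (2 * sqrt pi)"
proof -
  have "(\<lambda>n. complex_of_real (P (Suc n, 0, Busy) * R ^ n) * of_real (real n powr (3 / 2)))
      \<longlonglongrightarrow> - deriv H 0 / of_real (2 * sqrt pi)"
    by (rule sqrt_transfer_0[OF cont_sums scaled_disc H(1,2)]) (use local cont_ext in auto)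
  then have "(\<lambda>n. complex_of_real (P (Suc n, 0, Busy) * R ^ n * real n powr (3 / 2))) \<longlonglongrightarrow> of_real (- h / (2 * sqrt pi))"
    unfolding H(3) by simp
  then show ?thesis
    by (simp only: tendsto_of_real_iff)
qed

end

section \<open>Local behaviour at the dominant singularity\<close>

context retrial begin

text \<open>For \<open>x_plus > 1\<close> the right-hand side has a simple zero at
  \<open>x_plus\<close>, which bounds the order of vanishing of \<open>h1_c\<close> along the branch
  without any differentiation.\<close>

lemma h1_c_product:
  assumes "x \<noteq> 0"
  shows "of_real (alpha q * (lam q + mu1 q)) * (h1_c x (Y0_c x) * h1_c x (Y1_c x))
     = of_real (muh2 q * lam q * lam1 q) * (x - 1) * (x - of_real (x_plus q)) * (x - of_real (x_minus q))"
proof -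
  define b where "b = of_real (lam1 q) * x\<^sup>2 - of_real (lam q + ca) * x + of_real ca"
  let ?k = "complex_of_real (lam q + mu1 q)"
  have k0: "?k \<noteq> 0"
    using rate_pos param_pos by (simp del: of_real_add)
  have L0: "complex_of_real (lamh2 q) \<noteq> 0"
    using rate_pos by simp
  have "of_real (alpha q) * (h1_c x (Y0_c x) * h1_c x (Y1_c x))
     = of_real (alpha q) * b\<^sup>2 + b * (of_real (lamh2 q) * x * (Y0_c x + Y1_c x)) + of_real (lamh2 q * lam2 q) * x\<^sup>2 * (Y0_c x * Y1_c x)"
    unfolding h1_c_def b_def[symmetric] lamh2_def by (simp add: power2_eq_square algebra_simps)
  also have "of_real (lamh2 q * lam2 q) * x\<^sup>2 * (Y0_c x * Y1_c x) = of_real (lam2 q) * of_real (mu q) * of_real (mu2 q) * x\<^sup>2"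
    unfolding Y_c_sum_prod(2)[OF assms] muh2_def using L0 by simp
  finally have E: "of_real (alpha q) * (h1_c x (Y0_c x) * h1_c x (Y1_c x))
     = of_real (alpha q) * b\<^sup>2 - b * bhat_c x + of_real (lam2 q) * of_real (mu q) * of_real (mu2 q) * x\<^sup>2"
    unfolding Y_c_sum_prod(1)[OF assms] by simp
  define G where "G = of_real (lam q * lam1 q * (lam q + mu1 q)) * x\<^sup>2 + of_real (lam q * mu1 q * (lam q + mu1 q - mu q)) * x - of_real (mu q * (mu1 q)\<^sup>2)"
  have "?k\<^sup>2 * (of_real (alpha q) * b\<^sup>2 - b * bhat_c x + of_real (lam2 q) * of_real (mu q) * of_real (mu2 q) * x\<^sup>2)
      = of_real (mu q) * of_real (mu2 q) * (x - 1) * G"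
  proof -
    have eqs: "b = of_real (lam1 q) * x\<^sup>2 - (of_real (lam q) + of_real ca) * x + of_real ca"
      "bhat_c x = of_real (alpha q) * of_real (lam1 q) * x\<^sup>2 - (of_real (alpha q) * of_real (lam1 q) + of_real (alpha q) * of_real (lam2 q)
         + of_real (mu q) * of_real (mu1 q) + of_real (mu q) * of_real (mu2 q)) * x + of_real (mu q) * of_real (mu1 q)"
      "G = of_real (lam q) * of_real (lam1 q) * (of_real (lam q) + of_real (mu1 q)) * x\<^sup>2
         + of_real (lam q) * of_real (mu1 q) * (of_real (lam q) + of_real (mu1 q) - of_real (mu q)) * x - of_real (mu q) * (of_real (mu1 q))\<^sup>2"
      "?k = of_real (lam q) + of_real (mu1 q)"
      by (simp_all add: b_def bhat_c_def G_def lamh1_def lamh2_def muh1_def muh2_def)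
    have "complex_of_real (ca * (lam q + mu1 q)) = of_real (mu q * mu1 q)"
      unfolding ca(3) muh1_def ..
    then have c: "complex_of_real ca * (of_real (lam1 q) + of_real (lam2 q) + of_real (mu1 q)) = of_real (mu q) * of_real (mu1 q)"
      by (simp add: lam_def)
    have l: "complex_of_real (alpha q) = of_real (lam1 q) + of_real (lam2 q) + of_real (mu1 q) + of_real (mu2 q)"
      "complex_of_real (lam q) = of_real (lam1 q) + of_real (lam2 q)"
      by (simp_all add: alpha_def lam_def)
    show ?thesis
      unfolding eqs unfolding l by (rule boundary_product_identity[OF c])
  qed
  then have "?k * (?k * of_real (alpha q) * (h1_c x (Y0_c x) * h1_c x (Y1_c x))) = of_real (muh2 q) * (x - 1) * G"
    unfolding E[symmetric] muh2_def by (simp add: power2_eq_square mult_ac)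
  also have "G = of_real (lam q * lam1 q * (lam q + mu1 q)) * (x - of_real (x_plus q)) * (x - of_real (x_minus q))"
  proof -
    define A where "A = lam q * lam1 q * (lam q + mu1 q)"
    have prod: "mu q * (mu1 q)\<^sup>2 = - (A * (x_plus q * x_minus q))"
      and sum: "lam q * mu1 q * (lam q + mu1 q - mu q) = - (A * (x_plus q + x_minus q))"
      using g_factor(3)[of 0] g_factor(3)[of 1] by (simp_all add: g_def A_def[symmetric]) (simp add: algebra_simps)
    show ?thesis
      unfolding G_def A_def[symmetric] prod sum by (simp add: power2_eq_square algebra_simps)
  qed
  finally have "?k * (?k * of_real (alpha q) * (h1_c x (Y0_c x) * h1_c x (Y1_c x)))
     = ?k * (of_real (muh2 q * lam q * lam1 q) * (x - 1) * (x - of_real (x_plus q)) * (x - of_real (x_minus q)))"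
    by (simp only: of_real_mult mult_ac)
  then have "?k * of_real (alpha q) * (h1_c x (Y0_c x) * h1_c x (Y1_c x))
     = of_real (muh2 q * lam q * lam1 q) * (x - 1) * (x - of_real (x_plus q)) * (x - of_real (x_minus q))"
    using k0 by (simp only: mult_cancel_left) blast
  then show ?thesis
    by (simp only: of_real_mult mult_ac)
qed

text \<open>A zero of \<open>h1\<close> on the branch is not cancelled by the numerator, as
  \<open>h2\<close> and \<open>h0\<close> are positive there.\<close>

lemma N_pos:
  assumes "1 < x" "x \<le> x_3 q" "h1 q x (Y0 q x) = 0"
  shows "N q P x (Y0 q x) > 0"
proof -
  note b = branch_values[OF assms(1,2)]
  have "h2 q x (Y0 q x) > 0"
    using h2_pos[OF on_kernel_branch[OF assms(1,2)] assms(1) b(3)] assms(3) by simp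
  moreover have "pi2 P (Y0 q x) \<ge> 0"
    using Y0_le_\<sigma>(1)[OF assms(1,2)] b(3) R2 by (intro pi2_nonneg) auto
  moreover have "h0 q x (Y0 q x) > 0"
    by (rule h0_pos_at_zero[OF assms(1,3)])
  ultimately show ?thesis
    unfolding N_def using P00_pos by (simp add: add_nonneg_pos)
qed

text \<open>The quotient rule for \<open>- N / h1\<close> in \<open>y\<close> at fixed
  \<open>x\<close>, with \<open>d\<close> for the derivative of \<open>psi\<close> at
  \<open>y\<close>.\<close>

definition slope :: "real \<Rightarrow> real \<Rightarrow> real \<Rightarrow> real" where
  "slope x y d = - (((2 * lam2 q * y + lam1 q * x - lam q - cb) * pi2 P y + h2 q x y * d + lam2 q * P (0, 0, Busy)) * h1 q x y
      - N q P x y * (lam2 q * x)) / (h1 q x y)\<^sup>2"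

lemma real_slope:
  assumes "\<bar>y\<bar> < R2" "deriv psi (of_real y) = of_real d" "h1 q x y \<noteq> 0"
  shows "deriv (\<lambda>y. - (N q P x y / h1 q x y)) y = slope x y d"
proof -
  have "(psi has_field_derivative of_real d) (at (of_real y))"
    unfolding assms(2)[symmetric] by (rule holomorphic_derivI[OF psi_holomorphic]) (use assms(1) in auto)
  then have "((\<lambda>y. psi (of_real y)) has_vector_derivative of_real d) (at y)"
    by (rule has_vector_derivative_real_field)
  from bounded_linear.has_vector_derivative[OF bounded_linear_Re this]
  have "((\<lambda>y. Re (psi (of_real y))) has_real_derivative d) (at y)"
    by (simp add: has_real_derivative_iff_has_vector_derivative)
  then have pi': "(pi2 P has_real_derivative d) (at y)"
    by (rule has_field_derivative_transform_within_open[where S = "{- R2<..<R2}"])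
      (use assms(1) in \<open>auto simp: psi_of_real(1)\<close>)
  have h2': "((\<lambda>y. h2 q x y) has_real_derivative (2 * lam2 q * y + lam1 q * x - lam q - cb)) (at y)"
    unfolding h2_def cb_def[symmetric] by (auto intro!: derivative_eq_intros)
  have h0': "((\<lambda>y. h0 q x y) has_real_derivative lam2 q) (at y)"
    unfolding h0_def by (auto intro!: derivative_eq_intros)
  have h1': "((\<lambda>y. h1 q x y) has_real_derivative lam2 q * x) (at y)"
    unfolding h1_def a1_def by (auto intro!: derivative_eq_intros)
  have N': "((\<lambda>y. N q P x y) has_real_derivative ((2 * lam2 q * y + lam1 q * x - lam q - cb) * pi2 P y + h2 q x y * d + lam2 q * P (0, 0, Busy))) (at y)"
    unfolding N_def by (auto intro!: derivative_eq_intros h2' h0' pi')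
  have "((\<lambda>y. - (N q P x y / h1 q x y)) has_real_derivative slope x y d) (at y)"
    using DERIV_minus[OF DERIV_divide[OF N' h1' assms(3)]]
    by (simp only: slope_def minus_divide_left power2_eq_square)
  then show ?thesis
    by (rule DERIV_imp_deriv)
qed

text \<open>\<open>X\<close> is stationary at 0, as is \<open>x_3 * (1 - t ^ 2)\<close>, so only the
  motion of \<open>Y\<close> contributes and the chain rule gives \<open>\<eta>\<close> times the
  derivative in \<open>y\<close>.\<close>

lemma complex_slope:
  assumes y: "\<bar>y\<bar> < R2" "deriv psi (of_real y) = of_real d" "h1 q x y \<noteq> 0"
    and X: "(X has_field_derivative 0) (at 0)" "X 0 = of_real x"
    and Y: "(Y has_field_derivative of_real \<eta>) (at 0)" "Y 0 = of_real y"
  shows "((\<lambda>t. - N_c (X t) (Y t) / h1_c (X t) (Y t)) has_field_derivative of_real (\<eta> * slope x y d)) (at 0)"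
proof -
  have "(psi has_field_derivative of_real d) (at (Y 0))"
    unfolding y(2)[symmetric] Y(2) by (rule holomorphic_derivI[OF psi_holomorphic]) (use y(1) in auto)
  then have psi': "((\<lambda>t. psi (Y t)) has_field_derivative of_real d * of_real \<eta>) (at 0)"
    by (rule DERIV_chain2[OF _ Y(1)])
  have h2': "((\<lambda>t. h2_c (X t) (Y t)) has_field_derivative of_real ((2 * lam2 q * y + lam1 q * x - lam q - cb) * \<eta>)) (at 0)"
    unfolding h2_c_def by (auto intro!: derivative_eq_intros X(1) Y(1) simp: X(2) Y(2) algebra_simps)
  have h0': "((\<lambda>t. h0_c (X t) (Y t)) has_field_derivative of_real (lam2 q * \<eta>)) (at 0)"
    unfolding h0_c_def by (auto intro!: derivative_eq_intros X(1) Y(1))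
  have h1': "((\<lambda>t. h1_c (X t) (Y t)) has_field_derivative of_real (lam2 q * x * \<eta>)) (at 0)"
    unfolding h1_c_def by (auto intro!: derivative_eq_intros X(1) Y(1) simp: X(2))
  let ?n = "(2 * lam2 q * y + lam1 q * x - lam q - cb) * \<eta> * pi2 P y + h2 q x y * (d * \<eta>) + lam2 q * \<eta> * P (0, 0, Busy)"
  have v: "h1_c (X 0) (Y 0) = of_real (h1 q x y)" "N_c (X 0) (Y 0) = of_real (N q P x y)"
    unfolding X(2) Y(2) using y(1) by (simp_all add: of_real_boundary N_c_of_real)
  have N': "((\<lambda>t. N_c (X t) (Y t)) has_field_derivative of_real ?n) (at 0)"
    unfolding N_c_def using psi_of_real(1)[OF y(1)]
    by (auto intro!: derivative_eq_intros h2' h0' psi' simp: X(2) Y(2) of_real_boundary)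
  have "((\<lambda>t. - N_c (X t) (Y t) / h1_c (X t) (Y t)) has_field_derivative
     (- of_real ?n * of_real (h1 q x y) - - of_real (N q P x y) * of_real (lam2 q * x * \<eta>)) / (of_real (h1 q x y) * of_real (h1 q x y))) (at 0)"
    using DERIV_divide[OF DERIV_minus[OF N'] h1'] unfolding v using y(3) by simp
  also have "(- of_real ?n * of_real (h1 q x y) - - of_real (N q P x y) * of_real (lam2 q * x * \<eta>)) / (of_real (h1 q x y) * of_real (h1 q x y))
      = complex_of_real ((- ?n * h1 q x y + N q P x y * (lam2 q * x * \<eta>)) / (h1 q x y * h1 q x y))"
    by simp
  also have "(- ?n * h1 q x y + N q P x y * (lam2 q * x * \<eta>)) / (h1 q x y * h1 q x y) = \<eta> * slope x y d"
    unfolding slope_def power2_eq_square times_divide_eq_right by (rule arg_cong2[of _ _ _ _ "(/)"]) (simp_all add: algebra_simps)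
  finally show ?thesis .
qed

text \<open>The numerator splits into contributions of \<open>pi2\<close>, of \<open>d\<close> and
  of \<open>P (0, 0, Busy)\<close>: the first and third are signed by
  \<open>derivative_sign\<close>, the second by \<open>h2_pos\<close>, and the third is
  strict.\<close>

lemma slope_pos:
  assumes ker: "on_kernel x \<sigma>" and x: "1 < x" and neg: "h1 q x \<sigma> < 0" and "d \<ge> 0"
  shows "slope x \<sigma> d > 0"
proof -
  have h2: "h2 q x \<sigma> > 0"
    using h2_pos[OF ker x \<sigma>(1)] neg by simp
  have pi: "pi2 P \<sigma> \<ge> 0"
    using \<sigma> R2 by (intro pi2_nonneg) auto
  note s = derivative_sign[OF ker x neg]
  have "0 \<le> pi2 P \<sigma> * (lam2 q * x * h2 q x \<sigma> - h1 q x \<sigma> * (2 * lam2 q * \<sigma> + lam1 q * x - lam q - cb))"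
    using pi s(1) by simp
  moreover have "0 \<le> (- h1 q x \<sigma>) * (h2 q x \<sigma> * d)"
    using neg h2 \<open>d \<ge> 0\<close> by (intro mult_nonneg_nonneg) auto
  moreover have "0 < P (0, 0, Busy) * (lam2 q * x * h0 q x \<sigma> - h1 q x \<sigma> * lam2 q)"
    using P00_pos s(2) by simp
  ultimately have "0 < pi2 P \<sigma> * (lam2 q * x * h2 q x \<sigma> - h1 q x \<sigma> * (2 * lam2 q * \<sigma> + lam1 q * x - lam q - cb))
     + (- h1 q x \<sigma>) * (h2 q x \<sigma> * d) + P (0, 0, Busy) * (lam2 q * x * h0 q x \<sigma> - h1 q x \<sigma> * lam2 q)"
    by linarith
  also have "\<dots> = - (((2 * lam2 q * \<sigma> + lam1 q * x - lam q - cb) * pi2 P \<sigma> + h2 q x \<sigma> * d + lam2 q * P (0, 0, Busy)) * h1 q x \<sigma>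
      - N q P x \<sigma> * (lam2 q * x))"
    unfolding N_def by (simp add: algebra_simps)
  finally show ?thesis
    unfolding slope_def using neg by (intro divide_pos_pos) auto
qed

section \<open>Uniformization at the branch point \<open>x_3\<close>\<close>

definition W :: real where "W = sqrt ((x_3 q - x_1 q) * (x_3 q - x_2 q) * (x_4 q - x_3 q))"

lemma W: "W > 0"
  unfolding W_def using branch_points(1-7) by simp

lemma x3_gt: "1 < x_3 q" "0 < x_3 q"
  using branch_points(4) s0 by linarith+

lemma cofactor_x3: "cofactor (of_real (x_3 q)) = of_real (lamh1 q * W)"
proof -
  note bp = branch_points(1-7)
  have nn: "0 \<le> 1 - x_1 q / x_3 q" "0 \<le> 1 - x_2 q / x_3 q" "0 \<le> x_4 q - x_3 q"
    using bp x3_gt by auto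
  have c: "csqrt (1 - of_real r / of_real (x_3 q)) = of_real (sqrt (1 - r / x_3 q))" if "0 \<le> 1 - r / x_3 q" for r
  proof -
    have "1 - of_real r / of_real (x_3 q) = complex_of_real (1 - r / x_3 q)"
      by simp
    then show ?thesis
      using that by (simp only: csqrt_of_real_nonneg Im_complex_of_real Re_complex_of_real)
  qed
  have c': "csqrt (of_real (x_4 q) - of_real (x_3 q)) = of_real (sqrt (x_4 q - x_3 q))"
  proof -
    have "of_real (x_4 q) - of_real (x_3 q) = complex_of_real (x_4 q - x_3 q)"
      by simp
    then show ?thesis
      using nn by (simp only: csqrt_of_real_nonneg Im_complex_of_real Re_complex_of_real)
  qed
  have eqW: "(x_3 q - x_1 q) * (x_3 q - x_2 q) * (x_4 q - x_3 q) = (x_3 q)\<^sup>2 * (1 - x_1 q / x_3 q) * (1 - x_2 q / x_3 q) * (x_4 q - x_3 q)"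
  proof -
    have "(x_3 q)\<^sup>2 * (1 - x_1 q / x_3 q) * (1 - x_2 q / x_3 q) = (x_3 q - x_1 q) * (x_3 q - x_2 q)"
      using x3_gt by (simp add: power2_eq_square field_simps)
    then show ?thesis
      by simp
  qed
  have "W = x_3 q * sqrt (1 - x_1 q / x_3 q) * sqrt (1 - x_2 q / x_3 q) * sqrt (x_4 q - x_3 q)"
    unfolding W_def eqW using x3_gt by (simp add: real_sqrt_mult)
  then show ?thesis
    unfolding cofactor_def c[OF nn(1)] c[OF nn(2)] c' by simp
qed

text \<open>At once the limit of \<open>q_fun\<close> at \<open>x_3\<close> and the derivative of
  \<open>Y3\<close> at 0; through this coincidence the expansion in \<open>t\<close> produces
  \<open>C3\<close>.\<close>

definition q3 :: real where "q3 = - (lamh1 q * W * sqrt (x_3 q)) / (2 * lamh2 q * x_3 q)"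

lemma q_fun_limit: "Lim (at (x_3 q)) (q_fun q) = q3"
proof (rule tendsto_Lim)
  let ?f = "\<lambda>x. - (1 / (2 * lamh2 q * x)) * sqrt ((lamh1 q)\<^sup>2 * (x - x_1 q) * (x - x_2 q) * (x_4 q - x) * x_3 q)"
  have "(?f \<longlongrightarrow> ?f (x_3 q)) (at (x_3 q))"
    using rate_pos x3_gt by (intro tendsto_intros) auto
  moreover have "?f (x_3 q) = q3"
  proof -
    have "(lamh1 q)\<^sup>2 * (x_3 q - x_1 q) * (x_3 q - x_2 q) * (x_4 q - x_3 q) * x_3 q
      = (lamh1 q)\<^sup>2 * ((x_3 q - x_1 q) * (x_3 q - x_2 q) * (x_4 q - x_3 q)) * x_3 q"
      by (simp only: mult.assoc)
    then have "sqrt ((lamh1 q)\<^sup>2 * (x_3 q - x_1 q) * (x_3 q - x_2 q) * (x_4 q - x_3 q) * x_3 q) = lamh1 q * W * sqrt (x_3 q)"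
      unfolding W_def using rate_pos by (simp only: real_sqrt_mult real_sqrt_abs abs_of_pos)
    then show ?thesis
      by (simp add: q3_def)
  qed
  ultimately have "(?f \<longlongrightarrow> q3) (at (x_3 q))"
    by simp
  then show "(q_fun q \<longlongrightarrow> q3) (at (x_3 q))"
  proof (rule Lim_transform_eventually)
    have "Delta q x / (1 - x / x_3 q) = (lamh1 q)\<^sup>2 * (x - x_1 q) * (x - x_2 q) * (x_4 q - x) * x_3 q" if "x \<noteq> x_3 q" for x
    proof -
      have "1 - x / x_3 q = (x_3 q - x) / x_3 q"
        using x3_gt by (simp add: field_simps)
      then show ?thesis
        unfolding Delta_factor using that x3_gt by simp
    qed
    then have "?f x = q_fun q x" if "x \<noteq> x_3 q" for x
      unfolding q_fun_def using that by simp
    then show "\<forall>\<^sub>F x in at (x_3 q). ?f x = q_fun q x"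
      by (simp add: eventually_at_filter)
  qed
qed simp

definition X3 :: "complex \<Rightarrow> complex" where "X3 t = of_real (x_3 q) * (1 - t\<^sup>2)"

text \<open>The branch \<open>Y0_c\<close> near its branch point \<open>x_3\<close>, uniformized by \<open>x = x_3 (1 - t\<^sup>2)\<close>.\<close>

definition Y3 :: "complex \<Rightarrow> complex" where
  "Y3 t = - bhat_c (X3 t) / (2 * of_real (lamh2 q) * X3 t) - cofactor (X3 t) * of_real (sqrt (x_3 q)) / (2 * of_real (lamh2 q) * X3 t) * t"

text \<open>\<open>slit_dom\<close> has \<open>x_3\<close> on its boundary. Here the cut starts only
  at \<open>x_4\<close>, so that \<open>x_3\<close> is interior and \<open>cofactor\<close> remains
  holomorphic.\<close>

definition outer_dom :: "complex set" where
  "outer_dom = {x. s0 < norm x \<and> of_real (x_4 q) - x \<notin> \<real>\<^sub>\<le>\<^sub>0}"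

lemma open_outer_dom: "open outer_dom"
proof -
  have "outer_dom = {x. s0 < norm x} \<inter> (\<lambda>x. of_real (x_4 q) - x) -` (- \<real>\<^sub>\<le>\<^sub>0)"
    by (auto simp: outer_dom_def)
  moreover have "open {x::complex. s0 < norm x}"
    by (intro open_Collect_less continuous_intros)
  moreover have "open ((\<lambda>x. of_real (x_4 q) - x) -` (- \<real>\<^sub>\<le>\<^sub>0) :: complex set)"
    by (intro open_vimage continuous_intros) (auto simp: open_Compl)
  ultimately show ?thesis
    by auto
qed

lemma x3_outer: "of_real (x_3 q) \<in> outer_dom"
  using branch_points(4,5) x3_gt by (auto simp: outer_dom_def complex_nonpos_Reals_iff)

lemma outer_nonzero: "x \<in> outer_dom \<Longrightarrow> x \<noteq> 0"
  using s0_pos by (auto simp: outer_dom_def)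

lemma X3_0: "X3 0 = of_real (x_3 q)"
  by (simp add: X3_def)

lemma X3_deriv: "(X3 has_field_derivative 0) (at 0)"
  unfolding X3_def by (auto intro!: derivative_eq_intros)

lemma open_X3_outer: "open (X3 -` outer_dom)"
  unfolding X3_def by (intro open_vimage open_outer_dom continuous_intros)

lemma X3_holomorphic: "X3 holomorphic_on A"
  unfolding X3_def by (intro holomorphic_intros)

lemma cofactor_X3_holomorphic: "(\<lambda>t. cofactor (X3 t)) holomorphic_on X3 -` outer_dom"
proof -
  have "(cofactor \<circ> X3) holomorphic_on X3 -` outer_dom"
    by (rule holomorphic_on_compose_gen[OF X3_holomorphic cofactor_holomorphic]) (auto simp: outer_dom_def)
  then show ?thesis
    by (simp add: o_def)
qed

lemma Y3_holomorphic: "Y3 holomorphic_on X3 -` outer_dom"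
  unfolding Y3_def bhat_c_def using rate_pos outer_nonzero
  by (intro holomorphic_intros cofactor_X3_holomorphic X3_holomorphic) auto

lemma Y3_0: "Y3 0 = of_real \<sigma>"
proof -
  have "disc_root (of_real (x_3 q)) = 0"
    by (simp add: disc_root_def)
  then have "Y3 0 = Y0_c (of_real (x_3 q))"
    by (simp add: Y3_def Y0_c_def X3_0)
  also have "\<dots> = of_real (Y0 q (x_3 q))"
    by (rule Y_c_of_real(1)[OF branch_points(4) order.refl])
  finally show ?thesis
    by (simp add: Y0_x3)
qed

lemma Y3_deriv: "(Y3 has_field_derivative of_real q3) (at 0)"
proof -
  let ?A = "\<lambda>x. - bhat_c x / (2 * of_real (lamh2 q) * x)"
  let ?B = "\<lambda>x. cofactor x * of_real (sqrt (x_3 q)) / (2 * of_real (lamh2 q) * x)"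
  have "?A holomorphic_on outer_dom"
    unfolding bhat_c_def using rate_pos outer_nonzero by (intro holomorphic_intros) auto
  then obtain A' where "(?A has_field_derivative A') (at (X3 0))"
    unfolding X3_0 using holomorphic_derivI[OF _ open_outer_dom x3_outer] by blast
  then have A: "((\<lambda>t. ?A (X3 t)) has_field_derivative A' * 0) (at 0)"
    by (rule DERIV_chain2[OF _ X3_deriv])
  have "cofactor holomorphic_on outer_dom"
    unfolding outer_dom_def by (rule cofactor_holomorphic)
  then have "?B holomorphic_on outer_dom"
    using rate_pos outer_nonzero by (intro holomorphic_intros) auto
  then obtain B' where "(?B has_field_derivative B') (at (X3 0))"
    unfolding X3_0 using holomorphic_derivI[OF _ open_outer_dom x3_outer] by blast
  then have B: "((\<lambda>t. ?B (X3 t)) has_field_derivative B' * 0) (at 0)"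
    by (rule DERIV_chain2[OF _ X3_deriv])
  have "((\<lambda>t. ?A (X3 t) - ?B (X3 t) * t) has_field_derivative A' * 0 - (B' * 0 * 0 + 1 * ?B (X3 0))) (at 0)"
    by (intro DERIV_diff DERIV_mult A B DERIV_ident)
  moreover have "A' * 0 - (B' * 0 * 0 + 1 * ?B (X3 0)) = of_real q3"
    unfolding X3_0 cofactor_x3 q3_def by simp
  ultimately show ?thesis
    unfolding Y3_def[abs_def] by simp
qed

text \<open>\<open>Re t > 0\<close> makes \<open>sqrt x_3 * t\<close> the principal square root of
  \<open>x_3 - X3 t\<close>, so this half-plane parametrizes the sheet of
  \<open>Y0_c\<close>.\<close>

lemma Y3_branch:
  assumes "X3 t \<in> outer_dom" "Re t > 0"
  shows "X3 t \<in> slit_dom" "Y0_c (X3 t) = Y3 t"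
proof -
  have d: "of_real (x_3 q) - X3 t = of_real (x_3 q) * t\<^sup>2"
    by (simp add: X3_def algebra_simps)
  have sq: "(of_real (sqrt (x_3 q)) * t)\<^sup>2 = of_real (x_3 q) - X3 t"
    unfolding d using x3_gt by (simp add: power_mult_distrib flip: of_real_power)
  have c: "csqrt (of_real (x_3 q) - X3 t) = of_real (sqrt (x_3 q)) * t"
    by (rule csqrt_unique[OF sq]) (use assms(2) x3_gt in simp)
  have "of_real (x_3 q) - X3 t \<notin> \<real>\<^sub>\<le>\<^sub>0"
  proof
    assume "of_real (x_3 q) - X3 t \<in> \<real>\<^sub>\<le>\<^sub>0"
    then have *: "Im (of_real (x_3 q) * t\<^sup>2) = 0" "Re (of_real (x_3 q) * t\<^sup>2) \<le> 0"
      unfolding d by (auto simp: complex_nonpos_Reals_iff)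
    then have "Re t * Im t = 0" "(Re t)\<^sup>2 - (Im t)\<^sup>2 \<le> 0"
      using x3_gt by (auto simp: power2_eq_square mult_le_0_iff)
    then show False
      using assms(2) by simp
  qed
  then show "X3 t \<in> slit_dom"
    using assms(1) by (simp add: slit_dom_def outer_dom_def)
  show "Y0_c (X3 t) = Y3 t"
    unfolding Y0_c_def Y3_def disc_root_def c by (simp add: diff_divide_distrib)
qed

lemma Y3_neighbourhood:
  assumes "continuous_on (X3 -` outer_dom) f" "f 0 \<noteq> (0::complex)"
  obtains \<delta> where "\<delta> > 0" "\<And>t. norm t < \<delta> \<Longrightarrow> X3 t \<in> outer_dom \<and> norm (Y3 t) < R2 \<and> f t \<noteq> 0"
proof -
  let ?S = "((X3 -` outer_dom) \<inter> (\<lambda>t. norm (Y3 t)) -` {..<R2}) \<inter> ((X3 -` outer_dom) \<inter> f -` (- {0}))"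
  have cY: "continuous_on (X3 -` outer_dom) (\<lambda>t. norm (Y3 t))"
    by (intro continuous_intros holomorphic_on_imp_continuous_on Y3_holomorphic)
  have "open ?S"
    by (rule open_Int[OF continuous_open_preimage[OF cY open_X3_outer] continuous_open_preimage[OF assms(1) open_X3_outer]]) auto
  moreover have "0 \<in> ?S"
    using x3_outer assms(2) R2 \<sigma> by (simp add: X3_0 Y3_0)
  ultimately obtain \<delta> where "\<delta> > 0" "ball 0 \<delta> \<subseteq> ?S"
    by (meson open_contains_ball_eq)
  then show ?thesis
    using that[of \<delta>] by (auto simp: subset_iff)
qed

end

section \<open>Tail asymptotics\<close>

context retrial_disc begin

lemma R_gt1: "1 < R"
  using R s0 by linarith

text \<open>Since \<open>x - R = - R * t ^ 2\<close>, the simple pole of \<open>ext\<close> at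
  \<open>R\<close> is a double pole in \<open>t\<close>; hence \<open>k = 2\<close>, with
  \<open>Gamma 1 = 1\<close> and no power of \<open>n\<close>. Extending the fraction by
  \<open>h1_c\<close> on the other branch replaces the denominator by an explicit
  polynomial.\<close>

lemma pole_coefficients:
  assumes Rp: "R = x_plus q" and lt: "R < x_3 q" and zero: "h1 q R (Y0 q R) = 0"
  shows "(\<lambda>n. P (Suc n, 0, Busy) * R ^ n * real n powr 0) \<longlonglongrightarrow> C1 q P" "C1 q P \<noteq> 0"
proof -
  note b = branch_values[OF R_gt1 R(2)]
  define A where "A = muh2 q * lam q * lam1 q / (alpha q * (lam q + mu1 q))"
  have A: "A > 0"
    unfolding A_def using rate_pos param_pos by simp
  have prod: "h1_c x (Y0_c x) * h1_c x (Y1_c x) = of_real A * (x - 1) * (x - of_real R) * (x - of_real (x_minus q))"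
    if "x \<noteq> 0" for x
  proof -
    have "complex_of_real (alpha q * (lam q + mu1 q)) \<noteq> 0"
      using rate_pos param_pos by (simp del: of_real_mult of_real_add)
    moreover have "z = M / K * u * v * w" if "K * z = M * u * v * w" "K \<noteq> 0" for K M z u v w :: complex
      using that by (simp add: field_simps)
    ultimately show ?thesis
      using h1_c_product[OF that] unfolding A_def Rp of_real_divide by blast
  qed
  define X where "X t = of_real R * (1 - t\<^sup>2)" for t :: complex
  \<comment> \<open>The half-plane keeps away from \<open>x_minus < 0\<close> and
    \<open>slit_dom\<close> from 1, so that \<open>D\<close> has no zero on
    \<open>T\<close>.\<close>
  define T where "T = slit_dom \<inter> (\<lambda>x. norm (Y0_c x)) -` {..<R2} \<inter> {x. Re x > 0}"
  have "open T"
  proof -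
    have "continuous_on slit_dom (\<lambda>x. norm (Y0_c x))"
      by (intro continuous_intros holomorphic_on_imp_continuous_on Y_c_holomorphic)
    then show ?thesis
      unfolding T_def
      by (intro open_Int open_halfspace_Re_gt continuous_open_preimage[OF _ open_slit_dom]) auto
  qed
  then have oX: "open (X -` T)"
    unfolding X_def by (intro open_vimage continuous_intros)
  have Rs: "of_real R \<in> slit_dom"
    by (rule annulus_slit_dom) (use R lt R_pos in auto)
  have nY: "norm (Y0_c (of_real R)) < R2"
    using norm_Y0_c_le[OF Rs] R R_pos R2 by simp
  have "0 \<in> X -` T"
    using Rs nY R_pos by (simp add: X_def T_def)
  with oX obtain \<delta> where \<delta>: "\<delta> > 0" "ball 0 \<delta> \<subseteq> X -` T"
    by (meson open_contains_ball_eq)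
  define D where "D x = of_real (A * R) * (x - 1) * (x - of_real (x_minus q))" for x :: complex
  have D0: "D x \<noteq> 0" if "x \<in> T" for x
  proof -
    have "x \<noteq> 1"
      using that s0 by (auto simp: T_def slit_dom_def)
    moreover have "x \<noteq> of_real (x_minus q)"
      using that g_factor(1) by (auto simp: T_def)
    ultimately show ?thesis
      unfolding D_def using A R_pos by simp
  qed
  define H where "H t = N_c (X t) (Y0_c (X t)) * h1_c (X t) (Y1_c (X t)) / D (X t)" for t
  have sub: "X ` ball 0 \<delta> \<subseteq> slit_dom"
    using \<delta> by (auto simp: T_def)
  have Xh: "X holomorphic_on ball 0 \<delta>"
    unfolding X_def by (intro holomorphic_intros)
  have Yh: "(\<lambda>t. Y0_c (X t)) holomorphic_on ball 0 \<delta>" "(\<lambda>t. Y1_c (X t)) holomorphic_on ball 0 \<delta>"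
    using holomorphic_on_compose_gen[OF Xh Y_c_holomorphic(1) sub] holomorphic_on_compose_gen[OF Xh Y_c_holomorphic(2) sub]
    by (simp_all add: o_def)
  have Hh: "H holomorphic_on ball 0 \<delta>"
  proof -
    have "(\<lambda>t. D (X t)) holomorphic_on ball 0 \<delta>"
      unfolding D_def by (intro holomorphic_intros Xh)
    moreover have "(\<lambda>t. N_c (X t) (Y0_c (X t))) holomorphic_on ball 0 \<delta>"
      by (rule N_c_holomorphic[OF Xh Yh(1)]) (use \<delta> in \<open>auto simp: T_def\<close>)
    moreover have "D (X t) \<noteq> 0" if "t \<in> ball 0 \<delta>" for t
      using \<delta> that by (intro D0) auto
    ultimately show ?thesis
      unfolding H_def by (intro holomorphic_on_divide holomorphic_on_mult h_c_holomorphic Xh Yh)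
  qed
  have local: "of_real R * (1 - t\<^sup>2) \<in> ext_dom \<and> ext (of_real R * (1 - t\<^sup>2)) * t ^ 2 = H t"
    if t: "Re t > 0" "norm t < \<delta>" for t
  proof -
    define x where "x = X t"
    have xT: "x \<in> T"
      using \<delta> t by (auto simp: x_def)
    have t0: "t \<noteq> 0"
      using t by auto
    have x0: "x \<noteq> 0"
      using xT slit_dom_nonzero by (auto simp: T_def)
    have xR: "x - of_real R = - (of_real R * t\<^sup>2)"
      by (simp add: x_def X_def algebra_simps)
    have pr: "h1_c x (Y0_c x) * h1_c x (Y1_c x) = - (D x * t\<^sup>2)"
      unfolding prod[OF x0] xR D_def by (simp add: algebra_simps)
    then have nz: "h1_c x (Y0_c x) \<noteq> 0" "h1_c x (Y1_c x) \<noteq> 0"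
      using D0[OF xT] t0 by auto
    have "ext x * t\<^sup>2 = N_c x (Y0_c x) * (- (D x * t\<^sup>2)) / (h1_c x (Y0_c x) * D x)"
      unfolding ext_def using D0[OF xT] by simp
    also have "\<dots> = N_c x (Y0_c x) * h1_c x (Y1_c x) / D x"
      unfolding pr[symmetric] using nz(1) by simp
    finally have "ext x * t\<^sup>2 = H t"
      by (simp add: H_def x_def)
    moreover have "x \<in> ext_dom"
      using xT nz by (auto simp: ext_dom_def T_def)
    ultimately show ?thesis
      by (simp add: x_def X_def)
  qed
  \<comment> \<open>As \<open>h1\<close> vanishes on \<open>Y0\<close>, its value on
    \<open>Y1\<close> is \<open>lam2 * R\<close> times the gap between the branches; this is the
    origin of \<open>sqrt Delta\<close> in \<open>C1\<close>.\<close>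
  have diff: "h1 q R (Y1 q R) = sqrt (Delta q R) / alpha q"
  proof -
    have "h1 q R (Y1 q R) = h1 q R (Y1 q R) - h1 q R (Y0 q R)"
      using zero by simp
    also have "\<dots> = lam2 q * R * (Y1 q R - Y0 q R)"
      unfolding h1_def a1_def by (simp add: algebra_simps)
    also have "Y1 q R - Y0 q R = sqrt (Delta q R) / (lamh2 q * R)"
      unfolding b(1,2) Y_plus_def Y_minus_def diff_divide_distrib[symmetric] by simp
    finally show ?thesis
      using R_pos param_pos by (simp add: lamh2_def)
  qed
  have "H 0 = of_real (N q P R (Y0 q R) * h1 q R (Y1 q R) / (A * R * (R - 1) * (R - x_minus q)))"
  proof -
    have "\<bar>Y0 q R\<bar> < R2"
      using Y0_le_\<sigma>[OF R_gt1 R(2)] b(3) R2 by linarith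
    then show ?thesis
      unfolding H_def X_def D_def using Y_c_of_real(1,2)[OF R] by (simp add: N_c_of_real of_real_boundary)
  qed
  also have "N q P R (Y0 q R) * h1 q R (Y1 q R) / (A * R * (R - 1) * (R - x_minus q)) = C1 q P"
    unfolding C1_def Rp[symmetric] diff A_def using rate_pos by (simp add: mult_ac)
  finally have H0: "H 0 = of_real (C1 q P)" .
  show "(\<lambda>n. P (Suc n, 0, Busy) * R ^ n * real n powr 0) \<longlonglongrightarrow> C1 q P"
    using coeff_limit[OF Hh \<delta>(1) H0 local] by simp
  have "N q P R (Y0 q R) > 0"
    by (rule N_pos[OF R_gt1 R(2) zero])
  moreover have "sqrt (Delta q R) > 0"
    using between_branch_points(3)[OF R_gt1 R(2) lt] by simp
  ultimately show "C1 q P \<noteq> 0"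
    unfolding C1_def Rp[symmetric] using rate_pos param_pos R_gt1 g_factor(1) by simp
qed

text \<open>The zero of \<open>h1\<close> meets the branch point. The part of \<open>h1\<close> that
  is even in \<open>t\<close> vanishes at 0 and thus to second order, while the odd part starts with
  a linear term coming from \<open>cofactor\<close>; so \<open>h1\<close> has a simple zero in
  \<open>t\<close>, \<open>k = 1\<close>, and \<open>Gamma (1 / 2) = sqrt pi\<close>.\<close>

lemma merged_coefficients:
  assumes R3: "R = x_3 q" and zero: "h1 q R (Y0 q R) = 0"
  shows "(\<lambda>n. P (Suc n, 0, Busy) * R ^ n * real n powr (1 / 2)) \<longlonglongrightarrow> C2 q P R / sqrt pi" "C2 q P R \<noteq> 0"
proof -
  \<comment> \<open>The coefficients of \<open>x ^ 2\<close> and \<open>x\<close> in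
    \<open>p1\<close>, that is, in \<open>h1\<close> with \<open>y\<close> replaced by the mean of
    the two branches. \<open>\<kappa>\<close> is the quotient of \<open>h1\<close> by
    \<open>t\<close>.\<close>
  define pa pb where "pa = lam1 q / 2" and "pb = (lamh1 q + lamh2 q + muh1 q + muh2 q) / (2 * alpha q) - (lam q + ca)"
  define \<kappa> where "\<kappa> t = - (of_real (x_3 q) * t * (of_real pa * (X3 t + of_real (x_3 q)) + of_real pb))
     - cofactor (X3 t) * of_real (sqrt (x_3 q) / (2 * alpha q))" for t
  have \<alpha>0: "complex_of_real (alpha q) \<noteq> 0"
    using rate_pos by simp
  have l2: "lam2 q \<noteq> 0"
    using param_pos by simp
  have expand: "h1_c (X3 t) (Y3 t) = of_real pa * (X3 t)\<^sup>2 + of_real pb * X3 t + of_real (ca - muh1 q / (2 * alpha q))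
      - cofactor (X3 t) * of_real (sqrt (x_3 q) / (2 * alpha q)) * t" if "X3 t \<noteq> 0" for t
  proof -
    define s m C where "s = (lamh1 q + lamh2 q + muh1 q + muh2 q) / (2 * alpha q)" and "m = muh1 q / (2 * alpha q)"
      and "C = cofactor (X3 t) * of_real (sqrt (x_3 q) / (2 * alpha q)) * t"
    have e1: "of_real (lam2 q) * X3 t * Y3 t = - (bhat_c (X3 t) / of_real (2 * alpha q)) - C"
      unfolding Y3_def lamh2_def C_def using that \<alpha>0 l2 by (simp add: right_diff_distrib)
    have e2: "bhat_c (X3 t) / of_real (2 * alpha q) = of_real pa * (X3 t)\<^sup>2 - of_real s * X3 t + of_real m"
    proof -
      have "(A * X\<^sup>2 - S * X + M) / T = A / T * X\<^sup>2 - S / T * X + M / T" for A X S M T :: complex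
        by (simp add: add_divide_distrib diff_divide_distrib)
      moreover have "pa = lamh1 q / (2 * alpha q)"
        unfolding lamh1_def pa_def using rate_pos by simp
      ultimately show ?thesis
        unfolding bhat_c_def s_def m_def of_real_divide by (simp only: of_real_divide)
    qed
    have l: "lam1 q = pa + pa"
      by (simp add: pa_def)
    show ?thesis
      unfolding h1_c_def e1 e2 pb_def s_def[symmetric] m_def[symmetric] C_def[symmetric] l
      by (simp add: algebra_simps)
  qed
  have root: "pa * (x_3 q)\<^sup>2 + pb * x_3 q + (ca - muh1 q / (2 * alpha q)) = 0"
  proof -
    have "h1_c (X3 0) (Y3 0) = of_real (h1 q R (Y0 q R))"
      unfolding X3_0 Y3_0 R3 Y0_x3 by (rule of_real_boundary)
    moreover have "X3 0 \<noteq> 0"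
      using x3_gt by (simp add: X3_0)
    ultimately have "complex_of_real (pa * (x_3 q)\<^sup>2 + pb * x_3 q + (ca - muh1 q / (2 * alpha q))) = of_real 0"
      using expand[of 0] zero by (simp add: X3_0)
    then show ?thesis
      by (simp only: of_real_eq_iff)
  qed
  have fact: "h1_c (X3 t) (Y3 t) = t * \<kappa> t" if "X3 t \<noteq> 0" for t
  proof -
    have c: "ca - muh1 q / (2 * alpha q) = - (pa * (x_3 q)\<^sup>2) - pb * x_3 q"
      using root by linarith
    have "of_real pa * (X3 t)\<^sup>2 + of_real pb * X3 t + complex_of_real (ca - muh1 q / (2 * alpha q))
       = (X3 t - of_real (x_3 q)) * (of_real pa * (X3 t + of_real (x_3 q)) + of_real pb)"
      unfolding c by (simp add: power2_eq_square algebra_simps)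
    also have "X3 t - of_real (x_3 q) = - (of_real (x_3 q) * t * t)"
      by (simp add: X3_def power2_eq_square algebra_simps)
    finally show ?thesis
      unfolding expand[OF that] \<kappa>_def by (simp add: algebra_simps)
  qed
  have \<kappa>0: "\<kappa> 0 = of_real (- (lamh1 q * W * sqrt (x_3 q) / (2 * alpha q)))"
    unfolding \<kappa>_def X3_0 cofactor_x3 by simp
  have \<kappa>h: "\<kappa> holomorphic_on X3 -` outer_dom"
    unfolding \<kappa>_def by (intro holomorphic_intros X3_holomorphic cofactor_X3_holomorphic)
  have \<kappa>_ne: "\<kappa> 0 \<noteq> 0"
    unfolding \<kappa>0 using rate_pos W x3_gt by simp
  obtain \<delta> where \<delta>: "\<delta> > 0" "\<And>t. norm t < \<delta> \<Longrightarrow> X3 t \<in> outer_dom \<and> norm (Y3 t) < R2 \<and> \<kappa> t \<noteq> 0"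
    using Y3_neighbourhood[OF holomorphic_on_imp_continuous_on[OF \<kappa>h] \<kappa>_ne] by blast
  have sub: "ball 0 \<delta> \<subseteq> X3 -` outer_dom"
    using \<delta> by auto
  define H where "H t = - N_c (X3 t) (Y3 t) / \<kappa> t" for t
  have Hh: "H holomorphic_on ball 0 \<delta>"
    unfolding H_def using \<delta>
    by (intro holomorphic_intros X3_holomorphic holomorphic_on_subset[OF Y3_holomorphic sub] holomorphic_on_subset[OF \<kappa>h sub]) auto
  have local: "of_real R * (1 - t\<^sup>2) \<in> ext_dom \<and> ext (of_real R * (1 - t\<^sup>2)) * t ^ 1 = H t"
    if t: "Re t > 0" "norm t < \<delta>" for t
  proof -
    have o: "X3 t \<in> outer_dom" and nY: "norm (Y3 t) < R2" and \<kappa>: "\<kappa> t \<noteq> 0"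
      using \<delta>(2)[OF t(2)] by auto
    have t0: "t \<noteq> 0"
      using t by auto
    note br = Y3_branch[OF o t(1)]
    have h: "h1_c (X3 t) (Y0_c (X3 t)) = t * \<kappa> t"
      unfolding br(2) by (rule fact[OF outer_nonzero[OF o]])
    have "X3 t \<in> ext_dom"
      using br nY h \<kappa> t0 by (simp add: ext_dom_def)
    moreover have "ext (X3 t) * t = H t"
      unfolding ext_def h unfolding br(2) H_def using t0 by simp
    ultimately show ?thesis
      by (simp add: X3_def R3)
  qed
  have \<sigma>R: "\<bar>\<sigma>\<bar> < R2"
    using \<sigma> R2 by simp
  have "H 0 = of_real (- N q P R (Y0 q R) / (- (lamh1 q * W * sqrt (x_3 q) / (2 * alpha q))))"
    unfolding H_def \<kappa>0 X3_0 Y3_0 R3 Y0_x3 N_c_of_real[OF \<sigma>R] by simp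
  also have "- N q P R (Y0 q R) / (- (lamh1 q * W * sqrt (x_3 q) / (2 * alpha q))) = C2 q P R"
  proof -
    have "sqrt (R * (R - x_1 q) * (R - x_2 q) * (x_4 q - R)) = sqrt (x_3 q) * W"
      unfolding W_def R3 by (simp only: real_sqrt_mult mult_ac)
    then show ?thesis
      unfolding C2_def lamh1_def using rate_pos param_pos W by (simp add: field_simps)
  qed
  finally have H0: "H 0 = of_real (C2 q P R)" .
  show "(\<lambda>n. P (Suc n, 0, Busy) * R ^ n * real n powr (1 / 2)) \<longlonglongrightarrow> C2 q P R / sqrt pi"
    using coeff_limit[OF Hh \<delta>(1) H0 local] by (simp add: Gamma_one_half_real)
  have "N q P R (Y0 q R) > 0"
    by (rule N_pos[OF R_gt1 R(2) zero])
  moreover have "sqrt (R * (R - x_1 q) * (R - x_2 q) * (x_4 q - R)) > 0"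
    unfolding R3 using branch_points(1-7) x3_gt by simp
  ultimately have "C2 q P R > 0"
    unfolding C2_def by (intro mult_pos_pos divide_pos_pos) (auto simp: param_pos)
  then show "C2 q P R \<noteq> 0"
    by simp
qed

text \<open>The denominator does not vanish at \<open>x_3\<close>, so \<open>H\<close> is
  holomorphic at 0 and its linear coefficient \<open>q3 * slope\<close> governs the decay.\<close>

lemma branch_coefficients:
  assumes R3: "R = x_3 q" and neg: "h1 q R (Y0 q R) < 0"
  shows "(\<lambda>n. P (Suc n, 0, Busy) * R ^ n * real n powr (3 / 2)) \<longlonglongrightarrow> C3 q P * R / sqrt pi" "C3 q P \<noteq> 0"
proof -
  have hneg: "h1 q (x_3 q) \<sigma> < 0"
    using neg unfolding R3 Y0_x3 .
  have \<sigma>R: "\<bar>\<sigma>\<bar> < R2"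
    using \<sigma> R2 by simp
  obtain d where d: "d \<ge> 0" "deriv psi (of_real \<sigma>) = of_real d"
    using psi_deriv_real[of \<sigma>] \<sigma> R2 by auto
  have hh: "(\<lambda>t. h1_c (X3 t) (Y3 t)) holomorphic_on X3 -` outer_dom"
    by (intro holomorphic_intros X3_holomorphic Y3_holomorphic)
  have ne: "h1_c (X3 0) (Y3 0) \<noteq> 0"
    unfolding X3_0 Y3_0 of_real_boundary using hneg by simp
  obtain \<delta> where \<delta>: "\<delta> > 0" "\<And>t. norm t < \<delta> \<Longrightarrow> X3 t \<in> outer_dom \<and> norm (Y3 t) < R2 \<and> h1_c (X3 t) (Y3 t) \<noteq> 0"
    using Y3_neighbourhood[OF holomorphic_on_imp_continuous_on[OF hh] ne] by blast
  have sub: "ball 0 \<delta> \<subseteq> X3 -` outer_dom"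
    using \<delta> by auto
  define H where "H t = - N_c (X3 t) (Y3 t) / h1_c (X3 t) (Y3 t)" for t
  have Hh: "H holomorphic_on ball 0 \<delta>"
    unfolding H_def using \<delta>
    by (intro holomorphic_intros X3_holomorphic holomorphic_on_subset[OF Y3_holomorphic sub]) auto
  have local: "of_real R * (1 - t\<^sup>2) \<in> ext_dom \<and> ext (of_real R * (1 - t\<^sup>2)) = H t"
    if t: "Re t > 0" "norm t < \<delta>" for t
  proof -
    have o: "X3 t \<in> outer_dom" and nY: "norm (Y3 t) < R2" and h: "h1_c (X3 t) (Y3 t) \<noteq> 0"
      using \<delta>(2)[OF t(2)] by auto
    note br = Y3_branch[OF o t(1)]
    have "X3 t \<in> ext_dom"
      using br nY h by (simp add: ext_dom_def)
    moreover have "ext (X3 t) = H t"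
      unfolding ext_def br(2) H_def ..
    ultimately show ?thesis
      by (simp add: X3_def R3)
  qed
  have "(H has_field_derivative of_real (q3 * slope (x_3 q) \<sigma> d)) (at 0)"
    unfolding H_def[abs_def]
    by (rule complex_slope[OF \<sigma>R d(2) _ X3_deriv X3_0 Y3_deriv Y3_0]) (use hneg in simp)
  then have H': "deriv H 0 = of_real (q3 * slope (x_3 q) \<sigma> d)"
    by (rule DERIV_imp_deriv)
  have C3: "C3 q P = - (q3 / (2 * x_3 q)) * slope (x_3 q) \<sigma> d"
  proof -
    have "deriv (\<lambda>y. - (N q P (x_3 q) y / h1 q (x_3 q) y)) \<sigma> = slope (x_3 q) \<sigma> d"
      by (rule real_slope[OF \<sigma>R d(2)]) (use hneg in simp)
    then show ?thesis
      unfolding C3_def q_fun_limit Y0_x3 by simp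
  qed
  \<comment> \<open>The factor \<open>R\<close> offsets the \<open>x_3\<close> in the denominator of
    \<open>C3\<close>; this is why the third type has the exponent \<open>m - 2\<close> where the
    others have \<open>m - 1\<close>.\<close>
  have "- (q3 * slope (x_3 q) \<sigma> d) / (2 * sqrt pi) = C3 q P * R / sqrt pi"
    unfolding C3 R3 using x3_gt by simp
  then show "(\<lambda>n. P (Suc n, 0, Busy) * R ^ n * real n powr (3 / 2)) \<longlonglongrightarrow> C3 q P * R / sqrt pi"
    using coeff_limit_0[OF Hh \<delta>(1) H' local] by simp
  have "on_kernel (x_3 q) \<sigma>"
    using on_kernel_branch[OF x3_gt(1) order.refl] by (simp add: Y0_x3)
  then have "slope (x_3 q) \<sigma> d > 0"
    by (rule slope_pos[OF _ x3_gt(1) hneg d(1)])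
  then show "C3 q P \<noteq> 0"
    unfolding C3 q3_def using rate_pos W x3_gt by simp
qed

end

section \<open>From the boundary row to the rows \<open>n >= 1\<close>\<close>

lemma powr_Suc_ratio: "(\<lambda>n. real (Suc n) powr e / real n powr e) \<longlonglongrightarrow> 1"
  by real_asymp

context retrial begin

text \<open>Passing from the index of \<open>base\<close> to the orbit size \<open>m = Suc n\<close>
  costs the factor \<open>R\<close> in the limit; \<open>interior_ratio_limit\<close> then
  propagates it with \<open>w m\<close> equal to \<open>m powr (- e) / R ^ m\<close>. The sequence
  \<open>u\<close> is the profile across rows.\<close>

lemma row_asymptotics:
  assumes "R > 0" and base: "(\<lambda>n. P (Suc n, 0, Busy) * R ^ n * real n powr e) \<longlonglongrightarrow> L"
    and u: "u 0 = 1" "u 1 = - (b1 q R / c q R)"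
    and rec: "\<And>n. muh2 q * u (n + 2) = - bhat q R / R * u (n + 1) - lamh2 q * u n"
  shows "(\<lambda>m. P (m, n, Busy) * R ^ m * real m powr e) \<longlonglongrightarrow> L * R * u n"
proof -
  \<comment> \<open>\<open>0 powr (- e)\<close> is 0, but \<open>w\<close> must vanish nowhere;
    hence the separate value at \<open>m = 0\<close>.\<close>
  define w where "w m = (if m = 0 then 1 else real m powr (- e) * (1 / R) ^ m)" for m
  have w0: "w m \<noteq> 0" for m
    using \<open>R > 0\<close> by (simp add: w_def)
  have inv: "P (m, k, Busy) / w m = P (m, k, Busy) * R ^ m * real m powr e" if "m > 0" for m k
    using that \<open>R > 0\<close> by (simp add: w_def powr_minus power_divide field_simps)
  have w_lim: "(\<lambda>m. w (Suc m) / w m) \<longlonglongrightarrow> 1 / R"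
  proof -
    have "(\<lambda>m. (real (Suc m) powr (- e) / real m powr (- e)) * (1 / R)) \<longlonglongrightarrow> 1 * (1 / R)"
      by (intro tendsto_intros powr_Suc_ratio)
    then have "(\<lambda>m. (real (Suc m) powr (- e) / real m powr (- e)) * (1 / R)) \<longlonglongrightarrow> 1 / R"
      by simp
    then show ?thesis
    proof (rule Lim_transform_eventually)
      show "\<forall>\<^sub>F m in sequentially. (real (Suc m) powr (- e) / real m powr (- e)) * (1 / R) = w (Suc m) / w m"
        using eventually_gt_at_top[of 0]
      proof eventually_elim
        case (elim m)
        have "(1 / R) ^ m > 0"
          using \<open>R > 0\<close> by simp
        then show ?case
          using elim by (simp add: w_def del: of_nat_Suc)
      qed
    qed
  qed
  have base': "(\<lambda>m. P (m, 0, Busy) / w m) \<longlonglongrightarrow> L * R * u 0"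
  proof (rule LIMSEQ_imp_Suc)
    have "(\<lambda>n. P (Suc n, 0, Busy) * R ^ n * real n powr e * (real (Suc n) powr e / real n powr e) * R) \<longlonglongrightarrow> L * 1 * R"
      by (intro tendsto_intros base powr_Suc_ratio)
    then have "(\<lambda>n. P (Suc n, 0, Busy) * R ^ n * real n powr e * (real (Suc n) powr e / real n powr e) * R) \<longlonglongrightarrow> L * R * u 0"
      using u(1) by simp
    then show "(\<lambda>n. P (Suc n, 0, Busy) / w (Suc n)) \<longlonglongrightarrow> L * R * u 0"
    proof (rule Lim_transform_eventually)
      show "\<forall>\<^sub>F n in sequentially. P (Suc n, 0, Busy) * R ^ n * real n powr e * (real (Suc n) powr e / real n powr e) * R
          = P (Suc n, 0, Busy) / w (Suc n)"
        using eventually_gt_at_top[of 0]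
      proof eventually_elim
        case (elim n)
        then show ?case
          unfolding inv[OF zero_less_Suc] by (simp del: of_nat_Suc)
      qed
    qed
  qed
  have first: "L * R * u 1 = (lam1 q + lam2 q + mu1 q + mu2 q) / (mu q * mu2 q)
     * (lam1 q + lam2 q + mu q * mu1 q / (lam1 q + lam2 q + mu1 q) - mu q * mu1 q / (lam1 q + lam2 q + mu1 q) / R - lam1 q * R) * (L * R * u 0)"
  proof -
    have "- (b1 q R / c q R) = alpha q / muh2 q * (lam q + ca - ca / R - lam1 q * R)"
    proof -
      have b1_eq: "b1 q R = R * (lam1 q * R - (lam q + ca) + ca / R)"
        unfolding b1_def ca_def[symmetric] using \<open>R > 0\<close> by (simp add: power2_eq_square algebra_simps)
      show ?thesis
        unfolding c_def b1_eq using \<open>R > 0\<close> rate_pos by (simp add: field_simps)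
    qed
    then show ?thesis
      unfolding u tot_eq ca_def lam_def muh1_def muh2_def by simp
  qed
  have rec': "mu q * mu2 q * (L * R * u (k + 2)) = ((lam1 q + lam2 q + mu1 q + mu2 q) * (lam1 q + lam2 q) + mu q * (mu1 q + mu2 q)
      - mu q * mu1 q / R - (lam1 q + lam2 q + mu1 q + mu2 q) * lam1 q * R) * (L * R * u (k + 1))
      - (lam1 q + lam2 q + mu1 q + mu2 q) * lam2 q * (L * R * u k)" for k
  proof -
    have "- bhat q R / R = alpha q * (lam1 q + lam2 q) + mu q * (mu1 q + mu2 q) - mu q * mu1 q / R - alpha q * lam1 q * R"
      unfolding bhat_def lamh1_def lamh2_def muh1_def muh2_def using \<open>R > 0\<close> by (simp add: field_simps power2_eq_square)
    then have "mu q * mu2 q * u (k + 2) = (alpha q * (lam1 q + lam2 q) + mu q * (mu1 q + mu2 q) - mu q * mu1 q / R - alpha q * lam1 q * R) * u (k + 1)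
       - alpha q * lam2 q * u k"
      using rec[of k] by (simp add: muh2_def lamh2_def)
    then have "L * R * (mu q * mu2 q * u (k + 2)) = L * R * ((alpha q * (lam1 q + lam2 q) + mu q * (mu1 q + mu2 q) - mu q * mu1 q / R - alpha q * lam1 q * R) * u (k + 1)
       - alpha q * lam2 q * u k)"
      by (rule arg_cong)
    moreover have "v * (M * x) = v * (B * y - C * z) \<longleftrightarrow> M * (v * x) = B * (v * y) - C * (v * z)" for v M x B y C z :: real
      by (simp add: algebra_simps)
    ultimately show ?thesis
      unfolding tot_eq by blast
  qed
  have "(\<lambda>m. P (m, n, Busy) / w m) \<longlonglongrightarrow> L * R * u n"
    by (rule bal.interior_ratio_limit[where x = R, OF w0 w_lim _ base' first rec']) (use \<open>R > 0\<close> in simp)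
  then show ?thesis
    by (rule Lim_transform_eventually) (use eventually_gt_at_top[of 0] in eventually_elim, use inv in simp)
qed

text \<open>Agreement for \<open>m > j\<close> suffices; there the truncated subtraction
  \<open>m - j\<close> is genuine and \<open>real m\<close> is positive.\<close>

lemma tail_equiv_rowI:
  assumes "R > 0" and lim: "(\<lambda>m. f m * R ^ m * real m powr e) \<longlonglongrightarrow> K * R ^ j" and "K \<noteq> 0"
    and b: "\<And>m. m > j \<Longrightarrow> b m = K * real m powr (- e) * (1 / R) ^ (m - j)"
  shows "tail_equiv f b"
  unfolding tail_equiv_def
proof (rule Lim_transform_eventually)
  have "(\<lambda>m. f m * R ^ m * real m powr e / (K * R ^ j)) \<longlonglongrightarrow> K * R ^ j / (K * R ^ j)"
    using assms(1,3) by (intro tendsto_intros lim) auto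
  then show "(\<lambda>m. f m * R ^ m * real m powr e / (K * R ^ j)) \<longlonglongrightarrow> 1"
    using assms(1,3) by simp
  show "\<forall>\<^sub>F m in sequentially. f m * R ^ m * real m powr e / (K * R ^ j) = f m / b m"
    using eventually_gt_at_top[of j]
  proof eventually_elim
    case (elim m)
    have R: "R ^ m = R ^ (m - j) * R ^ j"
      using elim by (simp flip: power_add)
    show ?case
      unfolding b[OF elim] R using assms(1,3) elim by (simp add: powr_minus power_divide field_simps)
  qed
qed

lemma kernel_recursion:
  assumes x: "1 < x" "x \<le> x_3 q"
  shows "muh2 q * (1 / Y1 q x)\<^sup>2 = - bhat q x / x * (1 / Y1 q x) - lamh2 q"
proof -
  note b = branch_values[OF x]
  have y: "Y0 q x > 0" "Y1 q x > 0"
    using b(3,4) by auto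
  have "- bhat q x / x = lamh2 q * (Y0 q x + Y1 q x)"
    unfolding b(6) using x rate_pos by simp
  moreover have "muh2 q = lamh2 q * (Y0 q x * Y1 q x)"
    unfolding b(7) using rate_pos by simp
  ultimately show ?thesis
    using y by (simp add: field_simps power2_eq_square)
qed

lemma inverse_Y1:
  assumes x: "1 < x" "x \<le> x_3 q"
  shows "1 / Y1 q x = a1 q x * Y0 q x / c q x"
proof -
  note b = branch_values[OF x]
  have y: "Y1 q x > 0"
    using b(3,4) by auto
  have "a1 q x * Y0 q x / c q x = lamh2 q * Y0 q x / muh2 q"
    unfolding a1_def c_def lamh2_def using x rate_pos by (simp add: field_simps)
  also have "\<dots> = 1 / Y1 q x"
    using b(7) y rate_pos by (simp add: field_simps)
  finally show ?thesis ..
qed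

text \<open>Vanishing of \<open>h1\<close> turns the initial ratio \<open>- b1 / c\<close> into
  exactly \<open>1 / Y1\<close>, so the solution of the recurrence is purely geometric, with no
  component along the other root \<open>1 / Y0\<close>.\<close>

lemma geometric_row:
  assumes x: "1 < x" "x \<le> x_3 q" and zero: "h1 q x (Y0 q x) = 0"
    and base: "(\<lambda>n. P (Suc n, 0, Busy) * x ^ n * real n powr e) \<longlonglongrightarrow> L"
  shows "(\<lambda>m. P (m, n, Busy) * x ^ m * real m powr e) \<longlonglongrightarrow> L * x * (1 / Y1 q x) ^ n" "- (b1 q x / c q x) = 1 / Y1 q x"
proof -
  have "b1 q x = - (a1 q x * Y0 q x)"
    using zero unfolding h1_def by simp
  then show r: "- (b1 q x / c q x) = 1 / Y1 q x"
    unfolding inverse_Y1[OF x] by simp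
  have x0: "x > 0"
    using x by simp
  show "(\<lambda>m. P (m, n, Busy) * x ^ m * real m powr e) \<longlonglongrightarrow> L * x * (1 / Y1 q x) ^ n"
  proof (rule row_asymptotics[OF x0 base])
    fix k
    have "(1 / Y1 q x) ^ k * (muh2 q * (1 / Y1 q x)\<^sup>2) = (1 / Y1 q x) ^ k * (- bhat q x / x * (1 / Y1 q x) - lamh2 q)"
      unfolding kernel_recursion[OF x] ..
    then show "muh2 q * (1 / Y1 q x) ^ (k + 2) = - bhat q x / x * (1 / Y1 q x) ^ (k + 1) - lamh2 q * (1 / Y1 q x) ^ k"
      by (simp only: power_add power_one_right right_diff_distrib mult_ac)
  qed (use r in simp_all)
qed

text \<open>At \<open>x_3\<close> both characteristic roots equal \<open>1 / \<sigma>\<close>, so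
  the solution is a linear polynomial in \<open>n\<close> times a geometric sequence. The identity
  \<open>p1 = a1 * \<sigma> + b1\<close> measures how far the initial ratio is from the root and
  thereby produces the slope in \<open>n\<close>.\<close>

lemma double_root_row:
  assumes base: "(\<lambda>n. P (Suc n, 0, Busy) * x_3 q ^ n * real n powr e) \<longlonglongrightarrow> L" and n: "n \<ge> 1"
  shows "(\<lambda>m. P (m, n, Busy) * x_3 q ^ m * real m powr e) \<longlonglongrightarrow>
      L * x_3 q * ((- (b1 q (x_3 q) / c q (x_3 q)) + real (n - 1) * - (p1 q (x_3 q) / c q (x_3 q))) * (1 / Y1 q (x_3 q)) ^ (n - 1))"
proof -
  let ?x = "x_3 q"
  define r where "r = 1 / \<sigma>"
  define \<beta> where "\<beta> = - (p1 q ?x / c q ?x)"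
  have r: "r > 0"
    unfolding r_def using \<sigma> by simp
  have r_eq: "r = a1 q ?x * \<sigma> / c q ?x"
    using inverse_Y1[OF x3_gt(1) order.refl] by (simp add: Y0_x3 r_def)
  have bh: "- bhat q ?x / ?x = 2 * lamh2 q * \<sigma>"
    using branch_values(6)[OF x3_gt(1) order.refl] x3_gt rate_pos by (simp add: Y0_x3 field_simps)
  have "p1 q ?x = a1 q ?x * \<sigma> + b1 q ?x"
  proof -
    have bh': "bhat q ?x = - (2 * lamh2 q * \<sigma> * ?x)"
      using bh x3_gt by (simp add: field_simps)
    show ?thesis
      unfolding p1_def bh' using x3_gt rate_pos by (simp add: field_simps)
  qed
  then have first: "- (b1 q ?x / c q ?x) = \<beta> + r"
    unfolding \<beta>_def r_eq by (simp add: add_divide_distrib)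
  have m: "muh2 q = lamh2 q * \<sigma>\<^sup>2"
    using \<sigma>(2) rate_pos by (simp add: field_simps)
  have \<sigma>r: "\<sigma> * r = 1"
    unfolding r_def using \<sigma> by simp
  define u where "u n = (1 + real n * (\<sigma> * \<beta>)) * r ^ n" for n
  have "(\<lambda>m. P (m, n, Busy) * ?x ^ m * real m powr e) \<longlonglongrightarrow> L * ?x * u n"
  proof (rule row_asymptotics[OF x3_gt(2) base])
    show "u 0 = 1"
      by (simp add: u_def)
    have "u 1 = r + (\<sigma> * r) * \<beta>"
      by (simp add: u_def algebra_simps)
    then show "u 1 = - (b1 q ?x / c q ?x)"
      unfolding \<sigma>r first by simp
    fix k
    have "muh2 q * u (k + 2) = lamh2 q * (1 + real (k + 2) * (\<sigma> * \<beta>)) * (\<sigma> * r)\<^sup>2 * r ^ k"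
      unfolding u_def m by (simp add: power_add power2_eq_square mult_ac)
    also have "\<dots> = lamh2 q * (2 * (1 + real (k + 1) * (\<sigma> * \<beta>)) - (1 + real k * (\<sigma> * \<beta>))) * r ^ k"
      unfolding \<sigma>r by (simp add: algebra_simps)
    also have "\<dots> = 2 * lamh2 q * (\<sigma> * r) * (1 + real (k + 1) * (\<sigma> * \<beta>)) * r ^ k - lamh2 q * u k"
      unfolding \<sigma>r u_def by (simp add: algebra_simps)
    also have "\<dots> = - bhat q ?x / ?x * u (k + 1) - lamh2 q * u k"
      unfolding bh u_def by (simp add: mult_ac)
    finally show "muh2 q * u (k + 2) = - bhat q ?x / ?x * u (k + 1) - lamh2 q * u k" .
  qed
  moreover have "u n = (- (b1 q ?x / c q ?x) + real (n - 1) * \<beta>) * (1 / Y1 q ?x) ^ (n - 1)"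
  proof -
    obtain k where k: "n = Suc k"
      using n by (cases n) auto
    have "u n = (r + real n * \<beta> * (\<sigma> * r)) * r ^ k"
      unfolding u_def k by (simp add: algebra_simps)
    also have "\<dots> = (\<beta> + r + real k * \<beta>) * r ^ k"
      unfolding \<sigma>r k by (simp add: algebra_simps)
    finally show ?thesis
      unfolding first Y0_x3(2) r_def[symmetric] k by simp
  qed
  ultimately show ?thesis
    unfolding \<beta>_def by simp
qed

lemma disc_locale:
  assumes "dominant_singularity (gf1 P) (complex_of_real R)" "s0 < R" "R \<le> x_3 q" "h1 q R (Y0 q R) \<le> 0"
  shows "retrial_disc q P R"
proof
  show "summable (\<lambda>j. gf1 P j * z ^ j)" if "norm z < R" for z
    by (rule summable_inside_dominant[OF assms(1) zero_less_one gf_summable_unit(1)]) (use that assms(2) s0_pos in auto)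
qed (use assms in auto)

end

theorem theorem6p4:
  fixes q :: retrial_params and P :: "state \<Rightarrow> real" and x_dom :: real and n :: nat
  assumes "retrial_model q" and "stable_queue q" and "lamh1 q < muh1 q"
    and "stationary_distribution q P"
    and "dominant_singularity (gf1 P) (complex_of_real x_dom)"
    and "n \<ge> 1"
  shows
    "(ereal x_dom = x_star q \<and> x_star q = ereal (x_plus q) \<and> x_plus q < x_3 q \<longrightarrow>
        tail_equiv (\<lambda>m. P (m, n, Busy))
          (\<lambda>m. A1 q P (x_plus q) * (1 / Y1 q (x_plus q)) ^ (n - 1) * (1 / x_plus q) ^ (m - 1)))
     \<and>
     (x_dom = x_3 q \<and> ereal (x_3 q) = x_star q \<and> x_star q = ereal (x_plus q) \<longrightarrow>
        tail_equiv (\<lambda>m. P (m, n, Busy))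
          (\<lambda>m. A2 q P x_dom / sqrt pi * (1 / Y1 q x_dom) ^ (n - 1)
                * real m powr (- 1 / 2) * (1 / x_dom) ^ (m - 1)))
     \<and>
     (x_dom = x_3 q \<and> ereal (x_3 q) < x_star q \<and> x_star q = \<infinity> \<longrightarrow>
        tail_equiv (\<lambda>m. P (m, n, Busy))
          (\<lambda>m. (A3 q P (x_3 q) + real (n - 1) * B3 q P (x_3 q)) / sqrt pi
                * (1 / Y1 q (x_3 q)) ^ (n - 1)
                * real m powr (- 3 / 2) * (1 / x_3 q) ^ (m - 2)))"
proof (intro conjI impI)
  interpret retrial q P
    by standard (use assms in auto)
  obtain k where n: "n = Suc k"
    using assms(6) by (cases n) auto
  {
    assume hyp: "ereal x_dom = x_star q \<and> x_star q = ereal (x_plus q) \<and> x_plus q < x_3 q"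
    let ?x = "x_plus q"
    have star: "x_star q = ereal ?x" and lt: "?x < x_3 q" and xd: "x_dom = ?x"
      using hyp by auto
    note xs = x_star_finite[OF star]
    have gt: "s0 < ?x" "1 < ?x"
      using xs s0 by linarith+
    interpret retrial_disc q P ?x
      by (rule disc_locale) (use assms(5) xd gt xs in auto)
    note coeff = pole_coefficients[OF refl lt xs(3)]
    note row = geometric_row[OF gt(2) xs(2,3) coeff(1)]
    have Y1: "Y1 q ?x > 0"
      using branch_values(3,4)[OF gt(2) xs(2)] by simp
    show "tail_equiv (\<lambda>m. P (m, n, Busy)) (\<lambda>m. A1 q P ?x * (1 / Y1 q ?x) ^ (n - 1) * (1 / ?x) ^ (m - 1))"
    proof (rule tail_equiv_rowI[where e = 0 and j = 1 and K = "A1 q P ?x * (1 / Y1 q ?x) ^ (n - 1)"])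
      \<comment> \<open>Here \<open>- b1 / c\<close> is \<open>1 / Y1\<close>, so \<open>A1\<close>
        contributes the one power that lifts the exponent from \<open>n - 1\<close> to
        \<open>n\<close>.\<close>
      have "A1 q P ?x = 1 / Y1 q ?x * C1 q P"
        unfolding A1_def row(2) ..
      then have K: "A1 q P ?x * (1 / Y1 q ?x) ^ (n - 1) = C1 q P * (1 / Y1 q ?x) ^ n"
        unfolding n by simp
      show "(\<lambda>m. P (m, n, Busy) * ?x ^ m * real m powr 0) \<longlonglongrightarrow> A1 q P ?x * (1 / Y1 q ?x) ^ (n - 1) * ?x ^ 1"
        unfolding K using row(1)[of n] by (simp add: mult_ac)
      show "A1 q P ?x * (1 / Y1 q ?x) ^ (n - 1) \<noteq> 0"
        unfolding K using coeff(2) Y1 by simp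
    qed (use gt in auto)
  next
    assume hyp: "x_dom = x_3 q \<and> ereal (x_3 q) = x_star q \<and> x_star q = ereal (x_plus q)"
    have star: "x_star q = ereal (x_plus q)" and x3: "x_3 q = x_plus q" and xd: "x_dom = x_3 q"
      using hyp by auto
    note xs = x_star_finite[OF star, folded x3]
    interpret retrial_disc q P "x_3 q"
      by (rule disc_locale) (use assms(5) xd branch_points(4) xs in auto)
    note coeff = merged_coefficients[OF refl xs(3)]
    note row = geometric_row[OF x3_gt(1) order.refl xs(3) coeff(1)]
    have Y1: "Y1 q (x_3 q) > 0"
      using \<sigma> by (simp add: Y0_x3)
    show "tail_equiv (\<lambda>m. P (m, n, Busy)) (\<lambda>m. A2 q P x_dom / sqrt pi * (1 / Y1 q x_dom) ^ (n - 1)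
        * real m powr (- 1 / 2) * (1 / x_dom) ^ (m - 1))"
      unfolding xd
    proof (rule tail_equiv_rowI[where e = "1 / 2" and j = 1 and R = "x_3 q" and K = "A2 q P (x_3 q) / sqrt pi * (1 / Y1 q (x_3 q)) ^ (n - 1)"])
      have "A2 q P (x_3 q) = 1 / Y1 q (x_3 q) * C2 q P (x_3 q)"
        unfolding A2_def row(2) ..
      then have K: "A2 q P (x_3 q) / sqrt pi * (1 / Y1 q (x_3 q)) ^ (n - 1) = C2 q P (x_3 q) / sqrt pi * (1 / Y1 q (x_3 q)) ^ n"
        unfolding n by simp
      show "(\<lambda>m. P (m, n, Busy) * x_3 q ^ m * real m powr (1 / 2)) \<longlonglongrightarrow> A2 q P (x_3 q) / sqrt pi * (1 / Y1 q (x_3 q)) ^ (n - 1) * x_3 q ^ 1"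
        unfolding K using row(1)[of n] by (simp add: mult_ac)
      show "A2 q P (x_3 q) / sqrt pi * (1 / Y1 q (x_3 q)) ^ (n - 1) \<noteq> 0"
        unfolding K using coeff(2) Y1 by simp
    qed (use x3_gt in auto)
  next
    assume hyp: "x_dom = x_3 q \<and> ereal (x_3 q) < x_star q \<and> x_star q = \<infinity>"
    then have xd: "x_dom = x_3 q" and neg: "h1 q (x_3 q) (Y0 q (x_3 q)) < 0"
      using x_star_infinite by auto
    interpret retrial_disc q P "x_3 q"
      by (rule disc_locale) (use assms(5) xd branch_points(4) neg in auto)
    note coeff = branch_coefficients[OF refl neg]
    have Y1: "Y1 q (x_3 q) > 0"
      using \<sigma> by (simp add: Y0_x3)
    let ?A = "- (b1 q (x_3 q) / c q (x_3 q))" and ?B = "- (p1 q (x_3 q) / c q (x_3 q))"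
    have K: "(A3 q P (x_3 q) + real (n - 1) * B3 q P (x_3 q)) / sqrt pi * (1 / Y1 q (x_3 q)) ^ (n - 1)
        = C3 q P / sqrt pi * ((?A + real (n - 1) * ?B) * (1 / Y1 q (x_3 q)) ^ (n - 1))"
    proof -
      have "A3 q P (x_3 q) + real (n - 1) * B3 q P (x_3 q) = C3 q P * (?A + real (n - 1) * ?B)"
        unfolding A3_def B3_def by (simp add: algebra_simps)
      then show ?thesis
        by simp
    qed
    \<comment> \<open>The constants \<open>A3\<close> and \<open>(n - 1) * B3\<close> must not
      cancel; they do not, because \<open>b1\<close> and \<open>p1\<close>, which equals
      \<open>h1\<close> at \<open>\<sigma>\<close>, are both negative at \<open>x_3\<close>.\<close>
    have pos: "?A > 0" "?B > 0"
    proof -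
      have c0: "c q (x_3 q) > 0"
        unfolding c_def using rate_pos x3_gt by simp
      have bh: "bhat q (x_3 q) = - (2 * lamh2 q * x_3 q * \<sigma>)"
        using branch_values(6)[OF x3_gt(1) order.refl] x3_gt rate_pos by (simp add: Y0_x3 field_simps)
      have "p1 q (x_3 q) = h1 q (x_3 q) \<sigma>"
        unfolding p1_def h1_def bh using x3_gt rate_pos by simp
      then have "p1 q (x_3 q) < 0"
        using neg by (simp add: Y0_x3)
      with c0 show "?B > 0"
        by (simp add: divide_neg_pos)
      have "b1 q (x_3 q) < 0"
        using neg \<sigma> param_pos x3_gt unfolding Y0_x3 h1_def a1_def by (smt (verit) mult_pos_pos)
      with c0 show "?A > 0"
        by (simp add: divide_neg_pos)
    qed
    show "tail_equiv (\<lambda>m. P (m, n, Busy)) (\<lambda>m. (A3 q P (x_3 q) + real (n - 1) * B3 q P (x_3 q)) / sqrt pi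
        * (1 / Y1 q (x_3 q)) ^ (n - 1) * real m powr (- 3 / 2) * (1 / x_3 q) ^ (m - 2))"
    proof (rule tail_equiv_rowI[where e = "3 / 2" and j = 2 and R = "x_3 q"])
      show "(\<lambda>m. P (m, n, Busy) * x_3 q ^ m * real m powr (3 / 2)) \<longlonglongrightarrow>
          (A3 q P (x_3 q) + real (n - 1) * B3 q P (x_3 q)) / sqrt pi * (1 / Y1 q (x_3 q)) ^ (n - 1) * x_3 q ^ 2"
        unfolding K using double_root_row[OF coeff(1) assms(6)] by (simp add: power2_eq_square mult_ac)
      have "?A + real (n - 1) * ?B > 0"
        using pos by (intro add_pos_nonneg mult_nonneg_nonneg) auto
      then show "(A3 q P (x_3 q) + real (n - 1) * B3 q P (x_3 q)) / sqrt pi * (1 / Y1 q (x_3 q)) ^ (n - 1) \<noteq> 0"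
        unfolding K using coeff(2) Y1 by simp
    qed (use x3_gt in auto)
  }
qed

end
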